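(* Let $M\cong\mathbb Z^2$ and let $\Xi\subset M_{\mathbb R}$ be a smooth tropical curve constructed from a unimodal regular subdivision $(P,\nu)$ of a convex lattice polytope $P\subset N_{\mathbb R}$. Let $\hat\Xi\subset M_{\mathbb R}\times N_{\mathbb R}/N$ be its Lagrangian PL lift. Then there exists a one-parameter family $\mathcal L_t$ ($t\in(0,1]$) of smooth Lagrangian submanifolds of $T^*T=M_{\mathbb R}\times N_{\mathbb R}/N$ such that (a) for all $t$, $\mathcal L_t$ is homeomorphic to $\hat\Xi$; (b) as $t\to0$, $\mathcal L_t$ converges to $\hat\Xi$ in the Hausdorff topology.
   Context: Setting. $M\cong\mathbb Z^{2}$ is a lattice, $N=\mathrm{Hom}(M,\mathbb Z)$, $M_{\mathbb R}=M\otimes\mathbb R$, $N_{\mathbb R}=N\otimes\mathbb R$, $\langle\cdot,\cdot\rangle$ is the duality pairing, $T=N_{\mathbb R}/N$. The cotangent bundle $T^*T=M_{\mathbb R}\times N_{\mathbb R}/N$ carries the symplectic form induced by $\omega(m\oplus n,m'\oplus n')=\langle m,n'\rangle-\langle m',n\rangle$. Tropical curves. A convex lattice polytope $P\subset N_{\mathbb R}$ is the convex hull of finitely many points of $N$. A subdivision of $P$ into lattice polytopes $P_1,\dots,P_k$ is regular if there is a convex piecewise affine $\nu:P\to\mathbb R$ with $\nu(P\cap N)\subset\mathbb Z$ whose domains of linearity are the $P_i$; $(P,\nu)$ also denotes the set of all the $P_i$ and all their faces. The subdivision is unimodal if all the $P_i$ are elementary simplices (triangles whose edge vectors at a vertex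 form a basis of $N$). Put $\check\nu(m)=\min\{\langle v,m\rangle+\nu(v): v\in P\cap N\}$ for $m\in M_{\mathbb R}$. The tropical curve $\Xi$ associated to $(P,\nu)$ is the set of points where $\check\nu$ is not smooth; it is smooth if the subdivision is unimodal. For each $e\in(P,\nu)$ of dimension $k\in\{1,2\}$, the dual face $\check e$ of $\Xi$ (of dimension $2-k$) is the locus where the minimum defining $\check\nu$ is attained by all the affine functions corresponding to the vertices of $e$. PL lift. For $e\in(P,\nu)$ of dimension $1$ or $2$, let $\bar C_e^+=\{[y]\in N_{\mathbb R}/N: 2(y-k)\in e\text{ for some }k\in N\}$. A point $[y]$ is a vertex of it if $2(y-k)$ is a vertex of $e$ for some $k\in N$. Let $C_e^+$ be the set of $[y]$ which are either vertices or relative interior points of $\bar C_e^+$ (i.e. $2(y-k)$ is a vertex or a relative interior point of $e$ for some $k\in N$), let $C_e^-$ be its image under $[y]\mapsto[-y]$, and $C_e=C_e^+\cup C_e^-$. The Lagrangian PL lift of $\Xi$ is $\hat\Xi=\bigcup_e \check e\times C_e$, the union over all $e\in(P,\nu)$ of dimension $1$ and $2$. Hausdorff convergence is with respect to the product of a Euclidean metric on $M_{\mathbb R}$ and a flat metric on $T$. *)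

theory Defs
  imports "HOL-Analysis.Analysis"
begin

section \<open>Lattices, the torus and the cotangent bundle\<close>

text \<open>
  A basis of \<open>M\<close> and the dual basis of \<open>N\<close> are fixed. Both real vector spaces become
  \<open>\<real>\<^sup>2\<close>, both lattices the integer vectors, and the duality pairing the dot product.
\<close>

type_synonym MR = "real ^ 2"
type_synonym NR = "real ^ 2"

definition lattice_N :: "NR set" where
  "lattice_N = {n. \<forall>i. n $ i \<in> \<int>}"

definition lattice_basis :: "NR \<Rightarrow> NR \<Rightarrow> bool" where
  "lattice_basis u w \<longleftrightarrow> u \<in> lattice_N \<and> w \<in> lattice_N \<and>
     (\<forall>n\<in>lattice_N. \<exists>!(a :: int, b :: int). n = of_int a *\<^sub>R u + of_int b *\<^sub>R w)"

lemma lattice_N_zero: "0 \<in> lattice_N"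
  by (simp add: lattice_N_def)

lemma lattice_N_add: "x \<in> lattice_N \<Longrightarrow> y \<in> lattice_N \<Longrightarrow> x + y \<in> lattice_N"
  by (simp add: lattice_N_def)

lemma lattice_N_minus: "x \<in> lattice_N \<Longrightarrow> - x \<in> lattice_N"
  by (simp add: lattice_N_def)

lemma lattice_N_diff: "x \<in> lattice_N \<Longrightarrow> y \<in> lattice_N \<Longrightarrow> x - y \<in> lattice_N"
  by (simp add: lattice_N_def)

lemma closed_lattice_N: "closed lattice_N"
proof -
  have "lattice_N = (\<Inter>i. (\<lambda>n. n $ i) -` \<int>)"
    by (auto simp: lattice_N_def)
  also have "closed \<dots>"
    by (intro closed_INT ballI closed_vimage closed_Ints continuous_intros)
  finally show ?thesis .
qed

definition lattice_rel :: "NR \<Rightarrow> NR \<Rightarrow> bool" where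
  "lattice_rel x y \<longleftrightarrow> x - y \<in> lattice_N"

quotient_type torus = NR / lattice_rel
  morphisms rep_torus to_torus
proof (rule equivpI)
  show "reflp lattice_rel"
    by (simp add: reflp_def lattice_rel_def lattice_N_zero)
  show "symp lattice_rel"
    using lattice_N_minus by (fastforce simp: symp_def lattice_rel_def)
  show "transp lattice_rel"
    using lattice_N_add by (fastforce simp: transp_def lattice_rel_def)
qed

instantiation torus :: uminus
begin

lift_definition uminus_torus :: "torus \<Rightarrow> torus" is "\<lambda>x. - x"
  using lattice_N_minus by (fastforce simp: lattice_rel_def)

instance ..

end

lemma infdist_lattice_le:
  "x - y \<in> lattice_N \<Longrightarrow> infdist x lattice_N \<le> infdist y lattice_N"
proof -
  assume xy: "x - y \<in> lattice_N"
  have ne: "lattice_N \<noteq> {}"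
    using lattice_N_zero by blast
  have "infdist x lattice_N \<le> dist y a" if "a \<in> lattice_N" for a
  proof -
    have "a + (x - y) \<in> lattice_N"
      using that xy by (rule lattice_N_add)
    then have "infdist x lattice_N \<le> dist x (a + (x - y))"
      by (rule infdist_le)
    also have "\<dots> = dist y a"
      by (simp add: dist_norm algebra_simps)
    finally show ?thesis .
  qed
  then show ?thesis
    using ne by (auto simp: infdist_def[of y] intro!: cINF_greatest)
qed

lemma infdist_lattice_cong:
  assumes "x - y \<in> lattice_N"
  shows "infdist x lattice_N = infdist y lattice_N"
proof (rule antisym)
  show "infdist x lattice_N \<le> infdist y lattice_N"
    by (rule infdist_lattice_le[OF assms])
  have "y - x \<in> lattice_N"
    using lattice_N_minus[OF assms] by simp
  then show "infdist y lattice_N \<le> infdist x lattice_N"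
    by (rule infdist_lattice_le)
qed

lemma infdist_lattice_attained: "\<exists>a\<in>lattice_N. infdist x lattice_N = norm (x - a)"
  using infdist_attains_inf[OF closed_lattice_N, of x] lattice_N_zero
  by (metis dist_norm empty_iff)

lemma infdist_lattice_minus: "infdist (- x) lattice_N = infdist x lattice_N"
proof -
  have le: "infdist (- x) lattice_N \<le> infdist x lattice_N" for x
  proof -
    obtain a where a: "a \<in> lattice_N" "infdist x lattice_N = norm (x - a)"
      using infdist_lattice_attained by blast
    have "infdist (- x) lattice_N \<le> dist (- x) (- a)"
      using a lattice_N_minus by (intro infdist_le) auto
    then show ?thesis
      using a by (simp add: dist_norm norm_minus_commute)
  qed
  show ?thesis
    using le[of x] le[of "- x"] by simp
qed

lemma infdist_lattice_add:
  "infdist (x + y) lattice_N \<le> infdist x lattice_N + infdist y lattice_N"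
proof -
  obtain a where a: "a \<in> lattice_N" "infdist x lattice_N = norm (x - a)"
    using infdist_lattice_attained by blast
  obtain b where b: "b \<in> lattice_N" "infdist y lattice_N = norm (y - b)"
    using infdist_lattice_attained by blast
  have "infdist (x + y) lattice_N \<le> dist (x + y) (a + b)"
    using a b lattice_N_add by (intro infdist_le) auto
  also have "\<dots> \<le> norm (x - a) + norm (y - b)"
    by (simp add: dist_norm norm_diff_triangle_ineq)
  finally show ?thesis
    using a b by simp
qed

text \<open>The flat metric on the torus: the distance of two classes is the infimum of the
  Euclidean distances of their representatives.\<close>

instantiation torus :: metric_space
begin

lift_definition dist_torus :: "torus \<Rightarrow> torus \<Rightarrow> real"
  is "\<lambda>x y. infdist (x - y) lattice_N"
proof -
  fix x x' y y' :: NR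
  assume "lattice_rel x x'" "lattice_rel y y'"
  then have "(x - x') - (y - y') \<in> lattice_N"
    unfolding lattice_rel_def by (rule lattice_N_diff)
  then show "infdist (x - y) lattice_N = infdist (x' - y') lattice_N"
    by (intro infdist_lattice_cong) (simp add: algebra_simps)
qed

definition uniformity_torus :: "(torus \<times> torus) filter" where
  "uniformity_torus = (INF e\<in>{0 <..}. principal {(x, y). dist x y < e})"

definition open_torus :: "torus set \<Rightarrow> bool" where
  "open_torus S = (\<forall>x\<in>S. \<forall>\<^sub>F (x', y) in uniformity. x' = x \<longrightarrow> y \<in> S)"

instance
proof
  fix x y z :: torus
  show "dist x y = 0 \<longleftrightarrow> x = y"
  proof transfer
    fix x y :: NR
    show "infdist (x - y) lattice_N = 0 \<longleftrightarrow> lattice_rel x y"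
      unfolding lattice_rel_def
      using in_closed_iff_infdist_zero[OF closed_lattice_N] lattice_N_zero by blast
  qed
  show "dist x y \<le> dist x z + dist y z"
  proof transfer
    fix x y z :: NR
    show "infdist (x - y) lattice_N \<le> infdist (x - z) lattice_N + infdist (y - z) lattice_N"
      using infdist_lattice_add[of "x - z" "z - y"] infdist_lattice_minus[of "z - y"] by simp
  qed
qed (simp_all add: uniformity_torus_def open_torus_def)

end

text \<open>The metric topology on the torus is the quotient topology.\<close>

lemma dist_to_torus_le: "dist (to_torus x) (to_torus y) \<le> dist x y"
  using infdist_le[OF lattice_N_zero, of "x - y"]
  by (simp add: dist_torus.abs_eq dist_norm)

lemma open_torus_iff: "open U \<longleftrightarrow> open (to_torus -` U)"
proof
  assume "open U"
  have "continuous_on UNIV to_torus"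
    unfolding continuous_on_iff using dist_to_torus_le by (meson le_less_trans)
  then show "open (to_torus -` U)"
    using \<open>open U\<close> by (simp add: open_vimage)
next
  assume op: "open (to_torus -` U)"
  show "open U"
    unfolding open_dist
  proof
    fix p assume "p \<in> U"
    obtain x where x: "p = to_torus x"
      by (metis Quotient3_abs_rep Quotient3_torus)
    obtain e where e: "e > 0" "\<And>y. dist y x < e \<Longrightarrow> to_torus y \<in> U"
      using op \<open>p \<in> U\<close> x unfolding open_dist by auto
    have "q \<in> U" if "dist q p < e" for q
    proof -
      obtain y where y: "q = to_torus y"
        by (metis Quotient3_abs_rep Quotient3_torus)
      obtain a where a: "a \<in> lattice_N" "infdist (y - x) lattice_N = norm (y - x - a)"
        using infdist_lattice_attained by blast
      have "dist (y - a) x < e"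
        using that a by (simp add: x y dist_torus.abs_eq dist_norm algebra_simps)
      moreover have "to_torus (y - a) = to_torus y"
        using lattice_N_minus[OF a(1)] by (simp add: torus.abs_eq_iff lattice_rel_def)
      ultimately show ?thesis
        using e y by metis
    qed
    then show "\<exists>e>0. \<forall>q. dist q p < e \<longrightarrow> q \<in> U"
      using e by blast
  qed
qed

text \<open>The type \<^typ>\<open>MR \<times> torus\<close> carries the product of the two metrics. Tangent vectors are
  elements of \<^typ>\<open>MR \<times> NR\<close>, through the covering map \<open>cover\<close>.\<close>

definition cover :: "MR \<times> NR \<Rightarrow> MR \<times> torus" where
  "cover = (\<lambda>(m, n). (m, to_torus n))"

definition symp_form :: "MR \<times> NR \<Rightarrow> MR \<times> NR \<Rightarrow> real" where
  "symp_form = (\<lambda>(m, n) (m', n'). m \<bullet> n' - m' \<bullet> n)"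


section \<open>Smooth Lagrangian submanifolds\<close>

text \<open>On an open set \<open>U\<close>, a function is \<open>C\<^sup>k\<^sup>+\<^sup>1\<close> iff it is differentiable and all its
  directional derivatives are \<open>C\<^sup>k\<close>.\<close>

primrec Ck_on ::
  "nat \<Rightarrow> ('a::euclidean_space \<Rightarrow> 'b::real_normed_vector) \<Rightarrow> 'a set \<Rightarrow> bool" where
  "Ck_on 0 f U \<longleftrightarrow> continuous_on U f"
| "Ck_on (Suc k) f U \<longleftrightarrow>
     (\<exists>f'. (\<forall>x\<in>U. (f has_derivative f' x) (at x)) \<and> (\<forall>v. Ck_on k (\<lambda>x. f' x v) U))"

definition smooth_on :: "('a::euclidean_space \<Rightarrow> 'b::real_normed_vector) \<Rightarrow> 'a set \<Rightarrow> bool" where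
  "smooth_on f U \<longleftrightarrow> open U \<and> (\<forall>k. Ck_on k f U)"

definition smooth_at :: "('a::euclidean_space \<Rightarrow> 'b::real_normed_vector) \<Rightarrow> 'a \<Rightarrow> bool" where
  "smooth_at f x \<longleftrightarrow> (\<exists>U. x \<in> U \<and> smooth_on f U)"

text \<open>A local parametrization of \<open>L\<close> near \<open>p\<close>: a smooth immersion \<open>\<phi>\<close> of an open subset of the
  plane, written in the linear coordinates of the universal cover, such that \<open>cover \<circ> \<phi>\<close> is a
  homeomorphism onto a relatively open subset of \<open>L\<close> containing \<open>p\<close>.\<close>

definition local_parametrization ::
  "(MR \<times> torus) set \<Rightarrow> MR \<times> torus \<Rightarrow> (real ^ 2) set \<Rightarrow> (real ^ 2 \<Rightarrow> MR \<times> NR) \<Rightarrow> bool" where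
  "local_parametrization L p U \<phi> \<longleftrightarrow>
     smooth_on \<phi> U \<and> (\<forall>u\<in>U. inj (frechet_derivative \<phi> (at u))) \<and>
     (\<exists>W \<psi>. open W \<and> p \<in> W \<and> homeomorphism U (L \<inter> W) (cover \<circ> \<phi>) \<psi>)"

definition lagrangian_immersion :: "(real ^ 2) set \<Rightarrow> (real ^ 2 \<Rightarrow> MR \<times> NR) \<Rightarrow> bool" where
  "lagrangian_immersion U \<phi> \<longleftrightarrow>
     (\<forall>u\<in>U. \<forall>a b. symp_form (frechet_derivative \<phi> (at u) a) (frechet_derivative \<phi> (at u) b) = 0)"

text \<open>Embedded submanifolds of dimension 2 (half of the ambient dimension) without boundary,
  on whose tangent spaces the symplectic form vanishes.\<close>

definition lagrangian_submanifold :: "(MR \<times> torus) set \<Rightarrow> bool" where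
  "lagrangian_submanifold L \<longleftrightarrow>
     (\<forall>p\<in>L. \<exists>U \<phi>. local_parametrization L p U \<phi> \<and> lagrangian_immersion U \<phi>)"


section \<open>Tropical curves\<close>

definition lattice_polytope :: "NR set \<Rightarrow> bool" where
  "lattice_polytope P \<longleftrightarrow> (\<exists>V. finite V \<and> V \<subseteq> lattice_N \<and> P = convex hull V)"

definition lattice_subdivision :: "NR set \<Rightarrow> NR set set \<Rightarrow> bool" where
  "lattice_subdivision P \<P> \<longleftrightarrow>
     finite \<P> \<and> (\<forall>Q\<in>\<P>. lattice_polytope Q) \<and> \<Union>\<P> = P \<and>
     (\<forall>Q\<in>\<P>. \<forall>R\<in>\<P>. Q \<inter> R face_of Q \<and> Q \<inter> R face_of R)"

definition is_affine_on :: "(NR \<Rightarrow> real) \<Rightarrow> NR set \<Rightarrow> bool" where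
  "is_affine_on \<nu> D \<longleftrightarrow> (\<exists>m c. \<forall>v\<in>D. \<nu> v = v \<bullet> m + c)"

text \<open>The domains of linearity of \<open>\<nu>\<close> on \<open>P\<close>: the inclusion-maximal convex subsets of \<open>P\<close> on
  which \<open>\<nu>\<close> is affine. Only the values of \<open>\<nu>\<close> on \<open>P\<close> matter.\<close>

definition linearity_domains :: "NR set \<Rightarrow> (NR \<Rightarrow> real) \<Rightarrow> NR set set" where
  "linearity_domains P \<nu> =
     {D. D \<subseteq> P \<and> convex D \<and> is_affine_on \<nu> D \<and>
         (\<forall>D'. D \<subseteq> D' \<and> D' \<subseteq> P \<and> convex D' \<and> is_affine_on \<nu> D' \<longrightarrow> D' = D)}"

text \<open>Piecewise affinity of \<open>\<nu>\<close> is contained in the first two conditions on \<open>\<P>\<close>: \<open>P\<close> is covered by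
  finitely many polytopes on each of which \<open>\<nu>\<close> is affine.\<close>

definition regular_subdivision :: "NR set \<Rightarrow> (NR \<Rightarrow> real) \<Rightarrow> NR set set \<Rightarrow> bool" where
  "regular_subdivision P \<nu> \<P> \<longleftrightarrow>
     lattice_subdivision P \<P> \<and> \<P> = linearity_domains P \<nu> \<and>
     convex_on P \<nu> \<and> \<nu> ` (P \<inter> lattice_N) \<subseteq> \<int>"

definition elementary_simplex :: "NR set \<Rightarrow> bool" where
  "elementary_simplex Q \<longleftrightarrow>
     (\<exists>v0 v1 v2. {v0, v1, v2} \<subseteq> lattice_N \<and> Q = convex hull {v0, v1, v2} \<and>
        lattice_basis (v1 - v0) (v2 - v0))"

definition unimodal :: "NR set set \<Rightarrow> bool" where
  "unimodal \<P> \<longleftrightarrow> (\<forall>Q\<in>\<P>. elementary_simplex Q)"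

definition cells :: "NR set set \<Rightarrow> NR set set" where
  "cells \<P> = {e. \<exists>Q\<in>\<P>. e face_of Q}"

definition legendre :: "NR set \<Rightarrow> (NR \<Rightarrow> real) \<Rightarrow> MR \<Rightarrow> real" where
  "legendre P \<nu> m = Min ((\<lambda>v. v \<bullet> m + \<nu> v) ` (P \<inter> lattice_N))"

definition tropical_curve :: "NR set \<Rightarrow> (NR \<Rightarrow> real) \<Rightarrow> MR set" where
  "tropical_curve P \<nu> = {m. \<not> smooth_at (legendre P \<nu>) m}"

definition dual_face :: "NR set \<Rightarrow> (NR \<Rightarrow> real) \<Rightarrow> NR set \<Rightarrow> MR set" where
  "dual_face P \<nu> e = {m. \<forall>v. v extreme_point_of e \<longrightarrow> v \<bullet> m + \<nu> v = legendre P \<nu> m}"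


section \<open>The Lagrangian PL lift\<close>

definition C_plus :: "NR set \<Rightarrow> torus set" where
  "C_plus e = {to_torus y | y. \<exists>k\<in>lattice_N.
     2 *\<^sub>R (y - k) extreme_point_of e \<or> 2 *\<^sub>R (y - k) \<in> rel_interior e}"

definition C_minus :: "NR set \<Rightarrow> torus set" where
  "C_minus e = uminus ` C_plus e"

definition C_cell :: "NR set \<Rightarrow> torus set" where
  "C_cell e = C_plus e \<union> C_minus e"

definition PL_lift :: "NR set \<Rightarrow> (NR \<Rightarrow> real) \<Rightarrow> NR set set \<Rightarrow> (MR \<times> torus) set" where
  "PL_lift P \<nu> \<P> = (\<Union>e \<in> {e \<in> cells \<P>. aff_dim e \<in> {1, 2}}. dual_face P \<nu> e \<times> C_cell e)"


section \<open>Hausdorff convergence\<close>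

text \<open>The Hausdorff distance of \<open>A\<close> and \<open>B\<close>, as an extended real (the sets may be unbounded), is
  the infimum of all \<open>\<epsilon>\<close> with \<open>hausdorff_close \<epsilon> A B\<close>.\<close>

definition hausdorff_close :: "real \<Rightarrow> ('a::metric_space) set \<Rightarrow> 'a set \<Rightarrow> bool" where
  "hausdorff_close \<epsilon> A B \<longleftrightarrow>
     (\<forall>a\<in>A. \<exists>b\<in>B. dist a b < \<epsilon>) \<and> (\<forall>b\<in>B. \<exists>a\<in>A. dist a b < \<epsilon>)"

definition hausdorff_converges ::
  "('i \<Rightarrow> ('a::metric_space) set) \<Rightarrow> 'a set \<Rightarrow> 'i filter \<Rightarrow> bool" where
  "hausdorff_converges A B F \<longleftrightarrow> (\<forall>\<epsilon>>0. \<forall>\<^sub>F i in F. hausdorff_close \<epsilon> (A i) B)"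

end

theory Submission
  imports Defs "HOL-Complex_Analysis.Complex_Analysis"
begin

text \<open>The Lagrangian PL lift is smooth except over the vertices of the tropical curve. Over the interior
  of an edge it is a flat Lagrangian cylinder: the edge times the circle in the direction of the dual
  edge (lemma \<open>lagrangian_at_PL_lift\<close>). Over a vertex three such cylinders end on the two triangles in
  the fibre. It therefore suffices to replace a small neighbourhood of each vertex by a smooth
  Lagrangian piece that coincides with the cylinders outside a smaller neighbourhood and is
  homeomorphic to what it replaces.

  Since the subdivision is unimodular, every vertex looks the same: a lattice isomorphism together with
  its inverse transpose carries the PL lift of the standard tropical line to the lift near the vertex
  (\<open>PL_lift_at_vertex\<close>). For the tropical line the smooth piece is found in complex geometry. In
  suitable coordinates \<open>M\<^sub>\<real> \<times> T\<close> is \<open>(\<complex>\<^sup>*)\<^sup>2\<close>, with the symplectic form a constant times the imaginary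
  part of \<open>dlog z \<and> dlog w\<close>; this form vanishes on complex curves, so these are Lagrangian. The line \<open>z + w = 1\<close>
  is a sphere with three punctures whose ends are asymptotic to the three cylinders, and the arguments
  of \<open>z\<close> and \<open>1 - z\<close>, being angles of the triangle with vertices \<open>0\<close>, \<open>1\<close>, \<open>z\<close>, lie in the two
  triangles of the PL lift (\<open>line_coamoeba\<close>).

  The ends are only asymptotic to cylinders, and they are straightened by hand. Over an end the line is
  the graph of a Hamiltonian vector field, with the imaginary part of the dilogarithm as potential.
  Multiplying the potential by a cut-off function keeps the graph Lagrangian (\<open>bendH_divergence\<close>,
  \<open>lagrangian_surface\<close>) and makes it equal to the cylinder beyond a large radius; the farther out
  this is done, the less the arguments change. A symmetry of order three permutes the ends, so one
  third of the line is treated and the others follow. On that third a homeomorphism to the PL model is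
  written down, radially on each ray, so that it is equivariant on the edges and the identity far out
  (\<open>profile_edge\<close>, \<open>surface_homeomorphism\<close>).

  Dilations of \<open>M\<^sub>\<real>\<close> multiply the symplectic form by a constant and preserve the tropical line, so the
  large radius can be scaled down to a multiple of \<open>t\<close>. Gluing the scaled pieces into the PL lift at
  all vertices gives \<open>\<L> t\<close> (\<open>smoothing\<close>, \<open>homeomorphic_patch\<close>), and the Hausdorff distance to the
  lift is of order \<open>t\<close>. That the pieces fit uses the duality of the subdivision and the curve: at the
  vertex dual to a triangle the minimum is attained exactly at the three corners
  (\<open>mins_dual_vertex\<close>), and at other points of the dual edges at two lattice points only
  (\<open>mins_edge\<close>).\<close>

section \<open>Calculus of smooth maps\<close>

lemma Ck_on_SucI:
  assumes "\<And>x. x \<in> U \<Longrightarrow> (f has_derivative f' x) (at x)" "\<And>v. Ck_on k (\<lambda>x. f' x v) U"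
  shows "Ck_on (Suc k) f U"
  unfolding Ck_on.simps(2) by (intro exI[of _ f'] conjI ballI allI assms)

lemma Ck_on_SucE:
  assumes "Ck_on (Suc k) f U"
  obtains f' where "\<And>x. x \<in> U \<Longrightarrow> (f has_derivative f' x) (at x)" "\<And>v. Ck_on k (\<lambda>x. f' x v) U"
proof -
  from assms obtain f' where "(\<forall>x\<in>U. (f has_derivative f' x) (at x)) \<and> (\<forall>v. Ck_on k (\<lambda>x. f' x v) U)"
    unfolding Ck_on.simps(2) by (rule exE)
  then show thesis by (intro that[of f']) simp_all
qed

lemma Ck_on_Suc_imp: "Ck_on (Suc k) f U \<Longrightarrow> Ck_on k f U"
proof (induction k arbitrary: f)
  case 0
  then obtain f' where "\<And>x. x \<in> U \<Longrightarrow> (f has_derivative f' x) (at x)"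
    by (rule Ck_on_SucE) (rule that)
  then show ?case
    by (auto intro!: continuous_at_imp_continuous_on dest: has_derivative_continuous)
next
  case (Suc k)
  from Suc.prems obtain f' where "\<And>x. x \<in> U \<Longrightarrow> (f has_derivative f' x) (at x)"
    "\<And>v. Ck_on (Suc k) (\<lambda>x. f' x v) U"
    by (rule Ck_on_SucE) (rule that)
  then show ?case by (rule Ck_on_SucI[OF _ Suc.IH])
qed

lemma Ck_on_imp_continuous: "Ck_on k f U \<Longrightarrow> continuous_on U f"
proof (induction k)
  case (Suc k)
  from Suc.IH[OF Ck_on_Suc_imp[OF Suc.prems]] show ?case .
qed simp


lemma Ck_on_subset: "Ck_on k f U \<Longrightarrow> V \<subseteq> U \<Longrightarrow> Ck_on k f V"
proof (induction k arbitrary: f)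
  case 0
  then show ?case using continuous_on_subset by auto
next
  case (Suc k)
  from Suc.prems(1) obtain f' where "\<And>x. x \<in> U \<Longrightarrow> (f has_derivative f' x) (at x)"
      "\<And>v. Ck_on k (\<lambda>x. f' x v) U"
    by (rule Ck_on_SucE) (rule that)
  then show ?case using Suc.prems(2)
    by (intro Ck_on_SucI[where f' = f'] Suc.IH) auto
qed

lemma Ck_on_const: "Ck_on k (\<lambda>x. c) U"
proof (induction k arbitrary: c)
  case (Suc k)
  then show ?case by (intro Ck_on_SucI[where f' = "\<lambda>x v. 0"] has_derivative_const)
qed simp

lemma Ck_on_bounded_linear:
  assumes "bounded_linear L" "Ck_on k f U"
  shows "Ck_on k (\<lambda>x. L (f x)) U"
  using assms(2)
proof (induction k arbitrary: f)
  case 0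
  then show ?case
    using bounded_linear.continuous_on[OF assms(1)] by auto
next
  case (Suc k)
  from Suc.prems obtain f' where f': "\<And>x. x \<in> U \<Longrightarrow> (f has_derivative f' x) (at x)"
      "\<And>v. Ck_on k (\<lambda>x. f' x v) U"
    by (rule Ck_on_SucE) (rule that)
  show ?case
  proof (rule Ck_on_SucI[where f' = "\<lambda>x v. L (f' x v)"])
    show "((\<lambda>x. L (f x)) has_derivative (\<lambda>v. L (f' x v))) (at x)" if "x \<in> U" for x
      by (rule bounded_linear.has_derivative[OF assms(1) f'(1)[OF that]])
    show "Ck_on k (\<lambda>x. L (f' x v)) U" for v
      by (rule Suc.IH[OF f'(2)])
  qed
qed

lemma Ck_on_linear: "bounded_linear L \<Longrightarrow> Ck_on k L U"
proof (cases k)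
  case (Suc j)
  assume "bounded_linear L"
  then show ?thesis unfolding Suc
    by (intro Ck_on_SucI[where f' = "\<lambda>x. L"] Ck_on_const bounded_linear_imp_has_derivative)
qed (simp add: linear_continuous_on)

lemma Ck_on_add:
  "Ck_on k f U \<Longrightarrow> Ck_on k g U \<Longrightarrow> Ck_on k (\<lambda>x. f x + g x) U"
proof (induction k arbitrary: f g)
  case 0
  then show ?case by (auto intro: continuous_intros)
next
  case (Suc k)
  from Suc.prems(1) obtain f' where f': "\<And>x. x \<in> U \<Longrightarrow> (f has_derivative f' x) (at x)"
      "\<And>v. Ck_on k (\<lambda>x. f' x v) U"
    by (rule Ck_on_SucE) (rule that)
  from Suc.prems(2) obtain g' where g': "\<And>x. x \<in> U \<Longrightarrow> (g has_derivative g' x) (at x)"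
      "\<And>v. Ck_on k (\<lambda>x. g' x v) U"
    by (rule Ck_on_SucE) (rule that)
  show ?case
  proof (rule Ck_on_SucI[where f' = "\<lambda>x v. f' x v + g' x v"])
    show "((\<lambda>x. f x + g x) has_derivative (\<lambda>v. f' x v + g' x v)) (at x)" if "x \<in> U" for x
      by (rule has_derivative_add[OF f'(1)[OF that] g'(1)[OF that]])
    show "Ck_on k (\<lambda>x. f' x v + g' x v) U" for v
      by (rule Suc.IH[OF f'(2) g'(2)])
  qed
qed

text \<open>The product rule and the chain rule with an affine map are all the calculus that is needed: the
  remaining smooth functions are holomorphic or built from the flat function.\<close>

lemma Ck_on_bilinear:
  assumes "bounded_bilinear pr"
  shows "Ck_on k f U \<Longrightarrow> Ck_on k g U \<Longrightarrow> Ck_on k (\<lambda>x. pr (f x) (g x)) U"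
proof (induction k arbitrary: f g)
  case 0
  then show ?case using bounded_bilinear.continuous_on[OF assms] by auto
next
  case (Suc k)
  from Suc.prems(1) obtain f' where f': "\<And>x. x \<in> U \<Longrightarrow> (f has_derivative f' x) (at x)"
      "\<And>v. Ck_on k (\<lambda>x. f' x v) U"
    by (rule Ck_on_SucE) (rule that)
  from Suc.prems(2) obtain g' where g': "\<And>x. x \<in> U \<Longrightarrow> (g has_derivative g' x) (at x)"
      "\<And>v. Ck_on k (\<lambda>x. g' x v) U"
    by (rule Ck_on_SucE) (rule that)
  show ?case
  proof (rule Ck_on_SucI[where f' = "\<lambda>x v. pr (f x) (g' x v) + pr (f' x v) (g x)"])
    show "((\<lambda>x. pr (f x) (g x)) has_derivative (\<lambda>v. pr (f x) (g' x v) + pr (f' x v) (g x))) (at x)"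
      if "x \<in> U" for x
      using that by (intro bounded_bilinear.FDERIV[OF assms] f' g')
    show "Ck_on k (\<lambda>x. pr (f x) (g' x v) + pr (f' x v) (g x)) U" for v
      by (intro Ck_on_add Suc.IH f' g' Ck_on_Suc_imp[OF Suc.prems(1)] Ck_on_Suc_imp[OF Suc.prems(2)])
  qed
qed

lemmas Ck_on_mult = Ck_on_bilinear[OF bounded_bilinear_mult]

lemma Ck_on_minus: "Ck_on k f U \<Longrightarrow> Ck_on k (\<lambda>x. - f x) U"
  using Ck_on_bounded_linear[OF bounded_linear_minus[OF bounded_linear_ident]] .

lemma Ck_on_diff:
  "Ck_on k f U \<Longrightarrow> Ck_on k g U \<Longrightarrow> Ck_on k (\<lambda>x. f x - g x) U"
  using Ck_on_add[OF _ Ck_on_minus, of k f U g] by simp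

lemma Ck_on_Pair:
  assumes "Ck_on k f U" "Ck_on k g U"
  shows "Ck_on k (\<lambda>x. (f x, g x)) U"
proof -
  have "Ck_on k (\<lambda>x. (f x, 0)) U"
    by (rule Ck_on_bounded_linear[OF _ assms(1)])
      (intro bounded_linear_Pair bounded_linear_ident bounded_linear_zero)
  moreover have "Ck_on k (\<lambda>x. (0, g x)) U"
    by (rule Ck_on_bounded_linear[OF _ assms(2)])
      (intro bounded_linear_Pair bounded_linear_ident bounded_linear_zero)
  ultimately have "Ck_on k (\<lambda>x. (f x, 0) + (0, g x)) U" by (rule Ck_on_add)
  then show ?thesis by simp
qed

lemma Ck_on_vec2:
  assumes "Ck_on k f U" "Ck_on k g U"
  shows "Ck_on k (\<lambda>x. vector [f x, g x] :: real^2) U"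
proof -
  have "Ck_on k (\<lambda>x. f x *\<^sub>R axis 1 1 + g x *\<^sub>R axis 2 1 :: real^2) U"
    by (intro Ck_on_add Ck_on_bounded_linear[OF bounded_linear_scaleR_left] assms)
  moreover have "f x *\<^sub>R axis 1 1 + g x *\<^sub>R axis 2 1 = (vector [f x, g x] :: real^2)" for x
    by (simp add: vec_eq_iff axis_def forall_2)
  ultimately show ?thesis by simp
qed

lemma Ck_on_precompose_linear:
  assumes "bounded_linear L"
  shows "Ck_on k f U \<Longrightarrow> Ck_on k (\<lambda>x. f (L x)) (L -` U)"
proof (induction k arbitrary: f)
  case 0
  have "continuous_on (L -` U) L" using assms linear_continuous_on by blast
  then show ?case using 0
    by (auto intro!: continuous_on_compose2[of U f "L -` U" L])
next
  case (Suc k)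
  from Suc.prems obtain f' where f': "\<And>x. x \<in> U \<Longrightarrow> (f has_derivative f' x) (at x)"
      "\<And>v. Ck_on k (\<lambda>x. f' x v) U"
    by (rule Ck_on_SucE) (rule that)
  show ?case
  proof (rule Ck_on_SucI[where f' = "\<lambda>x v. f' (L x) (L v)"])
    fix x assume "x \<in> L -` U"
    then show "((\<lambda>x. f (L x)) has_derivative (\<lambda>v. f' (L x) (L v))) (at x)"
      using has_derivative_compose[OF bounded_linear_imp_has_derivative[OF assms] f'(1)] by simp
  next
    show "Ck_on k (\<lambda>x. f' (L x) (L v)) (L -` U)" for v
      by (rule Suc.IH[OF f'(2)])
  qed
qed

lemma Ck_on_add_const:
  assumes "Ck_on k f U"
  shows "Ck_on k (\<lambda>x. f (x + c)) ((\<lambda>x. x + c) -` U)"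
  using assms
proof (induction k arbitrary: f)
  case 0
  then show ?case
    by (auto intro!: continuous_on_compose2[of U f] continuous_intros)
next
  case (Suc k)
  from Suc.prems obtain f' where f': "\<And>x. x \<in> U \<Longrightarrow> (f has_derivative f' x) (at x)"
      "\<And>v. Ck_on k (\<lambda>x. f' x v) U"
    by (rule Ck_on_SucE) (rule that)
  show ?case
  proof (rule Ck_on_SucI[where f' = "\<lambda>x. f' (x + c)"])
    fix x assume x: "x \<in> (\<lambda>x. x + c) -` U"
    have "((\<lambda>x. x + c) has_derivative (\<lambda>v. v)) (at x)"
      by (auto intro!: derivative_eq_intros)
    from has_derivative_compose[OF this f'(1)] x
    show "((\<lambda>x. f (x + c)) has_derivative f' (x + c)) (at x)" by simp
  next
    show "Ck_on k (\<lambda>x. f' (x + c) v) ((\<lambda>x. x + c) -` U)" for v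
      by (rule Suc.IH[OF f'(2)])
  qed
qed

lemma Ck_on_inverse:
  fixes f :: "'a::euclidean_space \<Rightarrow> real"
  assumes "Ck_on k f U" "\<And>x. x \<in> U \<Longrightarrow> f x \<noteq> 0"
  shows "Ck_on k (\<lambda>x. inverse (f x)) U"
  using assms
proof (induction k arbitrary: f)
  case 0
  then show ?case by (auto intro!: continuous_intros)
next
  case (Suc k)
  from Suc.prems(1) obtain f' where f': "\<And>x. x \<in> U \<Longrightarrow> (f has_derivative f' x) (at x)"
      "\<And>v. Ck_on k (\<lambda>x. f' x v) U"
    by (rule Ck_on_SucE) (rule that)
  show ?case
  proof (rule Ck_on_SucI[where f' = "\<lambda>x v. - (inverse (f x) * f' x v * inverse (f x))"])
    show "Ck_on k (\<lambda>x. - (inverse (f x) * f' x v * inverse (f x))) U" for v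
      by (intro Ck_on_minus Ck_on_mult f' Suc.IH Ck_on_Suc_imp[OF Suc.prems(1)] Suc.prems(2))
    show "((\<lambda>x. inverse (f x)) has_derivative (\<lambda>v. - (inverse (f x) * f' x v * inverse (f x)))) (at x)"
      if "x \<in> U" for x
      by (rule Deriv.has_derivative_inverse[OF Suc.prems(2)[OF that] f'(1)[OF that]])
  qed
qed

lemma holomorphic_Ck_on:
  assumes "open U" "f holomorphic_on U"
  shows "Ck_on k f U"
  using assms(2)
proof (induction k arbitrary: f)
  case 0
  then show ?case by (simp add: holomorphic_on_imp_continuous_on)
next
  case (Suc k)
  show ?case
  proof (rule Ck_on_SucI[where f' = "\<lambda>x v. deriv f x * v"])
    show "(f has_derivative (\<lambda>v. deriv f x * v)) (at x)" if "x \<in> U" for x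
      using holomorphic_derivI[OF Suc.prems assms(1) that] by (simp add: has_field_derivative_def)
    show "Ck_on k (\<lambda>x. deriv f x * v) U" for v
      by (intro Suc.IH holomorphic_on_mult holomorphic_on_const holomorphic_deriv Suc.prems assms(1))
  qed
qed

text \<open>All derivatives of \<open>exp (- 1 / x)\<close> are combinations of the functions below, and the
  family is closed under differentiation; this is what makes the flat function smooth at \<open>0\<close>.\<close>

definition flat_fun :: "nat \<Rightarrow> real \<Rightarrow> real" where
  "flat_fun j x = (if x > 0 then (1 / x) ^ j * exp (- 1 / x) else 0)"

lemma flat_fun_tendsto: "((\<lambda>x. flat_fun j x) \<longlongrightarrow> 0) (at 0)"
proof -
  have "((\<lambda>x. (1 / x) ^ j * exp (- 1 / x)) \<longlongrightarrow> 0) (at_right (0::real))"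
  proof -
    have "((\<lambda>y. y ^ j * exp (- y)) \<longlongrightarrow> 0) (at_top :: real filter)"
      using tendsto_power_div_exp_0[of j] by (simp add: exp_minus field_simps)
    then show ?thesis
      by (simp add: filterlim_at_top_to_right inverse_eq_divide)
  qed
  then have r: "((\<lambda>x. flat_fun j x) \<longlongrightarrow> 0) (at_right 0)"
    by (rule Lim_transform_eventually) (auto simp: eventually_at_right_less flat_fun_def
        eventually_at_filter)
  have l: "((\<lambda>x. flat_fun j x) \<longlongrightarrow> 0) (at_left 0)"
    by (rule Lim_transform_eventually[of "\<lambda>_. 0"]) (auto simp: flat_fun_def eventually_at_filter)
  from l r show ?thesis using filterlim_split_at by blast
qed

lemma flat_fun_deriv:
  "(flat_fun j has_real_derivative (flat_fun (j + 2) x - j * flat_fun (j + 1) x)) (at x)"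
proof -
  consider "x > 0" | "x < 0" | "x = 0" by linarith
  then show ?thesis
  proof cases
    case 1
    have "((\<lambda>x. (1 / x) ^ j * exp (- 1 / x)) has_real_derivative
        (j * (1 / x) ^ (j - 1) * (- 1 / x^2)) * exp (- 1 / x) + (1/x)^j * (exp (- 1 / x) * (1 / x^2))) (at x)"
      using 1 by (auto intro!: derivative_eq_intros simp: power2_eq_square)
    moreover have "(j * (1 / x) ^ (j - 1) * (- 1 / x^2)) * exp (- 1 / x) + (1/x)^j * (exp (- 1 / x) * (1 / x^2))
       = flat_fun (j + 2) x - j * flat_fun (j + 1) x"
      using 1 by (cases j) (auto simp: flat_fun_def power2_eq_square field_simps)
    ultimately have "((\<lambda>x. (1 / x) ^ j * exp (- 1 / x)) has_real_derivative
        flat_fun (j + 2) x - j * flat_fun (j + 1) x) (at x)" by simp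
    then show ?thesis
      using 1 by (elim has_field_derivative_transform_within_open[where S = "{0<..}"])
        (auto simp: flat_fun_def)
  next
    case 2
    have "((\<lambda>x. 0) has_real_derivative flat_fun (j + 2) x - j * flat_fun (j + 1) x) (at x)"
      using 2 by (auto simp: flat_fun_def)
    then show ?thesis
      using 2 by (elim has_field_derivative_transform_within_open[where S = "{..<0}"])
        (auto simp: flat_fun_def)
  next
    case 3
    have "((\<lambda>h. (flat_fun j (0 + h) - flat_fun j 0) / h) \<longlongrightarrow> 0) (at 0)"
      by (rule Lim_transform_eventually[OF flat_fun_tendsto[of "Suc j"]])
        (auto simp: flat_fun_def eventually_at_filter)
    then show ?thesis using 3 by (simp add: DERIV_def flat_fun_def)
  qed
qed

lemma Ck_on_flat_fun: "Ck_on k (flat_fun j) U"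
proof (induction k arbitrary: j)
  case 0
  then show ?case
    using flat_fun_deriv by (auto intro!: continuous_at_imp_continuous_on DERIV_isCont)
next
  case (Suc k)
  show ?case
  proof (rule Ck_on_SucI[where f' = "\<lambda>x v. (flat_fun (j + 2) x - j * flat_fun (j + 1) x) * v"])
    show "(flat_fun j has_derivative (\<lambda>v. (flat_fun (j + 2) x - j * flat_fun (j + 1) x) * v)) (at x)" for x
      using flat_fun_deriv[of j x] by (simp add: has_field_derivative_def)
    show "Ck_on k (\<lambda>x. (flat_fun (j + 2) x - j * flat_fun (j + 1) x) * v) U" for v
      by (intro Ck_on_mult Ck_on_diff Ck_on_const Suc)
  qed
qed

lemma smooth_cutoff_exists:
  obtains cut cut1 :: "real \<Rightarrow> real" and C where
    "\<And>k. Ck_on k cut UNIV" "\<And>k. Ck_on k cut1 UNIV" "\<And>x. (cut has_real_derivative cut1 x) (at x)"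
    "\<And>x. x \<le> 0 \<Longrightarrow> cut x = 1" "\<And>x. x \<ge> 1 \<Longrightarrow> cut x = 0" "\<And>x. 0 \<le> cut x \<and> cut x \<le> 1"
    "\<And>x. x \<le> 0 \<Longrightarrow> cut1 x = 0" "\<And>x. x \<ge> 1 \<Longrightarrow> cut1 x = 0" "C > 0" "\<And>x. \<bar>cut1 x\<bar> \<le> C"
proof -
  define cut where "cut x = flat_fun 0 (1 - x) * inverse (flat_fun 0 x + flat_fun 0 (1 - x))" for x
  have nn: "flat_fun 0 x \<ge> 0" for x by (simp add: flat_fun_def)
  have pos: "flat_fun 0 x + flat_fun 0 (1 - x) > 0" for x
    by (cases "x > 0"; cases "1 - x > 0") (auto simp: flat_fun_def intro!: add_pos_pos)
  have refl: "Ck_on k (\<lambda>x. flat_fun 0 (1 - x)) UNIV" for k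
  proof -
    have "Ck_on k (\<lambda>x. flat_fun 0 (- x + 1)) (uminus -` ((\<lambda>x. x + 1) -` UNIV))"
      by (rule Ck_on_precompose_linear[OF bounded_linear_minus[OF bounded_linear_ident]
            Ck_on_add_const[OF Ck_on_flat_fun]])
    moreover have "- x + 1 = 1 - x" for x :: real by simp
    ultimately show ?thesis by (simp only: vimage_UNIV)
  qed
  have ne: "flat_fun 0 x + flat_fun 0 (1 - x) \<noteq> 0" for x
    using pos[of x] by linarith
  have ck: "Ck_on k cut UNIV" for k
    unfolding cut_def
    by (rule Ck_on_mult[OF refl Ck_on_inverse[OF Ck_on_add[OF Ck_on_flat_fun refl] ne]])
  define cut1 where "cut1 x = deriv cut x" for x
  obtain d where d: "\<And>x. x \<in> UNIV \<Longrightarrow> (cut has_derivative d x) (at x)"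
    by (rule Ck_on_SucE[OF ck]) (rule that)
  have diff: "cut differentiable (at x)" for x
    using d[of x] unfolding differentiable_def by (intro exI[of _ "d x"]) simp
  then have der: "(cut has_real_derivative cut1 x) (at x)" for x
    unfolding cut1_def using DERIV_deriv_iff_real_differentiable by blast
  have ck1: "Ck_on k cut1 UNIV" for k
  proof -
    obtain f' where f': "\<And>x. x \<in> UNIV \<Longrightarrow> (cut has_derivative f' x) (at x)"
        "\<And>v. Ck_on k (\<lambda>x. f' x v) UNIV"
      by (rule Ck_on_SucE[OF ck]) (rule that)
    have "f' x = (*) (cut1 x)" for x
      by (rule has_derivative_unique[OF f'(1)[OF UNIV_I]]) (rule der[unfolded has_field_derivative_def])
    then have "cut1 = (\<lambda>x. f' x 1)" by simp
    then show ?thesis using f'(2)[of 1] by simp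
  qed
  have one: "cut x = 1" if "x \<le> 0" for x
    using that pos[of x] by (auto simp: cut_def flat_fun_def)
  have zero: "cut x = 0" if "x \<ge> 1" for x
    using that by (auto simp: cut_def flat_fun_def)
  have bd: "0 \<le> cut x \<and> cut x \<le> 1" for x
    using nn[of x] nn[of "1 - x"] pos[of x] unfolding cut_def by (auto simp: field_simps)
  have iso: "isCont cut1 x" for x
    using ck1[of 0] by (simp add: continuous_on_eq_continuous_at)
  have eq0: "cut1 x = 0" if "x < 0 \<or> x > 1" for x
  proof -
    have "(cut has_real_derivative 0) (at x)"
      using that
    proof
      assume "x < 0"
      then show ?thesis
        using one by (intro has_field_derivative_transform_within_open[OF DERIV_const[of 1], of "{..<0}"]) auto
    next
      assume "x > 1"
      then show ?thesis
        using zero by (intro has_field_derivative_transform_within_open[OF DERIV_const[of 0], of "{1<..}"]) auto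
    qed
    then show ?thesis using der DERIV_unique by blast
  qed
  have l0: "cut1 x = 0" if "x \<le> 0" for x
  proof (cases "x = 0")
    case True
    have "(cut1 \<longlongrightarrow> cut1 0) (at_left 0)"
      using iso[of 0] by (simp add: isCont_def filterlim_at_split)
    moreover have "(cut1 \<longlongrightarrow> 0) (at_left 0)"
      by (rule Lim_transform_eventually[of "\<lambda>_. 0"]) (auto simp: eq0 eventually_at_filter)
    ultimately show ?thesis using True tendsto_unique trivial_limit_at_left_real by blast
  qed (use that eq0 in auto)
  have l1: "cut1 x = 0" if "x \<ge> 1" for x
  proof (cases "x = 1")
    case True
    have "(cut1 \<longlongrightarrow> cut1 1) (at_right 1)"
      using iso[of 1] by (simp add: isCont_def filterlim_at_split)
    moreover have "(cut1 \<longlongrightarrow> 0) (at_right 1)"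
      by (rule Lim_transform_eventually[of "\<lambda>_. 0"]) (auto simp: eq0 eventually_at_filter)
    ultimately show ?thesis using True tendsto_unique trivial_limit_at_right_real by blast
  qed (use that eq0 in auto)
  have "compact (cut1 ` {0..1})"
    using ck1[of 0] by (intro compact_continuous_image) (auto intro: continuous_on_subset)
  then obtain C where C: "C > 0" "\<forall>y\<in>cut1 ` {0..1}. norm y \<le> C"
    using compact_imp_bounded bounded_pos by metis
  have "\<bar>cut1 x\<bar> \<le> C" for x
  proof (cases "0 \<le> x \<and> x \<le> 1")
    case True
    then show ?thesis using C by auto
  next
    case False
    then show ?thesis using eq0[of x] C by auto
  qed
  from that[OF ck ck1 der one zero bd l0 l1 C(1) this] show ?thesis .
qed

lemma smooth_onD: "smooth_on f U \<Longrightarrow> x \<in> U \<Longrightarrow> (f has_derivative frechet_derivative f (at x)) (at x)"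
proof -
  assume "smooth_on f U" "x \<in> U"
  then have "Ck_on (Suc 0) f U" unfolding smooth_on_def by blast
  then obtain f' where "\<And>x. x \<in> U \<Longrightarrow> (f has_derivative f' x) (at x)"
    by (rule Ck_on_SucE) (rule that)
  with \<open>x \<in> U\<close> have "f differentiable (at x)" unfolding differentiable_def by (intro exI[of _ "f' x"]) simp
  then show ?thesis using frechet_derivative_works by blast
qed

no_notation fps_nth (infixl "$" 75)

section \<open>Complex coordinates on the cotangent bundle of the torus\<close>

lemma to_torus_eq_iff: "to_torus x = to_torus y \<longleftrightarrow> x - y \<in> lattice_N"
  by (simp add: torus.abs_eq_iff lattice_rel_def)

lemma to_torus_rep [simp]: "to_torus (rep_torus t) = t"
  by (rule Quotient3_abs_rep[OF Quotient3_torus])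

lemma rep_to_torus_diff: "rep_torus (to_torus n) - n \<in> lattice_N"
  using to_torus_eq_iff[of "rep_torus (to_torus n)" n] by simp

lemma uminus_to_torus: "- to_torus n = to_torus (- n)"
  by (simp add: uminus_torus.abs_eq)

lemma continuous_on_to_torus: "continuous_on S to_torus"
  unfolding continuous_on_iff using dist_to_torus_le by (meson le_less_trans)

lemma continuous_on_torusI:
  assumes "continuous_on UNIV (\<lambda>n. f (to_torus n))"
  shows "continuous_on UNIV f"
proof -
  have "open (f -` B)" if "open B" for B
  proof -
    have "open ((\<lambda>n. f (to_torus n)) -` B)"
      using assms that open_vimage by blast
    then show ?thesis by (simp add: open_torus_iff vimage_def)
  qed
  then show ?thesis by (simp add: continuous_on_open_vimage)
qed

lemma lattice_N_iff: "n \<in> lattice_N \<longleftrightarrow> n $ 1 \<in> \<int> \<and> n $ 2 \<in> \<int>"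
  by (simp add: lattice_N_def forall_2)

lemma cis_eq_iff_Ints: "cis (2 * pi * x) = cis (2 * pi * y) \<longleftrightarrow> x - y \<in> \<int>"
proof -
  have "cis (2 * pi * x) = cis (2 * pi * y) \<longleftrightarrow>
      (\<exists>n::int. \<i> * of_real (2 * pi * x) = \<i> * of_real (2 * pi * y) + (of_int (2 * n) * pi) * \<i>)"
    unfolding cis_conv_exp exp_eq by simp
  also have "\<dots> \<longleftrightarrow> (\<exists>n::int. x - y = of_int n)"
  proof (rule ex_cong1)
    fix n :: int
    have "\<i> * of_real (2 * pi * x) = \<i> * of_real (2 * pi * y) + (of_int (2 * n) * pi) * \<i>
      \<longleftrightarrow> 2 * pi * x = 2 * pi * y + 2 * n * pi"
      by (simp add: complex_eq_iff mult.commute)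
    also have "\<dots> \<longleftrightarrow> (2 * pi) * (x - y) = (2 * pi) * of_int n"
      by (simp add: algebra_simps)
    also have "\<dots> \<longleftrightarrow> x - y = of_int n"
      using pi_gt_zero by (subst mult_cancel_left) linarith
    finally show "\<i> * of_real (2 * pi * x) = \<i> * of_real (2 * pi * y) + (of_int (2 * n) * pi) * \<i>
      \<longleftrightarrow> x - y = of_int n" .
  qed
  finally show ?thesis by (auto simp: Ints_def)
qed

text \<open>The functions \<open>zco\<close> and \<open>wco\<close> identify \<open>M\<^sub>\<real> \<times> T\<close> with \<open>(\<complex>\<^sup>*)\<^sup>2\<close>. The pairing of \<open>m\<^sub>2\<close> with
  \<open>n\<^sub>1\<close> and of \<open>m\<^sub>1\<close> with \<open>- n\<^sub>2\<close> makes the symplectic form the imaginary part of the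
  holomorphic form \<open>dlog z \<and> dlog w\<close> up to a constant, so that holomorphic curves are Lagrangian.\<close>

definition zco :: "MR \<times> torus \<Rightarrow> complex" where
  "zco a = of_real (exp (- (fst a $ 2))) * cis (2 * pi * (rep_torus (snd a) $ 1))"

definition wco :: "MR \<times> torus \<Rightarrow> complex" where
  "wco a = of_real (exp (- (fst a $ 1))) * cis (- (2 * pi * (rep_torus (snd a) $ 2)))"

definition of_zw :: "complex \<Rightarrow> complex \<Rightarrow> MR \<times> torus" where
  "of_zw z w = (vector [- ln (norm w), - ln (norm z)],
     to_torus (vector [Arg z / (2 * pi), - Arg w / (2 * pi)]))"

lemma zco_to_torus: "zco (m, to_torus n) = of_real (exp (- (m $ 2))) * cis (2 * pi * (n $ 1))"
proof -
  have "cis (2 * pi * (rep_torus (to_torus n) $ 1)) = cis (2 * pi * (n $ 1))"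
    using rep_to_torus_diff[of n] by (simp add: cis_eq_iff_Ints lattice_N_iff)
  then show ?thesis by (simp add: zco_def)
qed

lemma wco_to_torus: "wco (m, to_torus n) = of_real (exp (- (m $ 1))) * cis (- (2 * pi * (n $ 2)))"
proof -
  have "cis (2 * pi * (rep_torus (to_torus n) $ 2)) = cis (2 * pi * (n $ 2))"
    using rep_to_torus_diff[of n] by (simp add: cis_eq_iff_Ints lattice_N_iff)
  then have "cis (- (2 * pi * (rep_torus (to_torus n) $ 2))) = cis (- (2 * pi * (n $ 2)))"
    by (metis cis_cnj)
  then show ?thesis by (simp add: wco_def)
qed

lemma zco_nonzero [simp]: "zco a \<noteq> 0" and wco_nonzero [simp]: "wco a \<noteq> 0"
  by (simp_all add: zco_def wco_def)

lemma norm_zco: "norm (zco a) = exp (- (fst a $ 2))" and norm_wco: "norm (wco a) = exp (- (fst a $ 1))"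
  by (simp_all add: zco_def wco_def norm_mult)

lemma zw_eqI:
  assumes "zco a = zco b" "wco a = wco b"
  shows "a = b"
proof -
  obtain m n where a: "a = (m, to_torus n)" by (metis surj_pair to_torus_rep)
  obtain m' n' where b: "b = (m', to_torus n')" by (metis surj_pair to_torus_rep)
  have "m $ 1 = m' $ 1" "m $ 2 = m' $ 2"
    using arg_cong[OF assms(1), of norm] arg_cong[OF assms(2), of norm]
    by (auto simp: norm_zco norm_wco a b)
  moreover have "n - n' \<in> lattice_N"
  proof -
    have "cis (2 * pi * (n $ 1)) = cis (2 * pi * (n' $ 1))"
      using assms(1) \<open>m $ 2 = m' $ 2\<close> by (simp add: a b zco_to_torus)
    moreover have "cis (- (2 * pi * (n $ 2))) = cis (- (2 * pi * (n' $ 2)))"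
      using assms(2) \<open>m $ 1 = m' $ 1\<close> by (simp add: a b wco_to_torus)
    then have "cis (2 * pi * (n $ 2)) = cis (2 * pi * (n' $ 2))"
      by (metis cis_cnj complex_cnj_cancel_iff)
    ultimately show ?thesis by (simp add: cis_eq_iff_Ints lattice_N_iff)
  qed
  ultimately show ?thesis by (simp add: a b to_torus_eq_iff vec_eq_iff forall_2)
qed

lemma of_real_norm_cis_Arg: "of_real (norm z) * cis (Arg z) = z"
  using rcis_cmod_Arg[of z] by (simp add: rcis_def)

lemma zco_of_zw [simp]: "z \<noteq> 0 \<Longrightarrow> zco (of_zw z w) = z"
  and wco_of_zw [simp]: "w \<noteq> 0 \<Longrightarrow> wco (of_zw z w) = w"
  by (simp_all add: of_zw_def zco_to_torus wco_to_torus of_real_norm_cis_Arg)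

lemma of_zw_zco_wco [simp]: "of_zw (zco a) (wco a) = a"
  by (rule zw_eqI) simp_all

lemma continuous_on_zco: "continuous_on S zco"
  and continuous_on_wco: "continuous_on S wco"
proof -
  have eq: "zco = (\<lambda>a. of_real (exp (- (fst a $ 2))) * (\<lambda>t. cis (2 * pi * (rep_torus t $ 1))) (snd a))"
    "wco = (\<lambda>a. of_real (exp (- (fst a $ 1))) * (\<lambda>t. cis (- (2 * pi * (rep_torus t $ 2)))) (snd a))"
    by (auto simp: zco_def wco_def)
  have c: "cis (2 * pi * (rep_torus (to_torus n) $ 1)) = cis (2 * pi * (n $ 1))"
    "cis (- (2 * pi * (rep_torus (to_torus n) $ 2))) = cis (- (2 * pi * (n $ 2)))" for n
    using zco_to_torus[of 0 n] wco_to_torus[of 0 n] by (simp_all add: zco_def wco_def)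
  have z: "continuous_on UNIV (\<lambda>t. cis (2 * pi * (rep_torus t $ 1)))"
    by (rule continuous_on_torusI) (simp only: c, intro continuous_intros)
  have 1: "continuous_on UNIV zco"
    unfolding eq
  proof (rule continuous_on_mult)
    show "continuous_on UNIV (\<lambda>a. complex_of_real (exp (- (fst a $ 2))))"
      by (intro continuous_intros)
  qed (rule continuous_on_compose2[OF z continuous_on_snd[OF continuous_on_id]], simp)
  have w: "continuous_on UNIV (\<lambda>t. cis (- (2 * pi * (rep_torus t $ 2))))"
    by (rule continuous_on_torusI) (simp only: c, intro continuous_intros)
  have 2: "continuous_on UNIV wco"
    unfolding eq
  proof (rule continuous_on_mult)
    show "continuous_on UNIV (\<lambda>a. complex_of_real (exp (- (fst a $ 1))))"
      by (intro continuous_intros)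
  qed (rule continuous_on_compose2[OF w continuous_on_snd[OF continuous_on_id]], simp)
  show "continuous_on S zco" "continuous_on S wco"
    using 1 2 continuous_on_subset by blast+
qed

lemma vec2_axis: "(vector [x, y] :: real^2) = x *\<^sub>R axis 1 1 + y *\<^sub>R axis 2 1"
  by (simp add: vec_eq_iff axis_def forall_2)

lemma continuous_vec2:
  assumes "continuous F f" "continuous F g"
  shows "continuous F (\<lambda>x. vector [f x, g x] :: real^2)"
proof -
  have "continuous F (\<lambda>x. f x *\<^sub>R axis 1 1 + g x *\<^sub>R axis 2 1 :: real^2)"
    using assms by (intro continuous_intros)
  moreover have "f x *\<^sub>R axis 1 1 + g x *\<^sub>R axis 2 1 = (vector [f x, g x] :: real^2)" for x
    by (simp add: vec_eq_iff axis_def forall_2)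
  ultimately show ?thesis by simp
qed

lemma continuous_on_vec2:
  assumes "continuous_on S f" "continuous_on S g"
  shows "continuous_on S (\<lambda>x. vector [f x, g x] :: real^2)"
proof -
  have "continuous_on S (\<lambda>x. f x *\<^sub>R axis 1 1 + g x *\<^sub>R axis 2 1 :: real^2)"
    using assms by (intro continuous_intros)
  moreover have "f x *\<^sub>R axis 1 1 + g x *\<^sub>R axis 2 1 = (vector [f x, g x] :: real^2)" for x
    by (simp add: vec_eq_iff axis_def forall_2)
  ultimately show ?thesis by simp
qed

lemma continuous_on_of_zw:
  "continuous_on ((- {0}) \<times> (- {0})) (\<lambda>(z, w). of_zw z w)"
proof (rule continuous_at_imp_continuous_on, rule ballI)
  fix p :: "complex \<times> complex" assume "p \<in> (- {0}) \<times> (- {0})"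
  then obtain z0 w0 where p: "p = (z0, w0)" "z0 \<noteq> 0" "w0 \<noteq> 0" by auto
  \<comment> \<open>The argument jumps, but near \<open>z\<^sub>0\<close> it may be replaced by \<open>Arg z\<^sub>0 + Arg (z / z\<^sub>0)\<close>, which
    has the same class and is continuous.\<close>
  define f where "f q = (vector [- ln (norm (snd q)), - ln (norm (fst q))] :: MR,
     to_torus (vector [(Arg z0 + Arg (fst q / z0)) / (2 * pi), - (Arg w0 + Arg (snd q / w0)) / (2 * pi)]))"
    for q :: "complex \<times> complex"
  have eq: "f q = of_zw (fst q) (snd q)" if "fst q \<noteq> 0" "snd q \<noteq> 0" for q
  proof (rule zw_eqI)
    have c: "of_real (norm z) * cis (Arg z0 + Arg (z / z0)) = z" if "z0 \<noteq> 0" "z \<noteq> 0" for z z0 :: complex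
    proof -
      have "of_real (norm z) * cis (Arg z0 + Arg (z / z0)) =
         (of_real (norm z0) * cis (Arg z0)) * (of_real (norm (z / z0)) * cis (Arg (z / z0)))"
        using that by (simp add: cis_mult[symmetric] norm_divide)
      also have "\<dots> = z" using that by (simp only: of_real_norm_cis_Arg) simp
      finally show ?thesis .
    qed
    show "zco (f q) = zco (of_zw (fst q) (snd q))"
      using that c[OF p(2) that(1)] by (simp add: f_def zco_to_torus)
    have "of_real (norm (snd q)) * cis (Arg (snd q / w0) + Arg w0) = snd q"
      using c[OF p(3) that(2)] by (subst add.commute)
    then show "wco (f q) = wco (of_zw (fst q) (snd q))"
      using that by (simp add: f_def wco_to_torus)
  qed
  have A: "isCont (\<lambda>q. Arg (fst q / z0)) p" "isCont (\<lambda>q. Arg (snd q / w0)) p"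
  proof -
    have 1: "isCont (\<lambda>q. fst q / z0) p" "isCont (\<lambda>q. snd q / w0) p"
      using p by (auto intro!: continuous_intros)
    have 2: "isCont Arg (fst p / z0)" "isCont Arg (snd p / w0)"
      using p by (simp_all add: continuous_at_Arg)
    show "isCont (\<lambda>q. Arg (fst q / z0)) p" "isCont (\<lambda>q. Arg (snd q / w0)) p"
      using isCont_o2[OF 1(1) 2(1)] isCont_o2[OF 1(2) 2(2)] by simp_all
  qed
  have "isCont (\<lambda>q. vector [- ln (norm (snd q)), - ln (norm (fst q))] :: MR) p"
    using p by (intro continuous_vec2 continuous_intros) auto
  moreover have "isCont (\<lambda>q. vector [(Arg z0 + Arg (fst q / z0)) / (2 * pi),
        - (Arg w0 + Arg (snd q / w0)) / (2 * pi)] :: NR) p"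
    using A by (intro continuous_vec2 continuous_intros) auto
  then have "isCont (\<lambda>q. to_torus (vector [(Arg z0 + Arg (fst q / z0)) / (2 * pi),
        - (Arg w0 + Arg (snd q / w0)) / (2 * pi)])) p"
    by (rule isCont_o2) (use continuous_on_to_torus[of UNIV] in \<open>simp add: continuous_on_eq_continuous_at\<close>)
  ultimately have "isCont f p"
    unfolding f_def by (intro continuous_intros)
  moreover have "open ((- {0}) \<times> (- {0}) :: (complex \<times> complex) set)"
    by (intro open_Times) auto
  then have "eventually (\<lambda>q. q \<in> (- {0}) \<times> (- {0})) (nhds p)"
    using p by (intro eventually_nhds_in_open) auto
  then have "eventually (\<lambda>q. f q = (\<lambda>(z, w). of_zw z w) q) (nhds p)"
    proof eventually_elim
    case (elim q)
    then show ?case using eq[of q] by (cases q) auto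
  qed
  then have "isCont f p \<longleftrightarrow> isCont (\<lambda>(z, w). of_zw z w) p"
    by (rule isCont_cong)
  ultimately show "isCont (\<lambda>(z, w). of_zw z w) p" by blast
qed

lemma continuous_on_of_zw_compose:
  assumes "continuous_on S f" "continuous_on S g" "\<And>x. x \<in> S \<Longrightarrow> f x \<noteq> 0" "\<And>x. x \<in> S \<Longrightarrow> g x \<noteq> 0"
  shows "continuous_on S (\<lambda>x. of_zw (f x) (g x))"
  using continuous_on_compose2[OF continuous_on_of_zw continuous_on_Pair[OF assms(1,2)]] assms(3,4)
  by auto

section \<open>Lagrangian charts and affine symplectic maps\<close>

definition lagrangian_at :: "(MR \<times> torus) set \<Rightarrow> MR \<times> torus \<Rightarrow> bool" where
  "lagrangian_at L p \<longleftrightarrow> (\<exists>U \<phi>. local_parametrization L p U \<phi> \<and> lagrangian_immersion U \<phi>)"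

lemma lagrangian_submanifold_iff: "lagrangian_submanifold L \<longleftrightarrow> (\<forall>p\<in>L. lagrangian_at L p)"
  by (simp add: lagrangian_submanifold_def lagrangian_at_def)

lemma smooth_on_subset: "smooth_on f U \<Longrightarrow> V \<subseteq> U \<Longrightarrow> open V \<Longrightarrow> smooth_on f V"
  unfolding smooth_on_def using Ck_on_subset by blast

text \<open>Being Lagrangian is a local condition; this is what allows the smoothing to be assembled from
  pieces.\<close>

lemma lagrangian_at_local:
  assumes "lagrangian_at L p" "open V" "p \<in> V" "L \<inter> V = L' \<inter> V"
  shows "lagrangian_at L' p"
proof -
  obtain U \<phi> W \<psi> where *: "smooth_on \<phi> U" "\<forall>u\<in>U. inj (frechet_derivative \<phi> (at u))"
      "open W" "p \<in> W" and h: "homeomorphism U (L \<inter> W) (cover \<circ> \<phi>) \<psi>" and l: "lagrangian_immersion U \<phi>"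
    using assms(1) unfolding lagrangian_at_def local_parametrization_def by blast
  define U' where "U' = U \<inter> (cover \<circ> \<phi>) -` V"
  have "open U"
    using *(1) by (simp add: smooth_on_def)
  have U': "open U'"
    unfolding U'_def using homeomorphism_cont1[OF h] \<open>open U\<close> assms(2)
    by (rule continuous_open_preimage)
  have img: "(cover \<circ> \<phi>) ` U' = L' \<inter> (W \<inter> V)"
  proof -
    have "(cover \<circ> \<phi>) ` U' = (cover \<circ> \<phi>) ` U \<inter> V" unfolding U'_def by blast
    also have "\<dots> = (L \<inter> V) \<inter> W" using homeomorphism_image1[OF h] by blast
    finally show ?thesis using assms(4) by blast
  qed
  have "homeomorphism U' (L' \<inter> (W \<inter> V)) (cover \<circ> \<phi>) \<psi>"
    by (rule homeomorphism_of_subsets[OF h _ subset_refl img]) (auto simp: U'_def)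
  moreover have "smooth_on \<phi> U'"
    using smooth_on_subset[OF *(1) _ U'] by (simp add: U'_def)
  ultimately have "local_parametrization L' p U' \<phi>"
    unfolding local_parametrization_def using * assms
    by (intro conjI exI[of _ "W \<inter> V"] exI[of _ \<psi>]) (auto simp: U'_def)
  moreover have "lagrangian_immersion U' \<phi>"
    using l by (simp add: lagrangian_immersion_def U'_def)
  ultimately show ?thesis by (auto simp: lagrangian_at_def)
qed

text \<open>A lattice isomorphism \<open>B\<close> of \<open>N\<close> acts on \<open>M\<close> by the inverse transpose; together with a
  translation, and a dilation of \<open>M\<close> only, it preserves the symplectic form up to a factor.\<close>

definition lattice_iso :: "(NR \<Rightarrow> NR) \<Rightarrow> bool" where
  "lattice_iso B \<longleftrightarrow> linear B \<and> bij B \<and> (\<forall>n. B n \<in> lattice_N \<longleftrightarrow> n \<in> lattice_N)"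

definition aff_map :: "MR \<Rightarrow> real \<Rightarrow> (NR \<Rightarrow> NR) \<Rightarrow> NR \<Rightarrow> MR \<times> torus \<Rightarrow> MR \<times> torus" where
  "aff_map c s B b a = (c + s *\<^sub>R adjoint (inv B) (fst a), to_torus (B (rep_torus (snd a)) + b))"

lemma lattice_iso_inv:
  assumes "lattice_iso B"
  shows "lattice_iso (inv B)"
proof -
  have "linear (inv B)"
    using assms linear_injective_imp_surjective bij_is_inj inj_linear_imp_inv_linear
    unfolding lattice_iso_def by blast
  then show ?thesis
    using assms bij_imp_bij_inv[of B] unfolding lattice_iso_def
    by (metis bij_inv_eq_iff)
qed

lemma linear_adjoint_inv: "lattice_iso B \<Longrightarrow> linear (adjoint (inv B))"
  using lattice_iso_inv adjoint_linear by (auto simp: lattice_iso_def)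

lemma adjoint_inv_inner:
  assumes "lattice_iso B"
  shows "adjoint (inv B) m \<bullet> B n = m \<bullet> n"
proof -
  have "linear (inv B)" using lattice_iso_inv[OF assms] by (simp add: lattice_iso_def)
  then have "B n \<bullet> adjoint (inv B) m = inv B (B n) \<bullet> m" by (rule adjoint_works)
  also have "inv B (B n) = n" using assms by (simp add: lattice_iso_def bij_is_inj)
  finally show ?thesis by (simp add: inner_commute)
qed

lemma aff_map_to_torus:
  assumes "lattice_iso B"
  shows "aff_map c s B b (m, to_torus n) = (c + s *\<^sub>R adjoint (inv B) m, to_torus (B n + b))"
proof -
  have "B (rep_torus (to_torus n)) - B n = B (rep_torus (to_torus n) - n)"
    using assms by (simp add: lattice_iso_def linear_diff)
  also have "\<dots> \<in> lattice_N"
    using assms rep_to_torus_diff[of n] by (simp add: lattice_iso_def)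
  finally show ?thesis by (simp add: aff_map_def to_torus_eq_iff)
qed

lemma continuous_on_aff_map:
  assumes "lattice_iso B"
  shows "continuous_on S (aff_map c s B b)"
proof -
  have lin: "bounded_linear B" "bounded_linear (adjoint (inv B))"
    using assms linear_adjoint_inv by (auto simp: lattice_iso_def linear_conv_bounded_linear)
  have "to_torus (B (rep_torus (to_torus n)) + b) = to_torus (B n + b)" for n
    using aff_map_to_torus[OF assms, of 0 1 b 0 n] by (simp add: aff_map_def)
  moreover have "continuous_on UNIV (\<lambda>n. B n + b)"
    using linear_continuous_on[OF lin(1)] by (intro continuous_on_add continuous_on_const)
  from continuous_on_compose2[OF continuous_on_to_torus[of UNIV] this]
  have "continuous_on UNIV (\<lambda>n. to_torus (B n + b))" by simp
  ultimately have c: "continuous_on UNIV (\<lambda>t. to_torus (B (rep_torus t) + b))"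
    by (intro continuous_on_torusI) simp
  have "continuous_on S (\<lambda>a. to_torus (B (rep_torus (snd a)) + b))"
    by (rule continuous_on_compose2[OF c continuous_on_snd[OF continuous_on_id]]) simp
  moreover have "continuous_on S (\<lambda>a. c + s *\<^sub>R adjoint (inv B) (fst a))"
    by (intro continuous_on_add continuous_on_const continuous_on_scaleR
        bounded_linear.continuous_on[OF lin(2)] continuous_on_fst continuous_on_id)
  ultimately show ?thesis
    unfolding aff_map_def by (intro continuous_on_Pair)
qed

lemma adjoint_inv_inverse:
  assumes "lattice_iso B"
  shows "adjoint (inv (inv B)) (adjoint (inv B) m) = m" "adjoint (inv B) (adjoint (inv (inv B)) m) = m"
proof -
  have 1: "adjoint (inv (inv B)) (adjoint (inv B) m) = m" if B: "lattice_iso B" for B and m :: MR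
  proof -
    have "adjoint (inv (inv B)) (adjoint (inv B) m) \<bullet> n = m \<bullet> n" for n
    proof -
      have "adjoint (inv (inv B)) (adjoint (inv B) m) \<bullet> inv B (B n) = adjoint (inv B) m \<bullet> B n"
        using adjoint_inv_inner[OF lattice_iso_inv[OF B]] by blast
      also have "\<dots> = m \<bullet> n" by (rule adjoint_inv_inner[OF B])
      finally show ?thesis using B by (simp add: lattice_iso_def bij_is_inj)
    qed
    then show ?thesis using vector_eq_rdot by blast
  qed
  show "adjoint (inv (inv B)) (adjoint (inv B) m) = m" by (rule 1[OF assms])
  have "inv (inv B) = B" using assms by (simp add: lattice_iso_def inv_inv_eq)
  then show "adjoint (inv B) (adjoint (inv (inv B)) m) = m"
    using 1[OF lattice_iso_inv[OF assms], of m] by simp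
qed

lemma aff_map_homeomorphism:
  assumes B: "lattice_iso B" and "s \<noteq> 0"
  obtains g where "\<And>a. g (aff_map c s B b a) = a" "\<And>a. aff_map c s B b (g a) = a"
    "continuous_on UNIV g"
proof -
  define g where "g = aff_map (- (1 / s) *\<^sub>R adjoint (inv (inv B)) c) (1 / s) (inv B) (- inv B b)"
  note B' = lattice_iso_inv[OF B]
  have lin: "linear B" "linear (inv B)" "linear (adjoint (inv B))" "linear (adjoint (inv (inv B)))"
    using B B' linear_adjoint_inv by (auto simp: lattice_iso_def)
  have BB: "inv B (B n) = n" "B (inv B n) = n" for n
    using B by (auto simp: lattice_iso_def bij_is_inj bij_is_surj surj_f_inv_f)
  have "g (aff_map c s B b a) = a" for a
  proof -
    obtain m n where a: "a = (m, to_torus n)" by (metis surj_pair to_torus_rep)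
    show ?thesis unfolding a g_def
      using lin BB adjoint_inv_inverse[OF B] \<open>s \<noteq> 0\<close>
      by (simp add: aff_map_to_torus[OF B] aff_map_to_torus[OF B'] linear_add linear_cmul algebra_simps)
  qed
  moreover have "aff_map c s B b (g a) = a" for a
  proof -
    obtain m n where a: "a = (m, to_torus n)" by (metis surj_pair to_torus_rep)
    show ?thesis unfolding a g_def
      using lin BB adjoint_inv_inverse[OF B] \<open>s \<noteq> 0\<close>
      by (simp add: aff_map_to_torus[OF B] aff_map_to_torus[OF B'] linear_add linear_diff linear_neg linear_cmul algebra_simps)
  qed
  moreover have "continuous_on UNIV g"
    unfolding g_def by (rule continuous_on_aff_map[OF B'])
  ultimately show ?thesis using that by blast
qed

text \<open>The inverse transpose on \<open>M\<close> keeps the pairing invariant, and the dilation multiplies the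
  symplectic form by \<open>s\<close>. The linear lift of the map carries a parametrization of \<open>L\<close> to one of the
  image.\<close>

lemma lagrangian_at_aff_map:
  assumes "lagrangian_at L p" and B: "lattice_iso B" and "s \<noteq> 0"
  shows "lagrangian_at (aff_map c s B b ` L) (aff_map c s B b p)"
proof -
  define F where "F = aff_map c s B b"
  define A where "A = adjoint (inv B)"
  obtain g where g: "\<And>a. g (F a) = a" "\<And>a. F (g a) = a" "continuous_on UNIV g"
    unfolding F_def using aff_map_homeomorphism[OF B \<open>s \<noteq> 0\<close>] by blast
  have Fc: "continuous_on S F" for S
    unfolding F_def by (rule continuous_on_aff_map[OF B])
  obtain U \<phi> W \<psi> where *: "smooth_on \<phi> U" "\<forall>u\<in>U. inj (frechet_derivative \<phi> (at u))"
      "open W" "p \<in> W" and h: "homeomorphism U (L \<inter> W) (cover \<circ> \<phi>) \<psi>" and l: "lagrangian_immersion U \<phi>"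
    using assms(1) unfolding lagrangian_at_def local_parametrization_def by blast
  have lin: "bounded_linear B" "bounded_linear A" "linear B" "linear A"
    using B linear_adjoint_inv by (auto simp: lattice_iso_def A_def linear_conv_bounded_linear)
  have injA: "inj A" using adjoint_inv_inverse[OF B] unfolding A_def by (metis injI)
  have injB: "inj B" using B by (simp add: lattice_iso_def bij_is_inj)
  define T where "T a = (s *\<^sub>R A (fst a), B (snd a))" for a :: "MR \<times> NR"
  define \<phi>' where "\<phi>' u = T (\<phi> u) + (c, b)" for u
  have T: "bounded_linear T"
    unfolding T_def using lin
    by (intro bounded_linear_Pair bounded_linear_scaleR_right[THEN bounded_linear_compose]
        bounded_linear_compose[OF lin(1)] bounded_linear_compose[OF lin(2)]
        bounded_linear_fst bounded_linear_snd)
  have "smooth_on \<phi>' U"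
    using *(1) unfolding smooth_on_def \<phi>'_def
    by (auto intro!: Ck_on_add[OF Ck_on_bounded_linear[OF T] Ck_on_const])
  have der: "frechet_derivative \<phi>' (at u) = (\<lambda>v. T (frechet_derivative \<phi> (at u) v))" if "u \<in> U" for u
  proof (rule frechet_derivative_at[symmetric])
    show "(\<phi>' has_derivative (\<lambda>v. T (frechet_derivative \<phi> (at u) v))) (at u)"
      unfolding \<phi>'_def
      using has_derivative_add[OF bounded_linear.has_derivative[OF T smooth_onD[OF *(1) that]]
          has_derivative_const[of "(c, b)"]] by simp
  qed
  have inj: "\<forall>u\<in>U. inj (frechet_derivative \<phi>' (at u))"
  proof
    fix u assume u: "u \<in> U"
    have "inj T"
    proof (rule injI)
      fix x y assume "T x = T y"
      then have "A (fst x) = A (fst y)" "B (snd x) = B (snd y)"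
        using \<open>s \<noteq> 0\<close> by (auto simp: T_def)
      then show "x = y" using injA injB by (simp add: inj_eq prod_eq_iff)
    qed
    moreover have "inj (frechet_derivative \<phi> (at u))" using *(2) u by blast
    ultimately have "inj (T \<circ> frechet_derivative \<phi> (at u))" by (rule inj_compose)
    then show "inj (frechet_derivative \<phi>' (at u))"
      unfolding der[OF u] comp_def .
  qed
  have cov: "cover \<circ> \<phi>' = F \<circ> (cover \<circ> \<phi>)"
    by (auto simp: fun_eq_iff cover_def \<phi>'_def T_def F_def aff_map_to_torus[OF B] A_def split: prod.splits)
  have "homeomorphism (L \<inter> W) (F ` (L \<inter> W)) F g"
    by (rule homeomorphismI[OF Fc continuous_on_subset[OF g(3) subset_UNIV]]) (auto simp: g)
  then have "homeomorphism U (F ` (L \<inter> W)) (F \<circ> (cover \<circ> \<phi>)) (\<psi> \<circ> g)"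
    by (rule homeomorphism_compose[OF h])
  moreover have "F ` (L \<inter> W) = F ` L \<inter> g -` W"
  proof (intro equalityI subsetI)
    fix x assume "x \<in> F ` L \<inter> g -` W"
    then obtain y where "y \<in> L" "x = F y" "g x \<in> W" by blast
    then show "x \<in> F ` (L \<inter> W)" using g(1) by auto
  qed (use g(1) in auto)
  ultimately have hom: "homeomorphism U (F ` L \<inter> g -` W) (cover \<circ> \<phi>') (\<psi> \<circ> g)"
    by (simp add: cov)
  have "open (g -` W)" using g(3) *(3) by (simp add: open_vimage)
  then have "local_parametrization (F ` L) (F p) U \<phi>'"
    unfolding local_parametrization_def using \<open>smooth_on \<phi>' U\<close> inj hom g *(4)
    by (intro conjI exI[of _ "g -` W"] exI[of _ "\<psi> \<circ> g"]) auto
  moreover have "lagrangian_immersion U \<phi>'"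
    unfolding lagrangian_immersion_def
  proof (intro ballI allI)
    fix u x y assume u: "u \<in> U"
    have "symp_form (T v) (T v') = s * symp_form v v'" for v v'
      using adjoint_inv_inner[OF B]
      by (simp add: symp_form_def T_def A_def split_def algebra_simps)
    then show "symp_form (frechet_derivative \<phi>' (at u) x) (frechet_derivative \<phi>' (at u) y) = 0"
      using l u der[OF u] by (simp add: lagrangian_immersion_def)
  qed
  ultimately show ?thesis unfolding lagrangian_at_def F_def by blast
qed

text \<open>Graphs \<open>w = exp (- H (log z))\<close> in the coordinates \<open>zco\<close>, \<open>wco\<close>. Writing
  \<open>log z = - m\<^sub>2 + 2 \<pi> \<i> n\<^sub>1\<close> and \<open>H = m\<^sub>1 + 2 \<pi> \<i> n\<^sub>2\<close>, the symplectic form pulls back to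
  \<open>(\<partial>m\<^sub>1/\<partial>m\<^sub>2 + \<partial>n\<^sub>2/\<partial>n\<^sub>1) dm\<^sub>2 \<and> dn\<^sub>1\<close>; in terms of the derivative of \<open>H\<close> its vanishing is
  the equation \<open>Im (D \<i>) = Re (D 1)\<close>, half of the Cauchy--Riemann equations.\<close>

lemma lagrangian_at_graph:
  fixes \<Omega> :: "complex set" and G H :: "complex \<Rightarrow> complex"
  assumes \<Omega>: "open \<Omega>" "0 \<notin> \<Omega>" "z0 \<in> \<Omega>" and W: "open W"
    and L: "\<And>a. a \<in> W \<Longrightarrow> zco a \<in> \<Omega> \<Longrightarrow> a \<in> L \<longleftrightarrow> wco a = exp (- G (zco a))"
    and in_W: "\<And>z. z \<in> \<Omega> \<Longrightarrow> of_zw z (exp (- G z)) \<in> W"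
    and H: "\<And>u. exp u \<in> \<Omega> \<Longrightarrow> H u = G (exp u)"
    and smooth: "\<And>k. Ck_on k H {u. exp u \<in> \<Omega>}"
    and div: "\<And>u D. exp u \<in> \<Omega> \<Longrightarrow> (H has_derivative D) (at u) \<Longrightarrow> Im (D \<i>) = Re (D 1)"
  shows "lagrangian_at L (of_zw z0 (exp (- G z0)))"
proof -
  define \<theta>0 where "\<theta>0 = Arg z0 / (2 * pi)"
  have z0: "z0 \<noteq> 0" "z0 = of_real (norm z0) * cis (2 * pi * \<theta>0)"
    using \<Omega> of_real_norm_cis_Arg[of z0] by (auto simp: \<theta>0_def)
  define lin where "lin u = Complex (- (u $ 1)) (2 * pi * (u $ 2))" for u :: "real^2"
  have lin: "bounded_linear lin"
    unfolding linear_conv_bounded_linear[symmetric]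
    by (rule linearI) (auto simp: lin_def complex_eq_iff algebra_simps)
  define V where "V = {u. exp u \<in> \<Omega>}"
  have "V = exp -` \<Omega>" by (auto simp: V_def)
  then have "open V" using \<Omega>(1) by (simp add: open_vimage continuous_on_exp)
  define U where "U = {u. exp (lin u) \<in> \<Omega> \<and> \<bar>u $ 2 - \<theta>0\<bar> < 1 / 2}"
  have "open U"
  proof -
    have "U = lin -` V \<inter> {u. \<bar>u $ 2 - \<theta>0\<bar> < 1 / 2}" by (auto simp: U_def V_def)
    moreover have "open (lin -` V)"
      using \<open>open V\<close> lin by (intro open_vimage) (simp_all add: linear_continuous_on)
    moreover have "open {u :: real^2. \<bar>u $ 2 - \<theta>0\<bar> < 1 / 2}"
      by (intro open_Collect_less continuous_intros)
    ultimately show ?thesis by auto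
  qed
  define P where "P u = Re (H (lin u))" for u
  define Q where "Q u = Im (H (lin u)) / (2 * pi)" for u
  define \<phi> where "\<phi> u = (vector [P u, u $ 1] :: MR, vector [u $ 2, Q u] :: NR)" for u
  have U_V: "U \<subseteq> lin -` V" by (auto simp: U_def V_def)
  have CkH: "Ck_on k (\<lambda>u. H (lin u)) U" for k
    using Ck_on_subset[OF Ck_on_precompose_linear[OF lin smooth[folded V_def]] U_V] .
  have CkP: "Ck_on k P U" for k
    unfolding P_def by (rule Ck_on_bounded_linear[OF bounded_linear_Re CkH])
  have CkQ: "Ck_on k Q U" for k
    unfolding Q_def
    by (rule Ck_on_bounded_linear[OF bounded_linear_compose[OF bounded_linear_divide bounded_linear_Im] CkH])
  have smooth_\<phi>: "smooth_on \<phi> U"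
    unfolding smooth_on_def \<phi>_def
    by (intro conjI allI \<open>open U\<close> Ck_on_Pair Ck_on_vec2 CkP CkQ Ck_on_linear bounded_linear_vec_nth)
  have exp_lin: "exp (lin u) = of_real (exp (- (u $ 1))) * cis (2 * pi * (u $ 2))" for u
    unfolding exp_eq_polar by (simp add: lin_def)
  have cov: "zco (cover (\<phi> u)) = exp (lin u)" "wco (cover (\<phi> u)) = exp (- H (lin u))" for u
    by (simp_all add: cover_def \<phi>_def zco_to_torus wco_to_torus exp_lin P_def Q_def
        exp_eq_polar[of "- H (lin u)"])
  define W' where "W' = W \<inter> zco -` (\<Omega> \<inter> {z. z / z0 \<notin> \<real>\<^sub>\<le>\<^sub>0})"
  have "open W'"
  proof -
    have "{z. z / z0 \<notin> \<real>\<^sub>\<le>\<^sub>0} = (\<lambda>z. z / z0) -` (- \<real>\<^sub>\<le>\<^sub>0)" by auto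
    moreover have "open ((\<lambda>z. z / z0) -` (- \<real>\<^sub>\<le>\<^sub>0))"
      using z0 by (intro open_vimage continuous_intros) auto
    ultimately show ?thesis
      unfolding W'_def using W \<Omega>(1) continuous_on_zco[of UNIV]
      by (intro open_Int open_vimage) auto
  qed
  define \<psi> where "\<psi> a = (vector [- ln (norm (zco a)), \<theta>0 + Arg (zco a / z0) / (2 * pi)] :: real^2)" for a
  have quot: "exp (lin u) / z0 = of_real (exp (- (u $ 1)) / norm z0) * cis (2 * pi * (u $ 2 - \<theta>0))" for u
  proof -
    have "exp (lin u) / z0 = of_real (exp (- (u $ 1)) / norm z0) * (cis (2 * pi * (u $ 2)) / cis (2 * pi * \<theta>0))"
      by (subst z0(2)) (simp add: exp_lin)
    also have "cis (2 * pi * (u $ 2)) / cis (2 * pi * \<theta>0) = cis (2 * pi * (u $ 2 - \<theta>0))"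
      by (simp add: cis_divide algebra_simps)
    finally show ?thesis .
  qed
  have arg: "Arg (exp (lin u) / z0) = 2 * pi * (u $ 2 - \<theta>0)" if "\<bar>u $ 2 - \<theta>0\<bar> < 1 / 2" for u
  proof -
    have "\<bar>2 * pi * (u $ 2 - \<theta>0)\<bar> = 2 * pi * \<bar>u $ 2 - \<theta>0\<bar>" by (simp add: abs_mult)
    also have "\<dots> < 2 * pi * (1 / 2)" using that by (intro mult_strict_left_mono) auto
    finally have "\<bar>2 * pi * (u $ 2 - \<theta>0)\<bar> < pi" by simp
    then have "2 * pi * (u $ 2 - \<theta>0) \<in> {- pi<..pi}"
      unfolding greaterThanAtMost_iff by linarith
    then show ?thesis
      using z0(1) by (intro Arg_unique'[of "exp (- (u $ 1)) / norm z0"]) (simp_all add: quot rcis_def)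
  qed
  have hom: "homeomorphism U (L \<inter> W') (cover \<circ> \<phi>) \<psi>"
  proof (rule homeomorphismI)
    have "continuous_on U \<phi>"
      using smooth_\<phi> Ck_on_imp_continuous[of 0 \<phi> U] by (simp add: smooth_on_def)
    moreover have "continuous_on UNIV cover"
      unfolding cover_def split_def
      by (intro continuous_intros continuous_on_compose2[OF continuous_on_to_torus[of UNIV]]) auto
    ultimately show "continuous_on U (cover \<circ> \<phi>)"
      by (intro continuous_on_compose) (auto intro: continuous_on_subset)
    show "continuous_on (L \<inter> W') \<psi>"
      unfolding \<psi>_def using z0
      by (intro continuous_on_vec2 continuous_intros continuous_on_zco) (auto simp: W'_def)
    show "(cover \<circ> \<phi>) ` U \<subseteq> L \<inter> W'"
    proof (intro image_subsetI IntI)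
      fix u assume u: "u \<in> U"
      then have e: "exp (lin u) \<in> \<Omega>" by (simp add: U_def)
      have eq: "cover (\<phi> u) = of_zw (exp (lin u)) (exp (- G (exp (lin u))))"
        by (rule zw_eqI) (simp_all add: cov H[OF e])
      have w: "cover (\<phi> u) \<in> W" using in_W[OF e] by (simp add: eq)
      then show "(cover \<circ> \<phi>) u \<in> L" using L[OF w] e by (simp add: cov H[OF e])
      have "exp (lin u) / z0 \<notin> \<real>\<^sub>\<le>\<^sub>0"
      proof
        assume n: "exp (lin u) / z0 \<in> \<real>\<^sub>\<le>\<^sub>0"
        then have "Arg (exp (lin u) / z0) = pi"
          using z0 by (intro Arg_unique'[of "norm (exp (lin u) / z0)"])
            (auto elim!: nonpos_Reals_cases simp: rcis_def)
        then have "(2 * pi) * (u $ 2 - \<theta>0) = (2 * pi) * (1 / 2)"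
          using arg[of u] u by (simp add: U_def)
        then have "u $ 2 - \<theta>0 = 1 / 2"
          using pi_gt_zero by (subst (asm) mult_cancel_left) linarith
        then show False using u by (simp add: U_def)
      qed
      then show "(cover \<circ> \<phi>) u \<in> W'" using w e by (simp add: W'_def cov)
    qed
    show "\<psi> ` (L \<inter> W') \<subseteq> U" and "\<And>a. a \<in> L \<inter> W' \<Longrightarrow> (cover \<circ> \<phi>) (\<psi> a) = a"
    proof -
      have e: "exp (lin (\<psi> a)) = zco a" for a
      proof -
        have "exp (lin (\<psi> a)) = of_real (norm (zco a)) * cis (Arg z0 + Arg (zco a / z0))"
          by (simp add: exp_lin \<psi>_def \<theta>0_def norm_zco distrib_left)
        also have "\<dots> = (of_real (norm z0) * cis (Arg z0)) * (of_real (norm (zco a / z0)) * cis (Arg (zco a / z0)))"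
          using z0 by (simp add: cis_mult[symmetric] norm_divide)
        also have "\<dots> = zco a" using z0 by (simp only: of_real_norm_cis_Arg) simp
        finally show ?thesis .
      qed
      have lt: "\<bar>Arg (zco a / z0)\<bar> < pi" if "a \<in> W'" for a
      proof -
        have "zco a / z0 \<notin> \<real>\<^sub>\<le>\<^sub>0" using that by (simp add: W'_def)
        then have "Arg (zco a / z0) \<noteq> pi"
          by (auto simp: Arg_eq_pi complex_nonpos_Reals_iff)
        then show ?thesis using Arg_bounded[of "zco a / z0"] by linarith
      qed
      show "\<psi> ` (L \<inter> W') \<subseteq> U"
      proof (intro image_subsetI)
        fix a assume "a \<in> L \<inter> W'"
        then have a: "a \<in> L" "a \<in> W'" by blast+
        have "\<bar>(\<psi> a) $ 2 - \<theta>0\<bar> = \<bar>Arg (zco a / z0)\<bar> / (2 * pi)"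
          by (simp add: \<psi>_def)
        also have "\<dots> < 1 / 2" using lt[OF a(2)] by (simp add: field_simps)
        finally show "\<psi> a \<in> U" using a by (simp add: U_def e W'_def)
      qed
      show "(cover \<circ> \<phi>) (\<psi> a) = a" if a: "a \<in> L \<inter> W'" for a
      proof (rule zw_eqI)
        show "zco ((cover \<circ> \<phi>) (\<psi> a)) = zco a" by (simp add: cov e)
        have "exp (lin (\<psi> a)) \<in> \<Omega>" using a by (simp add: e W'_def)
        from H[OF this] show "wco ((cover \<circ> \<phi>) (\<psi> a)) = wco a"
          using L[of a] a by (simp add: cov e W'_def)
      qed
    qed
    show "\<psi> ((cover \<circ> \<phi>) u) = u" if "u \<in> U" for u
      using that arg[of u]
      by (simp add: \<psi>_def cov vec_eq_iff forall_2 U_def lin_def)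
  qed
  have der: "\<exists>D. (H has_derivative D) (at (lin u)) \<and>
      frechet_derivative \<phi> (at u) = (\<lambda>v. (vector [Re (D (lin v)), v $ 1], vector [v $ 2, Im (D (lin v)) / (2 * pi)]))"
    if u: "u \<in> U" for u
  proof -
    obtain D where D: "\<And>v. v \<in> V \<Longrightarrow> (H has_derivative D v) (at v)"
      by (rule Ck_on_SucE[OF smooth[of "Suc 0", folded V_def]]) (rule that)
    have Du: "(H has_derivative D (lin u)) (at (lin u))"
      using D u U_V by blast
    have HL: "((\<lambda>u. H (lin u)) has_derivative (\<lambda>v. D (lin u) (lin v))) (at u)"
      using has_derivative_compose[OF bounded_linear_imp_has_derivative[OF lin] Du] .
    have "(P has_derivative (\<lambda>v. Re (D (lin u) (lin v)))) (at u)"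
      unfolding P_def by (rule bounded_linear.has_derivative[OF bounded_linear_Re HL])
    moreover have "(Q has_derivative (\<lambda>v. Im (D (lin u) (lin v)) / (2 * pi))) (at u)"
      unfolding Q_def
      by (rule bounded_linear.has_derivative[OF bounded_linear_compose[OF bounded_linear_divide bounded_linear_Im] HL])
    moreover have "((\<lambda>u :: real^2. u $ i) has_derivative (\<lambda>v. v $ i)) (at u)" for i
      by (rule bounded_linear_imp_has_derivative[OF bounded_linear_vec_nth])
    ultimately have "(\<phi> has_derivative (\<lambda>v.
         (Re (D (lin u) (lin v)) *\<^sub>R axis 1 1 + (v $ 1) *\<^sub>R axis 2 1 :: real^2,
          (v $ 2) *\<^sub>R axis 1 1 + (Im (D (lin u) (lin v)) / (2 * pi)) *\<^sub>R axis 2 1 :: real^2))) (at u)"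
      unfolding \<phi>_def vec2_axis
      by (intro has_derivative_Pair has_derivative_add has_derivative_scaleR_left)
    then have "(\<phi> has_derivative (\<lambda>v. (vector [Re (D (lin u) (lin v)), v $ 1],
        vector [v $ 2, Im (D (lin u) (lin v)) / (2 * pi)]))) (at u)"
      unfolding vec2_axis .
    from frechet_derivative_at[OF this, symmetric] Du show ?thesis
      by (intro exI[of _ "D (lin u)"] conjI)
  qed
  have "inj (frechet_derivative \<phi> (at u))" if u: "u \<in> U" for u
  proof -
    obtain D where "frechet_derivative \<phi> (at u) =
        (\<lambda>v. (vector [Re (D (lin v)), v $ 1] :: MR, vector [v $ 2, Im (D (lin v)) / (2 * pi)] :: NR))"
      using der[OF u] by blast
    then show ?thesis by (auto simp: inj_def vec_eq_iff forall_2)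
  qed
  moreover have "lagrangian_immersion U \<phi>"
    unfolding lagrangian_immersion_def
  proof (intro ballI allI)
    fix u a b assume u: "u \<in> U"
    obtain D where D: "(H has_derivative D) (at (lin u))" "frechet_derivative \<phi> (at u) =
        (\<lambda>v. (vector [Re (D (lin v)), v $ 1], vector [v $ 2, Im (D (lin v)) / (2 * pi)]))"
      using der[OF u] by blast
    have dv: "Im (D \<i>) = Re (D 1)" using div[OF _ D(1)] u by (simp add: U_def)
    have "linear D" using D(1) has_derivative_linear by blast
    then have DL: "D (lin v) = - (v $ 1) *\<^sub>R D 1 + (2 * pi * (v $ 2)) *\<^sub>R D \<i>" for v
    proof -
      have "lin v = - (v $ 1) *\<^sub>R 1 + (2 * pi * (v $ 2)) *\<^sub>R \<i>"
        by (simp add: lin_def complex_eq_iff)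
      then show ?thesis using \<open>linear D\<close> by (simp add: linear_add linear_cmul linear_neg linear_diff)
    qed
    show "symp_form (frechet_derivative \<phi> (at u) a) (frechet_derivative \<phi> (at u) b) = 0"
      by (simp add: D(2) symp_form_def inner_vec_def sum_2 DL dv) (simp add: field_simps)
  qed
  ultimately have "local_parametrization L (of_zw z0 (exp (- G z0))) U \<phi> \<and> lagrangian_immersion U \<phi>"
    unfolding local_parametrization_def
  proof (intro conjI exI[of _ W'] exI[of _ \<psi>])
    have "z0 / z0 \<notin> \<real>\<^sub>\<le>\<^sub>0" using z0 by simp
    then show "of_zw z0 (exp (- G z0)) \<in> W'" using \<Omega> in_W z0 by (auto simp: W'_def)
  qed (use smooth_\<phi> \<open>open W'\<close> hom in auto)
  then show ?thesis unfolding lagrangian_at_def by blast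
qed

section \<open>The model surface: a line with straightened ends\<close>

text \<open>The line has homogeneous coordinates \<open>z\<close>, \<open>1 - z\<close>, \<open>1\<close>, and \<open>sector\<close> is the part where the first
  of them has the least modulus. The symmetry below permutes the coordinates, so this is one third of
  the line, the one that contains the end \<open>z \<rightarrow> 0\<close>.\<close>

definition sector :: "complex set" where
  "sector = {z. z \<noteq> 0 \<and> norm z \<le> 1 \<and> norm z \<le> norm (1 - z)}"

lemma sector_nonzero: "z \<in> sector \<Longrightarrow> z \<noteq> 0"
  by (simp add: sector_def)

text \<open>The symmetry of order three of the line \<open>z + w = 1\<close>, which permutes its punctures.\<close>

definition rot :: "complex \<times> complex \<Rightarrow> complex \<times> complex" where
  "rot p = (- snd p / fst p, 1 / fst p)"

definition sweep :: "(complex \<times> complex) set \<Rightarrow> (complex \<times> complex) set" where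
  "sweep X = X \<union> rot ` X \<union> rot ` rot ` X"

lemma rot_Pair: "rot (z, w) = (- w / z, 1 / z)"
  by (simp add: rot_def)

lemma rot_rot_Pair: "z \<noteq> 0 \<Longrightarrow> w \<noteq> 0 \<Longrightarrow> rot (rot (z, w)) = (1 / w, - z / w)"
  by (simp add: rot_def)

lemma rot_rot_rot: "fst p \<noteq> 0 \<Longrightarrow> snd p \<noteq> 0 \<Longrightarrow> rot (rot (rot p)) = p"
  by (cases p) (simp add: rot_def)

lemma rot_mem_sweep:
  assumes "\<And>p. p \<in> X \<Longrightarrow> fst p \<noteq> 0 \<and> snd p \<noteq> 0" "fst p \<noteq> 0" "snd p \<noteq> 0"
  shows "rot p \<in> sweep X \<longleftrightarrow> p \<in> sweep X"
proof
  show "rot p \<in> sweep X" if "p \<in> sweep X"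
    using that assms(1) rot_rot_rot unfolding sweep_def by auto
  show "p \<in> sweep X" if "rot p \<in> sweep X"
  proof -
    have step: "rot q \<in> sweep X" if "q \<in> sweep X" for q
      using that assms(1) rot_rot_rot unfolding sweep_def by auto
    have "rot (rot (rot p)) \<in> sweep X" using that step by blast
    then show ?thesis using rot_rot_rot[of p] assms by simp
  qed
qed

lemma norm_ge_1_sum: "norm z \<ge> 1 - norm (1 - z)" for z :: complex
  using norm_triangle_ineq[of "1 - z" z] by simp

text \<open>The curve \<open>w = 1 - z\<close> is bent near \<open>z = 0\<close> into \<open>w = 1\<close>. The bending must stay Lagrangian,
  so not the curve but a potential of it is cut off: with \<open>log z = - x + 2 \<pi> \<i> n\<^sub>1\<close> the curve
  is the Hamiltonian graph of \<open>Im Gam\<close> (\<open>Gam\<close> the dilogarithm), and \<open>bend\<close> is the Hamiltonian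
  graph of \<open>cut \<cdot> Im Gam\<close>.\<close>

locale model =
  fixes cut cut1 :: "real \<Rightarrow> real" and Gam :: "complex \<Rightarrow> complex" and R \<delta> :: real
  assumes cut_smooth: "\<And>k. Ck_on k cut UNIV" and cut1_smooth: "\<And>k. Ck_on k cut1 UNIV"
    and cut_deriv: "\<And>x. (cut has_real_derivative cut1 x) (at x)"
    and cut_0: "\<And>x. x \<le> 0 \<Longrightarrow> cut x = 1" and cut_1: "\<And>x. x \<ge> 1 \<Longrightarrow> cut x = 0"
    and cut1_0: "\<And>x. x \<le> 0 \<Longrightarrow> cut1 x = 0" and cut1_1: "\<And>x. x \<ge> 1 \<Longrightarrow> cut1 x = 0"
    and Gam_deriv: "\<And>z. norm z < 1 \<Longrightarrow> z \<noteq> 0 \<Longrightarrow> (Gam has_field_derivative (- Ln (1 - z) / z)) (at z)"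
    and R: "R \<ge> 2" and \<delta>: "0 < \<delta>" "\<delta> \<le> 1 / 4"
    and small: "\<And>z. z \<noteq> 0 \<Longrightarrow> norm z \<le> exp (- R) \<Longrightarrow>
      norm (of_real (cut (- ln (norm z) - R)) * (- Ln (1 - z))
        - \<i> * of_real (cut1 (- ln (norm z) - R) * Im (Gam z))) \<le> \<delta>"
begin

definition bend :: "complex \<Rightarrow> complex" where
  "bend z = of_real (cut (- ln (norm z) - R)) * (- Ln (1 - z))
        - \<i> * of_real (cut1 (- ln (norm z) - R) * Im (Gam z))"

definition F :: "complex \<Rightarrow> complex" where
  "F z = (if norm z \<ge> exp (- R) then 1 - z else exp (- bend z))"

definition leg :: "(complex \<times> complex) set" where
  "leg = (\<lambda>z. (z, F z)) ` sector"

definition surface :: "(MR \<times> torus) set" where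
  "surface = {a. (zco a, wco a) \<in> sweep leg}"

lemma exp_R: "exp (- R) \<le> 1 / 4"
proof -
  have "exp (- R) \<le> exp (- 2)" using R by simp
  also have "\<dots> \<le> 1 / 4"
    using power_mono[OF exp_ge_add_one_self[of 1], of 2] exp_of_nat_mult[of 2 "1 :: real"]
    by (simp add: exp_minus field_simps)
  finally show ?thesis .
qed

lemma ln_le_R: "z \<noteq> 0 \<Longrightarrow> norm z \<ge> exp (- R) \<Longrightarrow> - ln (norm z) - R \<le> 0"
  using ln_ge_iff[of "norm z" "- R"] by simp

lemma F_core: "norm z \<ge> exp (- R) \<Longrightarrow> F z = 1 - z"
  by (simp add: F_def)

lemma F_bend: "0 < norm z \<Longrightarrow> norm z < 1 \<Longrightarrow> F z = exp (- bend z)"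
proof (cases "norm z \<ge> exp (- R)")
  assume z: "0 < norm z" "norm z < 1" and c: "norm z \<ge> exp (- R)"
  have "1 - z \<noteq> 0" using z by auto
  moreover have "bend z = - Ln (1 - z)"
    using ln_le_R[OF _ c] z by (simp add: bend_def cut_0 cut1_0)
  ultimately show ?thesis using c by (simp add: F_def)
qed (simp add: F_def)

lemma F_end:
  assumes "z \<noteq> 0" "norm z \<le> exp (- R - 1)"
  shows "F z = 1"
proof -
  have "exp (- R - 1) < exp (- R)" by simp
  then have "\<not> norm z \<ge> exp (- R)" using assms by linarith
  moreover have "- ln (norm z) - R \<ge> 1"
    using ln_le_cancel_iff[of "norm z" "exp (- R - 1)"] assms by simp
  ultimately show ?thesis by (simp add: F_def bend_def cut_1 cut1_1)
qed

lemma norm_bend: "z \<noteq> 0 \<Longrightarrow> norm z \<le> exp (- R) \<Longrightarrow> norm (bend z) \<le> \<delta>"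
  using small by (simp add: bend_def)

lemma norm_F_end:
  assumes "z \<noteq> 0" "norm z < exp (- R)"
  shows "norm (F z) \<ge> 1 / 2" "norm (F z) \<le> 2"
proof -
  have n: "norm (F z) = exp (- Re (bend z))"
    using assms by (simp add: F_def)
  have "\<bar>Re (bend z)\<bar> \<le> 1 / 4"
    using norm_bend[of z] assms \<delta> abs_Re_le_cmod[of "bend z"] by linarith
  then have "exp (- (1 / 4)) \<le> norm (F z)" "norm (F z) \<le> exp (1 / 4)"
    unfolding n by simp_all
  moreover have "3 / 4 \<le> exp (- (1 / 4) :: real)" using exp_ge_add_one_self[of "- (1 / 4)"] by simp
  moreover from this have "exp (1 / 4 :: real) \<le> 2" by (simp add: exp_minus field_simps)
  ultimately show "norm (F z) \<ge> 1 / 2" "norm (F z) \<le> 2" by simp_all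
qed

lemma F_nonzero: "z \<noteq> 0 \<Longrightarrow> z \<noteq> 1 \<Longrightarrow> F z \<noteq> 0"
  by (simp add: F_def)

lemma F_sector_nonzero: "z \<in> sector \<Longrightarrow> F z \<noteq> 0"
  by (rule F_nonzero) (auto simp: sector_def)

lemma leg_nonzero: "p \<in> leg \<Longrightarrow> fst p \<noteq> 0 \<and> snd p \<noteq> 0"
  unfolding leg_def using F_sector_nonzero sector_nonzero by fastforce

lemma Gam_holomorphic: "Gam holomorphic_on {z. z \<noteq> 0 \<and> norm z < 1}"
  using Gam_deriv unfolding holomorphic_on_def field_differentiable_def
  by (blast intro: has_field_derivative_at_within)

lemma not_nonpos_Reals: "norm (z :: complex) < 1 \<Longrightarrow> 1 - z \<notin> \<real>\<^sub>\<le>\<^sub>0"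
  using complex_Re_le_cmod[of z] by (auto simp: complex_nonpos_Reals_iff)

lemma continuous_on_F: "continuous_on (- {0}) F"
proof -
  have "continuous_on {z. 0 < norm z \<and> norm z < 1} F"
  proof (rule continuous_on_cong[THEN iffD2, OF refl F_bend])
    have g: "continuous_on {z. 0 < norm z \<and> norm z < 1} (\<lambda>z. Im (Gam z))"
      using holomorphic_on_imp_continuous_on[OF Gam_holomorphic]
      by (intro continuous_intros) (auto elim!: continuous_on_subset)
    have c: "continuous_on {z. 0 < norm z \<and> norm z < 1} (\<lambda>z. cut (- ln (norm z) - R))"
        "continuous_on {z. 0 < norm z \<and> norm z < 1} (\<lambda>z. cut1 (- ln (norm z) - R))"
      using cut_smooth[of 0] cut1_smooth[of 0]
      by (auto intro!: continuous_on_compose2[of UNIV cut] continuous_on_compose2[of UNIV cut1] continuous_intros)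
    have l: "continuous_on {z. 0 < norm z \<and> norm z < 1} (\<lambda>z. Ln (1 - z))"
      by (intro continuous_intros) (auto simp: not_nonpos_Reals)
    show "continuous_on {z. 0 < norm z \<and> norm z < 1} (\<lambda>z. exp (- bend z))"
      unfolding bend_def
      by (intro continuous_on_exp continuous_on_minus continuous_on_diff continuous_on_mult
          continuous_on_of_real continuous_on_const g c l)
  qed auto
  moreover have "continuous_on {z. norm z > exp (- R)} F"
    by (rule continuous_on_cong[THEN iffD2, OF refl F_core]) (auto intro: continuous_intros)
  moreover have "open {z :: complex. 0 < norm z \<and> norm z < 1}" "open {z :: complex. norm z > exp (- R)}"
    by (rule open_Collect_conj; intro open_Collect_less continuous_intros)
      (intro open_Collect_less continuous_intros)
  ultimately have "continuous_on ({z. 0 < norm z \<and> norm z < 1} \<union> {z. norm z > exp (- R)}) F"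
    by (intro continuous_on_open_Un)
  moreover have "{z :: complex. 0 < norm z \<and> norm z < 1} \<union> {z. norm z > exp (- R)} = - {0}"
  proof (intro equalityI subsetI)
    fix z :: complex assume "z \<in> - {0}"
    then show "z \<in> {z. 0 < norm z \<and> norm z < 1} \<union> {z. norm z > exp (- R)}"
      using exp_R by (cases "norm z < 1") auto
  qed (auto simp: not_less dest: less_trans[OF exp_gt_zero])
  ultimately show ?thesis by simp
qed

text \<open>Where the first coordinate is not least, a power of the symmetry moves the point into \<open>sector\<close>;
  the bounds say that it arrives outside the bent region.\<close>

lemma line_in_sweep:
  assumes "z \<noteq> 0" "z \<noteq> 1" "exp (- R) \<le> norm z" "norm (1 - z) \<le> exp R" "exp (- R) * norm z \<le> norm (1 - z)"
  shows "(z, 1 - z) \<in> sweep leg"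
proof -
  have nz: "norm z > 0" "norm (1 - z) > 0" using assms by auto
  consider "norm z \<le> 1" "norm z \<le> norm (1 - z)" | "1 \<le> norm z" "1 \<le> norm (1 - z)"
    | "norm (1 - z) \<le> 1" "norm (1 - z) \<le> norm z" by linarith
  then show ?thesis
  proof cases
    case 1
    then have "z \<in> sector" using assms by (simp add: sector_def)
    then have "(z, F z) \<in> leg" by (auto simp: leg_def)
    then show ?thesis using F_core[OF assms(3)] by (simp add: sweep_def)
  next
    case 2
    define y where "y = 1 / (1 - z)"
    have y1: "1 - y = - z / (1 - z)" using assms by (simp add: y_def field_simps)
    have "y \<in> sector"
      unfolding sector_def y1 using 2 nz by (simp add: y_def norm_divide field_simps)
    then have l: "(y, F y) \<in> leg" by (auto simp: leg_def)
    have "norm y \<ge> exp (- R)"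
      using assms nz by (simp add: y_def norm_divide exp_minus field_simps)
    then have "rot (y, F y) = (z, 1 - z)"
      using assms y1 by (simp add: F_core rot_def y_def)
    then show ?thesis using l by (force simp: sweep_def)
  next
    case 3
    define y where "y = (z - 1) / z"
    have y1: "1 - y = 1 / z" using assms by (simp add: y_def field_simps)
    have "norm (z - 1) = norm (1 - z)" by (rule norm_minus_commute)
    then have "y \<in> sector"
      unfolding sector_def y1 using 3 nz assms by (simp add: y_def norm_divide field_simps)
    then have l: "(y, F y) \<in> leg" by (auto simp: leg_def)
    have "norm y \<ge> exp (- R)"
      using assms nz \<open>norm (z - 1) = norm (1 - z)\<close> by (simp add: y_def norm_divide field_simps)
    then have "rot (rot (y, F y)) = (z, 1 - z)"
      using assms y1 by (simp add: F_core rot_def y_def field_simps)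
    then show ?thesis using l unfolding sweep_def by (metis UnCI imageI)
  qed
qed

text \<open>In a neighbourhood of the first third of the surface the whole surface is the graph of \<open>F\<close>:
  the other thirds enter this neighbourhood only along the unbent part of the line.\<close>

lemma sweep_leg_graph:
  assumes "z \<noteq> 0" "w \<noteq> 0" "norm z < 2" "norm z < 2 * norm w"
  shows "(z, w) \<in> sweep leg \<longleftrightarrow> w = F z"
proof
  assume w: "w = F z"
  show "(z, w) \<in> sweep leg"
  proof (cases "z \<in> sector")
    case True
    then show ?thesis using w by (auto simp: sweep_def leg_def)
  next
    case False
    then have "norm z > 1 \<or> norm z > norm (1 - z)" using assms by (auto simp: sector_def)
    then have z: "norm z \<ge> 1 / 2" using norm_ge_1_sum[of z] by linarith
    then have c: "norm z \<ge> exp (- R)" using exp_R by linarith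
    then have Fz: "F z = 1 - z" by (rule F_core)
    then have "z \<noteq> 1" using w assms by auto
    have "norm (1 - z) \<le> 3" using norm_triangle_ineq4[of 1 z] assms by simp
    also have "\<dots> \<le> exp R" using exp_ge_add_one_self[of R] R by linarith
    finally have "norm (1 - z) \<le> exp R" .
    have "exp (- R) * norm z \<le> (1 / 2) * norm z"
      using exp_R by (intro mult_right_mono) auto
    moreover have "norm z < 2 * norm (1 - z)" using assms(4) w Fz by simp
    ultimately have "exp (- R) * norm z \<le> norm (1 - z)" by linarith
    with \<open>norm (1 - z) \<le> exp R\<close> show ?thesis
      unfolding w Fz using assms c \<open>z \<noteq> 1\<close> by (intro line_in_sweep)
  qed
next
  assume "(z, w) \<in> sweep leg"
  then consider "(z, w) \<in> leg" | "(z, w) \<in> rot ` leg" | "(z, w) \<in> rot ` rot ` leg"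
    by (auto simp: sweep_def)
  then show "w = F z"
  proof cases
    case 1
    then show ?thesis by (auto simp: leg_def)
  next
    case 2
    then obtain y where y: "y \<in> sector" "z = - F y / y" "w = 1 / y"
      by (auto simp: leg_def rot_def)
    have y0: "norm y > 0" "norm y \<le> 1" using y by (auto simp: sector_def)
    have "norm (F y) < 2 * norm y"
      using assms(3) y0 unfolding y by (simp add: norm_divide field_simps)
    then have "norm y \<ge> exp (- R)"
      using norm_F_end[of y] y0 exp_R by fastforce
    then have Fy: "F y = 1 - y" by (rule F_core)
    have z: "z = 1 - 1 / y" unfolding y Fy using y0 by (simp add: field_simps)
    have "norm z = norm (1 - y) / norm y" unfolding y Fy by (simp add: norm_divide norm_minus_commute)
    also have "\<dots> \<ge> 1" using y y0 by (simp add: sector_def)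
    finally have "norm z \<ge> exp (- R)" using exp_R by linarith
    then show ?thesis using F_core[of z] by (simp add: z y)
  next
    case 3
    then obtain y where y: "y \<in> sector" "(z, w) = rot (rot (y, F y))"
      by (auto simp: leg_def)
    have y0: "norm y > 0" "norm y \<le> 1" using y by (auto simp: sector_def)
    have zw: "z = 1 / F y" "w = - y / F y"
      using y rot_rot_Pair[of y "F y"] F_sector_nonzero[of y] y0 by auto
    have F0: "norm (F y) > 0" using F_sector_nonzero[of y] y by simp
    have "norm y > 1 / 2"
      using assms(4) F0 unfolding zw by (simp add: norm_divide field_simps)
    then have "norm y \<ge> exp (- R)" using exp_R by linarith
    then have Fy: "F y = 1 - y" by (rule F_core)
    have "norm (1 - y) \<le> 2" using norm_triangle_ineq4[of 1 y] y0 by simp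
    then have "norm z \<ge> 1 / 2" using F0 unfolding zw Fy by (simp add: norm_divide field_simps)
    then have "norm z \<ge> exp (- R)" using exp_R by linarith
    moreover have "1 - y \<noteq> 0" using F0 Fy by auto
    ultimately show ?thesis using F_core[of z] unfolding zw Fy by (simp add: field_simps)
  qed
qed

end

lemma adjoint_inv_eqI:
  assumes "lattice_iso B" "\<And>m n. A m \<bullet> B n = m \<bullet> n"
  shows "adjoint (inv B) = A"
proof
  fix m
  have "adjoint (inv B) m \<bullet> y = A m \<bullet> y" for y
  proof -
    have "B (inv B y) = y" using assms(1) by (simp add: lattice_iso_def bij_is_surj surj_f_inv_f)
    then show ?thesis using adjoint_inv_inner[OF assms(1), of m "inv B y"] assms(2)[of m "inv B y"] by simp
  qed
  then show "adjoint (inv B) m = A m" using vector_eq_rdot by blast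
qed

definition rot_N :: "NR \<Rightarrow> NR" where
  "rot_N n = vector [- (n $ 1) - n $ 2, n $ 1]"

definition rot_map :: "MR \<times> torus \<Rightarrow> MR \<times> torus" where
  "rot_map = aff_map 0 1 rot_N (vector [1 / 2, 0])"

lemma lattice_iso_rot_N: "lattice_iso rot_N"
  unfolding lattice_iso_def
proof (intro conjI allI)
  show "linear rot_N"
    by (rule linearI) (auto simp: rot_N_def vec_eq_iff forall_2 algebra_simps)
  show "bij rot_N"
    by (rule o_bij[of "\<lambda>n. vector [n $ 2, - (n $ 1) - n $ 2]"])
      (auto simp: rot_N_def fun_eq_iff vec_eq_iff forall_2)
  fix n :: NR
  have "- (n $ 1) - n $ 2 \<in> \<int> \<longleftrightarrow> n $ 2 \<in> \<int>" if "n $ 1 \<in> \<int>"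
  proof
    assume "- (n $ 1) - n $ 2 \<in> \<int>"
    with that have "- (- (n $ 1) - n $ 2 + n $ 1) \<in> \<int>" by (intro Ints_minus Ints_add)
    then show "n $ 2 \<in> \<int>" by simp
  qed (use that in auto)
  then show "rot_N n \<in> lattice_N \<longleftrightarrow> n \<in> lattice_N"
    by (auto simp: rot_N_def lattice_N_iff)
qed

lemma rot_map_to_torus:
  "rot_map (m, to_torus n) =
    (vector [- (m $ 2), m $ 1 - m $ 2], to_torus (vector [1 / 2 - n $ 1 - n $ 2, n $ 1]))"
proof -
  have "adjoint (inv rot_N) = (\<lambda>m. vector [- (m $ 2), m $ 1 - m $ 2])"
    by (rule adjoint_inv_eqI[OF lattice_iso_rot_N])
      (auto simp: rot_N_def inner_vec_def sum_2 algebra_simps)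
  moreover have "rot_N n + vector [1 / 2, 0] = vector [1 / 2 - n $ 1 - n $ 2, n $ 1]"
    by (simp add: rot_N_def vec_eq_iff forall_2)
  ultimately show ?thesis
    by (simp add: rot_map_def aff_map_to_torus[OF lattice_iso_rot_N])
qed

lemma zw_rot_map: "(zco (rot_map a), wco (rot_map a)) = rot (zco a, wco a)"
proof -
  obtain m n where a: "a = (m, to_torus n)" by (metis surj_pair to_torus_rep)
  have c: "cis (2 * pi * (1 / 2 - n $ 1 - n $ 2)) = - (cis (- (2 * pi * (n $ 2))) / cis (2 * pi * (n $ 1)))"
  proof -
    have "cis (2 * pi * (1 / 2 - n $ 1 - n $ 2)) = cis (pi + (- (2 * pi * (n $ 2)) - 2 * pi * (n $ 1)))"
      by (simp add: algebra_simps)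
    also have "\<dots> = cis pi * (cis (- (2 * pi * (n $ 2))) / cis (2 * pi * (n $ 1)))"
      by (simp only: cis_mult[symmetric] cis_divide)
    finally show ?thesis by simp
  qed
  have c': "cis (- (2 * pi * (n $ 1))) = 1 / cis (2 * pi * (n $ 1))"
    by (simp add: cis_divide[of 0, simplified])
  show ?thesis
    unfolding a rot_map_to_torus zco_to_torus wco_to_torus rot_Pair prod.inject vector_2 c c'
    by (simp add: exp_minus exp_diff field_simps)
qed

lemma rot_map_rot_map_rot_map: "rot_map (rot_map (rot_map a)) = a"
proof (rule zw_eqI)
  have "(zco (rot_map (rot_map (rot_map a))), wco (rot_map (rot_map (rot_map a)))) = (zco a, wco a)"
    unfolding zw_rot_map using rot_rot_rot[of "(zco a, wco a)"] by simp
  then show "zco (rot_map (rot_map (rot_map a))) = zco a" "wco (rot_map (rot_map (rot_map a))) = wco a"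
    by simp_all
qed

lemma continuous_on_rot_map: "continuous_on S rot_map"
  unfolding rot_map_def by (rule continuous_on_aff_map[OF lattice_iso_rot_N])

lemma lagrangian_at_rot_map:
  assumes "lagrangian_at L p" "\<And>a. rot_map a \<in> L \<longleftrightarrow> a \<in> L"
  shows "lagrangian_at L (rot_map p)"
proof -
  have "lagrangian_at (rot_map ` L) (rot_map p)"
    unfolding rot_map_def by (rule lagrangian_at_aff_map[OF assms(1) lattice_iso_rot_N]) simp
  moreover have "rot_map ` L = L"
  proof (intro equalityI subsetI)
    fix a assume "a \<in> L"
    then have "rot_map (rot_map a) \<in> L" using assms(2) by blast
    then show "a \<in> rot_map ` L" using rot_map_rot_map_rot_map[of a] by (metis imageI)
  qed (use assms(2) in auto)
  ultimately show ?thesis by simp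
qed

context model
begin

lemma rot_map_surface: "rot_map a \<in> surface \<longleftrightarrow> a \<in> surface"
  unfolding surface_def mem_Collect_eq zw_rot_map
  by (rule rot_mem_sweep[OF leg_nonzero]) auto

definition bendH :: "complex \<Rightarrow> complex" where
  "bendH u = of_real (cut (- Re u - R)) * (- Ln (1 - exp u))
        - \<i> * of_real (cut1 (- Re u - R) * Im (Gam (exp u)))"

lemma bendH: "bendH u = bend (exp u)"
  by (simp add: bendH_def bend_def)


lemma log_part_deriv:
  assumes "Re u < 0"
  shows "((\<lambda>u. - Ln (1 - exp u)) has_field_derivative exp u / (1 - exp u)) (at u)"
    and "((\<lambda>u. Gam (exp u)) has_field_derivative - Ln (1 - exp u)) (at u)"
proof -
  have n: "norm (exp u) < 1" using assms by simp
  have ne: "1 - exp u \<noteq> 0"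
  proof
    assume "1 - exp u = 0"
    then have "norm (exp u) = 1" by (metis eq_iff_diff_eq_0 norm_one)
    then show False using n by simp
  qed
  show "((\<lambda>u. - Ln (1 - exp u)) has_field_derivative exp u / (1 - exp u)) (at u)"
    using not_nonpos_Reals[OF n] by (auto intro!: derivative_eq_intros simp: ne divide_inverse)
  have "((\<lambda>u. Gam (exp u)) has_field_derivative (- Ln (1 - exp u) / exp u) * exp u) (at u)"
    by (rule DERIV_chain2[OF Gam_deriv[OF n] DERIV_exp]) simp
  then show "((\<lambda>u. Gam (exp u)) has_field_derivative - Ln (1 - exp u)) (at u)" by simp
qed

lemma open_left_half_plane: "open {u :: complex. Re u < 0}"
  by (intro open_Collect_less continuous_intros)

lemma Ck_on_compose_Re:
  assumes "\<And>k. Ck_on k c UNIV"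
  shows "Ck_on k (\<lambda>u. c (- Re u - R)) S"
proof -
  have "Ck_on k (\<lambda>x. c (x + - R)) UNIV"
    using Ck_on_add_const[OF assms, of k "- R"] by simp
  from Ck_on_precompose_linear[OF bounded_linear_minus[OF bounded_linear_Re] this]
  have "Ck_on k (\<lambda>u. c (- Re u - R)) UNIV" by simp
  then show ?thesis using Ck_on_subset by blast
qed

lemma smooth_bendH: "Ck_on k bendH {u. Re u < 0}"
proof -
  have hol: "(\<lambda>u. - Ln (1 - exp u)) holomorphic_on {u. Re u < 0}"
      "(\<lambda>u. Gam (exp u)) holomorphic_on {u. Re u < 0}"
    using log_part_deriv open_left_half_plane by (auto simp: holomorphic_on_open)
  note C = holomorphic_Ck_on[OF open_left_half_plane hol(1)]
    Ck_on_bounded_linear[OF bounded_linear_Im holomorphic_Ck_on[OF open_left_half_plane hol(2)]]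
  show ?thesis
    unfolding bendH_def
    by (rule Ck_on_diff[OF Ck_on_mult[OF Ck_on_bounded_linear[OF bounded_linear_of_real
            Ck_on_compose_Re[OF cut_smooth]] C(1)] Ck_on_mult[OF Ck_on_const
          Ck_on_bounded_linear[OF bounded_linear_of_real Ck_on_mult[OF Ck_on_compose_Re[OF cut1_smooth] C(2)]]]])
qed

text \<open>The terms with the derivative of \<open>cut\<close> cancel because \<open>Im (\<partial>Gam/\<partial>n\<^sub>1)\<close> is \<open>m\<^sub>1\<close>: this is the
  symmetry of the second derivatives of the cut-off potential.\<close>

lemma bendH_divergence:
  assumes "Re u < 0" "(bendH has_derivative D) (at u)"
  shows "Im (D \<i>) = Re (D 1)"
proof -
  define l where "l = - Ln (1 - exp u)"
  define q where "q = exp u / (1 - exp u)"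
  define x where "x = - Re u - R"
  obtain c where c: "(cut1 has_real_derivative c) (at x)"
  proof -
    obtain f' where "\<And>x. x \<in> UNIV \<Longrightarrow> (cut1 has_derivative f' x) (at x)"
      by (rule Ck_on_SucE[OF cut1_smooth[of "Suc 0"]]) (rule that)
    then have "cut1 differentiable (at x)"
      unfolding differentiable_def by (intro exI[of _ "f' x"]) simp
    then show thesis
      using DERIV_deriv_iff_real_differentiable by (intro that[of "deriv cut1 x"]) blast
  qed
  have re: "((\<lambda>u. - Re u - R) has_derivative (\<lambda>v. - Re v)) (at u)"
    by (auto intro!: derivative_eq_intros)
  have d1: "((\<lambda>u. cut (- Re u - R)) has_derivative (\<lambda>v. cut1 x * (- Re v))) (at u)"
    using has_derivative_compose[OF re, of cut "(*) (cut1 x)"] cut_deriv[of x]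
    by (simp add: has_field_derivative_def x_def)
  have d2: "((\<lambda>u. cut1 (- Re u - R)) has_derivative (\<lambda>v. c * (- Re v))) (at u)"
    using has_derivative_compose[OF re, of cut1 "(*) c"] c
    by (simp add: has_field_derivative_def x_def)
  have d3: "((\<lambda>u. - Ln (1 - exp u)) has_derivative (\<lambda>v. q * v)) (at u)"
    using log_part_deriv(1)[OF assms(1)] unfolding has_field_derivative_def q_def .
  have "((\<lambda>u. Gam (exp u)) has_derivative (\<lambda>v. l * v)) (at u)"
    using log_part_deriv(2)[OF assms(1)] unfolding has_field_derivative_def l_def .
  from bounded_linear.has_derivative[OF bounded_linear_Im this]
  have d4: "((\<lambda>u. Im (Gam (exp u))) has_derivative (\<lambda>v. Im (l * v))) (at u)" .
  have o: "((\<lambda>u. of_real (f u) :: complex) has_derivative (\<lambda>v. of_real (f' v))) (at u)"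
    if "(f has_derivative f') (at u)" for f f'
    by (rule bounded_linear.has_derivative[OF bounded_linear_of_real that])
  have "(bendH has_derivative
      (\<lambda>v. (of_real (cut x) * (q * v) + of_real (cut1 x * (- Re v)) * l)
         - \<i> * of_real (cut1 x * Im (l * v) + c * (- Re v) * Im (Gam (exp u))))) (at u)"
    unfolding bendH_def
    by (rule has_derivative_diff[OF has_derivative_mult[OF o[OF d1] d3, folded x_def l_def]
          has_derivative_mult_right[OF o[OF has_derivative_mult[OF d2 d4, folded x_def]]]])
  from has_derivative_unique[OF assms(2) this] show ?thesis by simp
qed

lemma lagrangian_at_leg:
  assumes "z0 \<in> sector"
  shows "lagrangian_at surface (of_zw z0 (F z0))"
proof -
  define W where "W = {a. norm (zco a) < 2 \<and> norm (zco a) < 2 * norm (wco a)}"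
  have W: "open W"
    unfolding W_def by (intro open_Collect_conj open_Collect_less continuous_intros continuous_on_zco continuous_on_wco)
  have graph: "a \<in> surface \<longleftrightarrow> wco a = F (zco a)" if "a \<in> W" for a
    using sweep_leg_graph[of "zco a" "wco a"] that by (simp add: W_def surface_def)
  have z0: "z0 \<noteq> 0" "norm z0 \<le> 1" "norm z0 \<le> norm (1 - z0)" "z0 \<noteq> 1"
    using assms by (auto simp: sector_def)
  have F0: "norm z0 < 2 * norm (F z0)"
  proof (cases "norm z0 \<ge> exp (- R)")
    case True
    have "norm z0 > 0" using z0 by simp
    then have "norm z0 < 2 * norm (1 - z0)" using z0(3) by linarith
    then show ?thesis by (simp add: F_core[OF True])
  next
    case False
    then show ?thesis using norm_F_end(1)[of z0] z0 exp_R by linarith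
  qed
  show ?thesis
  proof (cases "norm z0 < 1")
    case True
    define \<Omega> where "\<Omega> = {z \<in> - {0}. norm z < 1 \<and> norm z < 2 * norm (F z)}"
    have "continuous_on (- {0}) (\<lambda>z. 2 * norm (F z) - norm z)"
      by (intro continuous_intros continuous_on_F)
    then have "open (- {0} \<inter> (\<lambda>z. 2 * norm (F z) - norm z) -` {0<..})"
      by (rule continuous_open_preimage) auto
    moreover have "open {z :: complex. norm z < 1}"
      by (intro open_Collect_less continuous_intros)
    moreover have "\<Omega> = (- {0} \<inter> (\<lambda>z. 2 * norm (F z) - norm z) -` {0<..}) \<inter> {z. norm z < 1}"
      by (auto simp: \<Omega>_def)
    ultimately have "open \<Omega>" by (simp only: open_Int)
    have \<Omega>: "0 < norm z" "norm z < 1" "F z \<noteq> 0" "F z = exp (- bend z)" if "z \<in> \<Omega>" for z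
      using that F_bend[of z] by (auto simp: \<Omega>_def)
    have ex: "Re u < 0" if "exp u \<in> \<Omega>" for u
      using \<Omega>(2)[OF that] by simp
    have "lagrangian_at surface (of_zw z0 (exp (- bend z0)))"
    proof (rule lagrangian_at_graph[OF \<open>open \<Omega>\<close> _ _ W, where H = bendH])
      show "0 \<notin> \<Omega>" "z0 \<in> \<Omega>" using z0 True F0 by (auto simp: \<Omega>_def)
      show "a \<in> surface \<longleftrightarrow> wco a = exp (- bend (zco a))" if "a \<in> W" "zco a \<in> \<Omega>" for a
        using graph[OF that(1)] \<Omega>(4)[OF that(2)] by simp
      show "of_zw z (exp (- bend z)) \<in> W" if "z \<in> \<Omega>" for z
        using that \<Omega>[OF that] by (auto simp: W_def \<Omega>_def)
      show "bendH u = bend (exp u)" for u by (rule bendH)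
      show "Ck_on k bendH {u. exp u \<in> \<Omega>}" for k
        by (rule Ck_on_subset[OF smooth_bendH]) (auto simp del: norm_exp_eq_Re dest: ex)
      show "Im (D \<i>) = Re (D 1)" if "exp u \<in> \<Omega>" "(bendH has_derivative D) (at u)" for u D
        by (rule bendH_divergence[OF ex[OF that(1)] that(2)])
    qed
    then show ?thesis using F_bend[of z0] z0 True by simp
  next
    case False
    define \<Omega> where "\<Omega> = {z. 1 / 2 < norm z \<and> norm z < 2 \<and> norm z < 2 * norm (1 - z :: complex)}"
    have "open \<Omega>"
      unfolding \<Omega>_def by (intro open_Collect_conj open_Collect_less continuous_intros)
    have \<Omega>: "F z = 1 - z" "1 - z \<notin> \<real>\<^sub>\<le>\<^sub>0" "F z = exp (- (- Ln (1 - z)))"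
      if "z \<in> \<Omega>" for z :: complex
    proof -
      show F: "F z = 1 - z" using that exp_R by (intro F_core) (simp add: \<Omega>_def)
      show "1 - z \<notin> \<real>\<^sub>\<le>\<^sub>0"
      proof
        assume "1 - z \<in> \<real>\<^sub>\<le>\<^sub>0"
        then have "Im z = 0" "Re z \<ge> 1" by (auto simp: complex_nonpos_Reals_iff)
        then have "z = of_real (Re z)" "norm z = Re z" by (auto simp: complex_eq_iff cmod_eq_Re)
        moreover have "norm (1 - z) = Re z - 1"
          using \<open>Im z = 0\<close> \<open>Re z \<ge> 1\<close> by (simp add: cmod_eq_Re)
        ultimately show False using that by (auto simp: \<Omega>_def)
      qed
      then have "1 - z \<noteq> 0" by auto
      then show "F z = exp (- (- Ln (1 - z)))" using F by simp
    qed
    have hol: "(\<lambda>u. - Ln (1 - exp u)) holomorphic_on {u. exp u \<in> \<Omega>}"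
      using \<Omega>(2) by (intro holomorphic_intros) auto
    have op: "open {u :: complex. exp u \<in> \<Omega>}"
      using open_vimage[OF \<open>open \<Omega>\<close>, of exp] by (simp add: vimage_def continuous_on_exp)
    have "lagrangian_at surface (of_zw z0 (exp (- (- Ln (1 - z0)))))"
    proof (rule lagrangian_at_graph[OF \<open>open \<Omega>\<close> _ _ W, where H = "\<lambda>u. - Ln (1 - exp u)"])
      show "0 \<notin> \<Omega>" "z0 \<in> \<Omega>" using z0 False by (auto simp: \<Omega>_def)
      show "a \<in> surface \<longleftrightarrow> wco a = exp (- (- Ln (1 - zco a)))" if "a \<in> W" "zco a \<in> \<Omega>" for a
        using graph[OF that(1)] \<Omega>(3)[OF that(2)] by simp
      show "of_zw z (exp (- (- Ln (1 - z)))) \<in> W" if "z \<in> \<Omega>" for z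
      proof -
        have "exp (- (- Ln (1 - z))) = 1 - z" using \<Omega>[OF that] by simp
        moreover have "z \<noteq> 0" "1 - z \<noteq> 0" using that \<Omega>(2)[OF that] by (auto simp: \<Omega>_def)
        ultimately show ?thesis using that by (simp add: W_def \<Omega>_def)
      qed
      show "Ck_on k (\<lambda>u. - Ln (1 - exp u)) {u. exp u \<in> \<Omega>}" for k
        by (rule holomorphic_Ck_on[OF op hol])
      show "Im (D \<i>) = Re (D 1)"
        if u: "exp u \<in> \<Omega>" "((\<lambda>u. - Ln (1 - exp u)) has_derivative D) (at u)" for u D
      proof -
        obtain d where "((\<lambda>u. - Ln (1 - exp u)) has_field_derivative d) (at u)"
          using holomorphic_on_imp_differentiable_at[OF hol op] u
          by (auto simp: field_differentiable_def)
        then have "D = (*) d"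
          using has_derivative_unique[OF u(2)] by (simp add: has_field_derivative_def)
        then show ?thesis by simp
      qed
    qed simp
    then show ?thesis using \<Omega>(3)[of z0] z0 False by (simp add: \<Omega>_def)
  qed
qed

lemma lagrangian_surface: "lagrangian_submanifold surface"
  unfolding lagrangian_submanifold_iff
proof
  fix a assume "a \<in> surface"
  then consider "(zco a, wco a) \<in> leg" | "(zco a, wco a) \<in> rot ` leg" | "(zco a, wco a) \<in> rot ` rot ` leg"
    by (auto simp: surface_def sweep_def)
  moreover have base: "lagrangian_at surface b" if b: "(zco b, wco b) \<in> leg" for b
  proof -
    obtain z where z: "z \<in> sector" "zco b = z" "wco b = F z" using b by (auto simp: leg_def)
    then have "b = of_zw z (F z)" using of_zw_zco_wco[of b] by simp
    then show ?thesis using lagrangian_at_leg[OF z(1)] by simp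
  qed
  note step = lagrangian_at_rot_map[OF _ rot_map_surface]
  have zw: "rot_map b = a" if "rot (zco b, wco b) = (zco a, wco a)" for a b
    using that zw_rot_map[of b] by (intro zw_eqI) simp_all
  ultimately show "lagrangian_at surface a"
  proof cases
    case 1
    then show ?thesis by (rule base)
  next
    case 2
    then obtain z w where "(z, w) \<in> leg" "rot (z, w) = (zco a, wco a)" by auto
    then show ?thesis
      using step[OF base, of "of_zw z w"] zw[of "of_zw z w" a] leg_nonzero[of "(z, w)"] by simp
  next
    case 3
    then obtain z w where zw': "(z, w) \<in> leg" "rot (rot (z, w)) = (zco a, wco a)" by auto
    define b where "b = of_zw z w"
    have b: "(zco b, wco b) = (z, w)" using leg_nonzero[OF zw'(1)] by (simp add: b_def)
    have "rot_map (rot_map b) = a"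
      by (rule zw) (simp only: zw_rot_map b zw'(2))
    then show ?thesis using step[OF step[OF base]] b zw'(1) by metis
  qed
qed

end

text \<open>The derivative of \<open>cut\<close> has a bound independent of \<open>R\<close>, while \<open>Ln (1 - z)\<close> and \<open>Gam z\<close> vanish at
  \<open>0\<close>; so the bending becomes as small as desired when it takes place far out on the end.\<close>

lemma model_exists:
  assumes "0 < \<delta>" "\<delta> \<le> 1 / 4"
  obtains cut cut1 Gam R where "model cut cut1 Gam R \<delta>"
proof -
  obtain cut cut1 :: "real \<Rightarrow> real" and C where c:
    "\<And>k. Ck_on k cut UNIV" "\<And>k. Ck_on k cut1 UNIV" "\<And>x. (cut has_real_derivative cut1 x) (at x)"
    "\<And>x. x \<le> 0 \<Longrightarrow> cut x = 1" "\<And>x. x \<ge> 1 \<Longrightarrow> cut x = 0" "\<And>x. 0 \<le> cut x \<and> cut x \<le> 1"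
    "\<And>x. x \<le> 0 \<Longrightarrow> cut1 x = 0" "\<And>x. x \<ge> 1 \<Longrightarrow> cut1 x = 0" "C > 0" "\<And>x. \<bar>cut1 x\<bar> \<le> C"
    by (rule smooth_cutoff_exists) (rule that)
  have slit: "1 - z \<notin> \<real>\<^sub>\<le>\<^sub>0" if "norm z < 1" for z :: complex
    using that complex_Re_le_cmod[of z] by (auto simp: complex_nonpos_Reals_iff)
  define g where "g z = - Ln (1 - z)" for z :: complex
  have g: "g holomorphic_on ball 0 1"
    unfolding g_def using slit by (intro holomorphic_intros) auto
  have "(\<lambda>z. if z = 0 then deriv g 0 else (g z - g 0) / (z - 0)) holomorphic_on ball 0 1"
    by (rule pole_lemma_open[OF g open_ball])
  then obtain G where G: "\<And>z. z \<in> ball 0 1 \<Longrightarrow> (G has_field_derivative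
      (if z = 0 then deriv g 0 else (g z - g 0) / (z - 0))) (at z within ball 0 1)"
    using holomorphic_convex_primitive'[OF convex_ball open_ball] by blast
  define Gam where "Gam z = G z - G 0" for z
  have dGam: "(Gam has_field_derivative - Ln (1 - z) / z) (at z)" if "norm z < 1" "z \<noteq> 0" for z
  proof -
    have "(G has_field_derivative - Ln (1 - z) / z) (at z)"
      using G[of z] that by (simp add: at_within_open[of z "ball 0 1"] g_def)
    then show ?thesis unfolding Gam_def by (auto intro!: derivative_eq_intros)
  qed
  have "isCont G 0"
    using G[of 0] by (simp add: at_within_open[of 0 "ball 0 1"] DERIV_isCont)
  then have tG: "((\<lambda>z. norm (g z) + C * norm (Gam z)) \<longlongrightarrow> norm (g 0) + C * norm (Gam 0)) (at 0)"
    unfolding Gam_def g_def by (intro tendsto_intros) (auto simp: isCont_def)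
  moreover have "norm (g 0) + C * norm (Gam 0) = 0" by (simp add: g_def Gam_def)
  ultimately have "eventually (\<lambda>z. norm (g z) + C * norm (Gam z) < \<delta>) (at 0)"
    using assms(1) by (intro order_tendstoD(2)[OF tG]) simp
  then obtain r where r: "r > 0" "\<And>z. z \<noteq> 0 \<Longrightarrow> norm z < r \<Longrightarrow> norm (g z) + C * norm (Gam z) < \<delta>"
    unfolding eventually_at by (auto simp: dist_norm)
  define R where "R = max 2 (1 - ln r)"
  have "exp (- R) < r"
  proof -
    have "exp (- R) \<le> exp (ln r - 1)" by (simp add: R_def)
    also have "\<dots> < exp (ln r)" by simp
    also have "\<dots> = r" using r by simp
    finally show ?thesis .
  qed
  have "model cut cut1 Gam R \<delta>"
  proof
    fix z :: complex assume z: "z \<noteq> 0" "norm z \<le> exp (- R)"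
    define t where "t = - ln (norm z) - R"
    have "norm (of_real (cut t) * g z - \<i> * of_real (cut1 t * Im (Gam z)))
        \<le> norm (of_real (cut t) * g z) + norm (\<i> * of_real (cut1 t * Im (Gam z)))"
      by (rule norm_triangle_ineq4)
    also have "norm (of_real (cut t) * g z) \<le> 1 * norm (g z)"
      unfolding norm_mult using c(6)[of t] by (intro mult_right_mono) auto
    also have "norm (\<i> * of_real (cut1 t * Im (Gam z))) \<le> C * norm (Gam z)"
    proof -
      have "norm (\<i> * of_real (cut1 t * Im (Gam z))) = \<bar>cut1 t\<bar> * \<bar>Im (Gam z)\<bar>"
        by (simp add: norm_mult abs_mult)
      also have "\<dots> \<le> C * norm (Gam z)"
        using c(9) c(10)[of t] abs_Im_le_cmod[of "Gam z"] by (intro mult_mono) auto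
      finally show ?thesis .
    qed
    also have "1 * norm (g z) + C * norm (Gam z) \<le> \<delta>"
      using r(2)[of z] z \<open>exp (- R) < r\<close> by simp
    finally show "norm (of_real (cut (- ln (norm z) - R)) * - Ln (1 - z)
        - \<i> * of_real (cut1 (- ln (norm z) - R) * Im (Gam z))) \<le> \<delta>"
      unfolding t_def g_def by simp
  qed (use c dGam assms in \<open>auto simp: R_def\<close>)
  then show thesis by (rule that)
qed

section \<open>A homeomorphism from the model surface to the tropical line\<close>

text \<open>Rays through \<open>0\<close> are preserved by all the maps of this part. A ray is recorded by \<open>sgn z\<close>, which
  is kept folded, and by the unsigned angle \<open>ang z\<close>, which unlike \<open>Arg z\<close> is continuous on the
  negative axis.\<close>

declare Re_sgn [simp del] Im_sgn [simp del]

definition ang :: "complex \<Rightarrow> real" where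
  "ang z = arccos (Re (sgn z))"

text \<open>\<open>ang_max z\<close> is the largest angle at the vertex \<open>1\<close> and \<open>log_min z\<close> the least value of
  \<open>- ln \<bar>z\<bar>\<close> that occur in \<open>sector\<close> in the direction of \<open>z\<close>.\<close>

definition ang_max :: "complex \<Rightarrow> real" where
  "ang_max z = min (ang z) ((pi - ang z) / 2)"

definition log_min :: "complex \<Rightarrow> real" where
  "log_min z = ln (max 1 (2 * Re (sgn z)))"

definition slope :: "complex \<Rightarrow> real" where
  "slope z = (1 + ang_max z) / (1 - log_min z)"

text \<open>On each ray, \<open>height\<close> is the piecewise affine function of \<open>x = - ln \<bar>z\<bar>\<close> that is \<open>x\<close> for
  \<open>x \<ge> 1\<close> and maps \<open>[log_min, 1]\<close> to \<open>[- ang_max, 1]\<close>. Its positive part is the position on a leg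
  of the tropical line, its negative part the depth in the triangle over the vertex.\<close>

definition height :: "complex \<Rightarrow> real" where
  "height z = - ln (norm z) + max 0 (1 + ln (norm z)) * (1 - slope z)"

text \<open>The image of a point of \<open>sector\<close> in the PL model, in the coordinates \<open>zco\<close> and \<open>wco\<close>. The side of
  the real axis decides which of the two triangles over the vertex is entered.\<close>

definition pl_profile :: "complex \<Rightarrow> complex \<times> complex" where
  "pl_profile z = (of_real (exp (- max (height z) 0)) * sgn z,
     if Im z \<le> 0 then cis (max (- height z) 0) else cis (- max (- height z) 0))"

text \<open>At most one of the positive and the negative part of \<open>height\<close> is nonzero, so that it can be read
  off from its image as a difference; this gives the inverse of the profile map.\<close>

definition depth_of :: "complex \<times> complex \<Rightarrow> real" where
  "depth_of p = - ln (norm (fst p)) - arccos (Re (snd p))"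

definition pl_inverse :: "complex \<times> complex \<Rightarrow> complex" where
  "pl_inverse p = of_real (exp (- (depth_of p + max 0 (1 - depth_of p) * (1 - 1 / slope (fst p))))) * sgn (fst p)"

lemma ang_bounds: "0 \<le> ang z" "ang z \<le> pi"
  and cos_ang: "cos (ang z) = Re (sgn z)"
proof -
  have "\<bar>Re (sgn z)\<bar> \<le> 1"
    using abs_Re_le_cmod[of "sgn z"] by (cases "z = 0") (simp_all add: norm_sgn)
  then show "0 \<le> ang z" "ang z \<le> pi" "cos (ang z) = Re (sgn z)"
    unfolding ang_def abs_le_iff by (simp_all add: arccos_lbound arccos_ubound)
qed

lemma sgn_polar: "z \<noteq> 0 \<Longrightarrow> sgn z = cis (if Im z \<le> 0 then - ang z else ang z)"
proof -
  assume z: "z \<noteq> 0"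
  have "(Re (sgn z))\<^sup>2 + (Im (sgn z))\<^sup>2 = 1"
    using z by (metis cmod_power2 norm_sgn one_power2)
  then have "(Im (sgn z))\<^sup>2 = (sin (ang z))\<^sup>2"
    using sin_cos_squared_add[of "ang z"] by (simp add: cos_ang)
  then have "\<bar>Im (sgn z)\<bar> = sin (ang z)"
    using sin_ge_zero[OF ang_bounds] by (metis abs_of_nonneg power2_eq_iff_nonneg power2_abs abs_ge_zero)
  moreover have "Im (sgn z) = Im z / norm z" by (rule Im_sgn)
  then have "Im (sgn z) \<le> 0 \<longleftrightarrow> Im z \<le> 0" using z by (simp add: divide_le_0_iff)
  ultimately have "Im (sgn z) = (if Im z \<le> 0 then - sin (ang z) else sin (ang z))" by auto
  then show ?thesis by (simp add: complex_eq_iff cos_ang)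
qed

lemma ang_max_bounds: "0 \<le> ang_max z" "ang_max z \<le> pi / 3" "ang_max z \<le> ang z" "2 * ang_max z \<le> pi - ang z"
  using ang_bounds[of z] by (auto simp: ang_max_def min_def)

lemma log_min_bounds: "0 \<le> log_min z" "log_min z < 1"
proof -
  have "Re (sgn z) \<le> 1" using cos_ang[of z] cos_le_one[of "ang z"] by simp
  then have "log_min z \<le> ln 2" unfolding log_min_def by (subst ln_le_cancel_iff) auto
  also have "\<dots> < 1" using ln_2_less_1 .
  finally show "log_min z < 1" .
qed (simp add: log_min_def)

lemma slope_pos: "0 < slope z"
  using ang_max_bounds[of z] log_min_bounds[of z] by (simp add: slope_def add_nonneg_pos)

lemma sgn_scale: "0 < r \<Longrightarrow> sgn (of_real r * z) = sgn (z :: complex)"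
  by (simp add: sgn_mult sgn_of_real)

lemma direction_cong:
  assumes "sgn z = sgn z'"
  shows "ang z = ang z'" "ang_max z = ang_max z'" "log_min z = log_min z'" "slope z = slope z'"
  using assms by (simp_all add: ang_def ang_max_def log_min_def slope_def)

lemma sector_iff: "z \<noteq> 0 \<Longrightarrow> z \<in> sector \<longleftrightarrow> log_min z \<le> - ln (norm z)"
proof -
  assume z: "z \<noteq> 0"
  have le: "norm z \<le> norm (1 - z) \<longleftrightarrow> 2 * Re z \<le> 1"
  proof -
    have "norm z \<le> norm (1 - z) \<longleftrightarrow> (norm z)\<^sup>2 \<le> (norm (1 - z))\<^sup>2"
      by (simp add: power2_le_iff_abs_le)
    also have "\<dots> \<longleftrightarrow> 2 * Re z \<le> 1" unfolding cmod_power2 by (simp add: power2_eq_square algebra_simps)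
    finally show ?thesis .
  qed
  have re: "Re (sgn z) = Re z / norm z" by (rule Re_sgn)
  have "log_min z \<le> - ln (norm z) \<longleftrightarrow> max 1 (2 * Re (sgn z)) \<le> inverse (norm z)"
    using z unfolding log_min_def ln_inverse[symmetric] by (subst ln_le_cancel_iff) auto
  also have "\<dots> \<longleftrightarrow> norm z \<le> 1 \<and> 2 * Re z \<le> 1"
    using z by (simp add: re inverse_eq_divide field_simps)
  finally show ?thesis using z le by (simp add: sector_def)
qed

lemma height_ge: "z \<in> sector \<Longrightarrow> height z \<ge> - ang_max z"
proof -
  assume z: "z \<in> sector"
  define x where "x = - ln (norm z)"
  have x: "log_min z \<le> x" using sector_iff[OF sector_nonzero[OF z]] z by (simp add: x_def)
  have h: "height z = x + max 0 (1 - x) * (1 - slope z)" by (simp add: height_def x_def)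
  show ?thesis
  proof (cases "x \<ge> 1")
    case True
    then show ?thesis using h ang_max_bounds[of z] by simp
  next
    case False
    have "(1 - x) * slope z \<le> (1 - log_min z) * slope z"
      using x slope_pos[of z] by (intro mult_right_mono) auto
    also have "\<dots> = 1 + ang_max z" using log_min_bounds[of z] by (simp add: slope_def)
    finally show ?thesis using h False by (simp add: max_def algebra_simps)
  qed
qed

lemma height_min: "z \<in> sector \<Longrightarrow> height z = - ang_max z \<longleftrightarrow> - ln (norm z) = log_min z"
proof -
  assume z: "z \<in> sector"
  define x where "x = - ln (norm z)"
  have x: "log_min z \<le> x" using sector_iff[OF sector_nonzero[OF z]] z by (simp add: x_def)
  have h: "height z = x + max 0 (1 - x) * (1 - slope z)" by (simp add: height_def x_def)
  show ?thesis
  proof (cases "x \<ge> 1")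
    case True
    then show ?thesis using h ang_max_bounds[of z] log_min_bounds[of z] by (simp add: x_def[symmetric])
  next
    case False
    have "1 + ang_max z = (1 - log_min z) * slope z" using log_min_bounds[of z] by (simp add: slope_def)
    then have "height z + ang_max z = (x - log_min z) * slope z"
      using h False by (simp add: max_def algebra_simps)
    then show ?thesis using slope_pos[of z] unfolding x_def[symmetric]
      by (metis add.inverse_unique add.commute eq_iff_diff_eq_0 less_irrefl mult_eq_0_iff neg_eq_iff_add_eq_0)
  qed
qed

lemma height_end: "z \<noteq> 0 \<Longrightarrow> norm z \<le> exp (- 1) \<Longrightarrow> height z = - ln (norm z)"
  using ln_le_cancel_iff[of "norm z" "exp (- 1)"] by (simp add: height_def)

lemma height_inverse:
  "height z + max 0 (1 - height z) * (1 - 1 / slope z) = - ln (norm z)"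
proof -
  define x where "x = - ln (norm z)"
  have h: "height z = x + max 0 (1 - x) * (1 - slope z)" by (simp add: height_def x_def)
  show ?thesis
  proof (cases "x \<ge> 1")
    case True
    then show ?thesis using h by (simp add: x_def)
  next
    case False
    then have "1 - height z = (1 - x) * slope z" using h by (simp add: max_def algebra_simps)
    moreover from this have "1 - height z > 0" using False slope_pos[of z] by simp
    ultimately show ?thesis using slope_pos[of z]
      by (simp add: max_def algebra_simps x_def[symmetric]) (simp add: field_simps)
  qed
qed

lemma height_surj:
  assumes "u \<noteq> 0" "h \<ge> - ang_max u"
  obtains z where "z \<in> sector" "sgn z = sgn u" "height z = h"
proof -
  define x where "x = h + max 0 (1 - h) * (1 - 1 / slope u)"
  define z where "z = of_real (exp (- x)) * sgn u"
  have z: "z \<noteq> 0" "sgn z = sgn u" "- ln (norm z) = x"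
    using assms by (simp_all add: z_def sgn_scale norm_mult norm_sgn sgn_zero_iff)
  note cong = direction_cong[OF z(2)]
  have x: "log_min u \<le> x \<and> x + max 0 (1 - x) * (1 - slope u) = h"
  proof (cases "h \<ge> 1")
    case True
    then show ?thesis using log_min_bounds[of u] by (simp add: x_def)
  next
    case False
    then have x1: "(1 - x) * slope u = 1 - h"
      using slope_pos[of u] by (simp add: x_def max_def field_simps)
    have "1 - h \<le> 1 + ang_max u" using assms by simp
    also have "\<dots> = (1 - log_min u) * slope u" using log_min_bounds[of u] by (simp add: slope_def)
    finally have "(1 - x) * slope u \<le> (1 - log_min u) * slope u" using x1 by simp
    then have "1 - x \<le> 1 - log_min u" by (rule mult_right_le_imp_le[OF _ slope_pos])
    moreover have "1 - x > 0" using x1 False slope_pos[of u] by (metis diff_gt_0_iff_gt not_le zero_less_mult_pos2)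
    ultimately show ?thesis using x1 by (simp add: max_def algebra_simps)
  qed
  then have "height z = h" unfolding height_def using z cong by (metis diff_minus_eq_add)
  moreover have "z \<in> sector" using sector_iff[OF z(1)] x z cong by simp
  ultimately show thesis using that z by blast
qed

lemma norm_fst_profile: "z \<noteq> 0 \<Longrightarrow> norm (fst (pl_profile z)) = exp (- max (height z) 0)"
  by (simp add: pl_profile_def norm_mult norm_sgn)

lemma sgn_fst_profile: "sgn (fst (pl_profile z)) = sgn z"
  by (simp add: pl_profile_def sgn_scale)

lemma norm_snd_profile: "norm (snd (pl_profile z)) = 1"
  by (simp add: pl_profile_def)

lemma profile_nonzero: "z \<noteq> 0 \<Longrightarrow> fst (pl_profile z) \<noteq> 0 \<and> snd (pl_profile z) \<noteq> 0"
  using norm_snd_profile[of z] by (auto simp: pl_profile_def sgn_zero_iff)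

lemma Re_snd_profile: "Re (snd (pl_profile z)) = cos (max (- height z) 0)"
  by (simp add: pl_profile_def)

lemma depth_bounds:
  assumes "z \<in> sector"
  shows "0 \<le> max (- height z) 0" "max (- height z) 0 \<le> ang_max z" "max (- height z) 0 \<le> pi"
  using height_ge[OF assms] ang_max_bounds[of z] by auto

lemma pl_inverse_profile:
  assumes "z \<in> sector"
  shows "pl_inverse (pl_profile z) = z"
proof -
  have z: "z \<noteq> 0" using sector_nonzero[OF assms] .
  have "arccos (Re (snd (pl_profile z))) = max (- height z) 0"
    unfolding Re_snd_profile using depth_bounds[OF assms] by (intro arccos_cos)
  then have d: "depth_of (pl_profile z) = height z"
    by (simp add: depth_of_def norm_fst_profile[OF z] max_def)
  have s: "slope (fst (pl_profile z)) = slope z" by (rule direction_cong(4)[OF sgn_fst_profile])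
  have "pl_inverse (pl_profile z) = of_real (exp (- (- ln (norm z)))) * sgn z"
    unfolding pl_inverse_def d s sgn_fst_profile height_inverse ..
  also have "\<dots> = z" using z by (simp add: sgn_div_norm scaleR_conv_of_real)
  finally show ?thesis .
qed

lemma profile_end: "z \<noteq> 0 \<Longrightarrow> norm z \<le> exp (- 1) \<Longrightarrow> pl_profile z = (z, 1)"
proof -
  assume z: "z \<noteq> 0" "norm z \<le> exp (- 1)"
  then have "ln (norm z) \<le> - 1" using ln_le_cancel_iff[of "norm z" "exp (- 1)"] by simp
  then have e: "max (height z) 0 = - ln (norm z)" "max (- height z) 0 = 0"
    unfolding height_end[OF z] by simp_all
  show ?thesis
    unfolding pl_profile_def e using z by (simp add: sgn_div_norm scaleR_conv_of_real)
qed

lemma continuous_on_direction: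
  "continuous_on (- {0}) ang_max" "continuous_on (- {0}) log_min" "continuous_on (- {0}) slope"
proof -
  have s: "continuous_on (- {0}) (\<lambda>z. Re (sgn z :: complex))"
    by (intro continuous_intros) auto
  have a: "continuous_on (- {0}) ang"
    unfolding ang_def
  proof (rule continuous_on_arccos[OF s])
    show "\<forall>z\<in>- {0}. - 1 \<le> Re (sgn z) \<and> Re (sgn z) \<le> 1"
      using cos_ang cos_le_one cos_ge_minus_one by metis
  qed
  show 1: "continuous_on (- {0}) ang_max"
    unfolding ang_max_def by (intro continuous_intros a) auto
  show 2: "continuous_on (- {0}) log_min"
    unfolding log_min_def by (intro continuous_intros s) auto
  show "continuous_on (- {0}) slope"
    unfolding slope_def using log_min_bounds
    by (intro continuous_intros 1 2) (auto simp: less_imp_neq[symmetric])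
qed

lemma continuous_on_profile:
  "continuous_on sector (\<lambda>z. fst (pl_profile z))" "continuous_on sector (\<lambda>z. snd (pl_profile z))"
proof -
  have nz: "sector \<subseteq> - {0}" using sector_nonzero by blast
  have h: "continuous_on sector height"
    unfolding height_def using nz continuous_on_subset[OF continuous_on_direction(3) nz]
    by (intro continuous_intros) auto
  show "continuous_on sector (\<lambda>z. fst (pl_profile z))"
    unfolding pl_profile_def fst_conv using nz by (intro continuous_intros h) auto
  have "continuous_on sector (\<lambda>z. if Im z \<le> 0 then cis (max (- height z) 0) else cis (- max (- height z) 0))"
  proof (rule continuous_on_cases_le)
    show "continuous_on {z \<in> sector. Im z \<le> 0} (\<lambda>z. cis (max (- height z) 0))"
      "continuous_on {z \<in> sector. 0 \<le> Im z} (\<lambda>z. cis (- max (- height z) 0))"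
      by (intro continuous_intros continuous_on_subset[OF h]; blast)+
    show "continuous_on sector Im" by (intro continuous_intros)
    fix z assume z: "z \<in> sector" "Im z = 0"
    have "sgn z = cis (- ang z)" using sgn_polar[OF sector_nonzero[OF z(1)]] z(2) by simp
    then have "sin (ang z) = 0" using z(2) by (simp add: complex_eq_iff Im_sgn)
    then have "ang z = 0 \<or> ang z = pi"
      using ang_bounds[of z] sin_gt_zero[of "ang z"] by linarith
    then have "ang_max z = 0" by (auto simp: ang_max_def)
    then have "max (- height z) 0 = 0" using depth_bounds[OF z(1)] by linarith
    then show "cis (max (- height z) 0) = cis (- max (- height z) 0)" by simp
  qed
  then show "continuous_on sector (\<lambda>z. snd (pl_profile z))"
    unfolding pl_profile_def snd_conv .
qed

lemma continuous_on_pl_inverse: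
  "continuous_on {p. fst p \<noteq> 0 \<and> norm (snd p) = 1} pl_inverse"
proof -
  let ?S = "{p :: complex \<times> complex. fst p \<noteq> 0 \<and> norm (snd p) = 1}"
  have ac: "continuous_on ?S (\<lambda>p. arccos (Re (snd p)))"
  proof (rule continuous_on_arccos)
    show "\<forall>p\<in>?S. - 1 \<le> Re (snd p) \<and> Re (snd p) \<le> 1"
      using abs_Re_le_cmod by (metis (mono_tags, lifting) abs_le_iff mem_Collect_eq minus_le_iff)
  qed (intro continuous_intros)
  have d: "continuous_on ?S depth_of"
    unfolding depth_of_def
    by (intro continuous_on_diff continuous_on_minus continuous_on_ln continuous_on_norm ac
        continuous_on_fst continuous_on_id) auto
  have s: "continuous_on ?S (\<lambda>p. slope (fst p))"
    by (rule continuous_on_compose2[OF continuous_on_direction(3) continuous_on_fst[OF continuous_on_id]]) auto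
  show ?thesis
    unfolding pl_inverse_def using slope_pos
    by (intro continuous_intros d s) (auto simp: less_imp_neq[symmetric])
qed

lemma one_minus_cis: "1 - cis b = of_real (2 * sin (b / 2)) * cis ((b - pi) / 2)"
proof -
  have "cos b = 1 - 2 * (sin (b / 2))\<^sup>2" "sin b = 2 * sin (b / 2) * cos (b / 2)"
    using cos_double_sin[of "b / 2"] sin_double[of "b / 2"] by simp_all
  moreover have "cos ((b - pi) / 2) = sin (b / 2)" "sin ((b - pi) / 2) = - cos (b / 2)"
    by (simp_all add: diff_divide_distrib cos_diff sin_diff)
  ultimately show ?thesis by (simp add: complex_eq_iff power2_eq_square)
qed

lemma sector_Re: "z \<in> sector \<Longrightarrow> 2 * Re z \<le> 1"
  and sector_Re_eq: "norm z = norm (1 - z) \<longleftrightarrow> 2 * Re z = 1"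
proof -
  have *: "(norm z)\<^sup>2 - (norm (1 - z))\<^sup>2 = 2 * Re z - 1" for z
    unfolding cmod_power2 by (simp add: power2_eq_square algebra_simps)
  have "norm z = norm (1 - z) \<longleftrightarrow> (norm z)\<^sup>2 = (norm (1 - z))\<^sup>2" by simp
  then show "norm z = norm (1 - z) \<longleftrightarrow> 2 * Re z = 1" using *[of z] by linarith
  assume "z \<in> sector"
  then have "(norm z)\<^sup>2 \<le> (norm (1 - z))\<^sup>2" by (intro power_mono) (auto simp: sector_def)
  then show "2 * Re z \<le> 1" using *[of z] by linarith
qed

text \<open>On the two edges of \<open>sector\<close>, where the thirds of the surface meet, the profile map is the
  projection along \<open>M\<^sub>\<real>\<close> of the line \<open>w = 1 - z\<close> to the fibre over the vertex. This formula is
  invariant under \<open>rot\<close>, so the maps of the three thirds fit together.\<close>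

lemma profile_edge:
  assumes "z \<in> sector" "norm z = 1 \<or> norm z = norm (1 - z)"
  shows "pl_profile z = (sgn z, sgn (1 - z))" "height z = - ang_max z"
proof -
  have z: "z \<noteq> 0" using sector_nonzero[OF assms(1)] .
  have re: "Re (sgn z) = Re z / norm z" by (rule Re_sgn)
  have cos3: "cos (pi / 3) = 1 / 2" by (rule cos_60)
  have *: "- ln (norm z) = log_min z \<and>
    sgn (1 - z) = (if Im z \<le> 0 then cis (ang_max z) else cis (- ang_max z))"
    using assms(2)
  proof
    assume n: "norm z = 1"
    have r: "2 * Re (sgn z) \<le> 1" using sector_Re[OF assms(1)] n re by simp
    then have "cos (ang z) \<le> cos (pi / 3)" by (simp add: cos_ang cos3)
    then have a: "ang z \<ge> pi / 3" using cos_mono_le_eq[of "ang z" "pi / 3"] ang_bounds[of z] by simp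
    then have am: "ang_max z = (pi - ang z) / 2" by (simp add: ang_max_def)
    have "sin (ang z / 2) > 0" using a ang_bounds[of z] pi_gt_zero by (intro sin_gt_zero) linarith+
    then have s: "sgn (complex_of_real (2 * sin (ang z / 2)) * cis t) = cis t" for t
      by (subst sgn_scale) (auto simp: sgn_div_norm)
    have "z = sgn z" using n by (simp add: sgn_div_norm)
    then have zc: "z = cis (if Im z \<le> 0 then - ang z else ang z)" using sgn_polar[OF z] by simp
    have "sgn (1 - z) = (if Im z \<le> 0 then cis (ang_max z) else cis (- ang_max z))"
    proof (cases "Im z \<le> 0")
      case True
      then have "1 - z = 1 - cis (- ang z)" using zc by simp
      also have "\<dots> = cnj (1 - cis (ang z))" by (simp add: cis_cnj)
      also have "\<dots> = of_real (2 * sin (ang z / 2)) * cis (- ((ang z - pi) / 2))"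
        unfolding one_minus_cis by (simp add: cis_cnj)
      finally have "sgn (1 - z) = cis (- ((ang z - pi) / 2))" using s by simp
      moreover have "- ((ang z - pi) / 2) = ang_max z" by (simp add: am field_simps)
      ultimately show ?thesis using True by simp
    next
      case False
      then have "1 - z = of_real (2 * sin (ang z / 2)) * cis ((ang z - pi) / 2)"
        using zc one_minus_cis[of "ang z"] by simp
      then have "sgn (1 - z) = cis ((ang z - pi) / 2)" using s by simp
      moreover have "(ang z - pi) / 2 = - ang_max z" by (simp add: am field_simps)
      ultimately show ?thesis using False by simp
    qed
    moreover have "log_min z = 0" using r by (simp add: log_min_def)
    ultimately show ?thesis using n by simp
  next
    assume n: "norm z = norm (1 - z)"
    then have "2 * Re z = 1" by (simp add: sector_Re_eq)
    then have c: "1 - z = cnj z" by (simp add: complex_eq_iff)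
    have r: "2 * Re (sgn z) = 1 / norm z" using \<open>2 * Re z = 1\<close> re by simp
    have "norm z \<le> 1" using assms(1) by (simp add: sector_def)
    then have ge: "1 / norm z \<ge> 1" using z by simp
    then have "log_min z = ln (1 / norm z)" by (simp add: log_min_def r)
    then have l: "log_min z = - ln (norm z)" using z by (simp add: ln_div)
    have "cos (pi / 3) \<le> cos (ang z)" using r ge by (simp add: cos_ang cos3)
    then have a: "ang z \<le> pi / 3" using cos_mono_le_eq[of "pi / 3" "ang z"] ang_bounds[of z] by simp
    then have am: "ang_max z = ang z" by (simp add: ang_max_def)
    have "sgn (1 - z) = cnj (sgn z)" by (simp add: c sgn_div_norm)
    also have "\<dots> = (if Im z \<le> 0 then cis (ang_max z) else cis (- ang_max z))"
      by (simp add: sgn_polar[OF z] cis_cnj am)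
    finally show ?thesis using l by simp
  qed
  then show h: "height z = - ang_max z" using height_min[OF assms(1)] by simp
  have "max (height z) 0 = 0" "max (- height z) 0 = ang_max z"
    using h ang_max_bounds[of z] by auto
  then show "pl_profile z = (sgn z, sgn (1 - z))"
    unfolding pl_profile_def using * by simp
qed

text \<open>Conversely the profiles of two thirds agree only there: equality forces both angles to be
  extremal, by comparing real parts.\<close>

lemma profile_rot_imp_edge:
  assumes z: "z \<in> sector" and y: "y \<in> sector" and eq: "pl_profile z = rot (pl_profile y)"
  shows "norm y = norm (1 - y)" "norm z = 1" "z = - (1 - y) / y"
proof -
  have nz: "z \<noteq> 0" "y \<noteq> 0" using z y sector_nonzero by auto
  define m where "m = max (- height z) 0"
  define n where "n = max (- height y) 0"
  have mb: "0 \<le> m" "m \<le> ang_max z" "m \<le> pi" and nb: "0 \<le> n" "n \<le> ang_max y" "n \<le> pi"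
    unfolding m_def n_def using depth_bounds[OF z] depth_bounds[OF y] by blast+
  have q: "fst (pl_profile z) = - snd (pl_profile y) / fst (pl_profile y)"
    "snd (pl_profile z) = 1 / fst (pl_profile y)"
    using eq by (simp_all add: rot_def)
  have "norm (fst (pl_profile y)) = 1"
    using arg_cong[OF q(2), of norm] norm_snd_profile[of z] by (simp add: norm_divide)
  then have hy: "max (height y) 0 = 0" using norm_fst_profile[OF nz(2)] by simp
  have "norm (fst (pl_profile z)) = 1"
    using arg_cong[OF q(1), of norm] norm_snd_profile[of y] \<open>norm (fst (pl_profile y)) = 1\<close>
    by (simp add: norm_divide)
  then have hz: "max (height z) 0 = 0" using norm_fst_profile[OF nz(1)] by simp
  have fz: "fst (pl_profile z) = cis (if Im z \<le> 0 then - ang z else ang z)"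
    and fy: "fst (pl_profile y) = cis (if Im y \<le> 0 then - ang y else ang y)"
    unfolding pl_profile_def fst_conv hz hy using sgn_polar nz by simp_all
  have "Re (snd (pl_profile z)) = cos (ang y)"
    unfolding q(2) fy by (simp add: cis_divide[of 0, simplified])
  then have "cos m = cos (ang y)" by (simp add: Re_snd_profile m_def)
  from cos_inj_pi[OF mb(1,3) ang_bounds this] have m: "m = ang y" .
  have sy: "snd (pl_profile y) = cis (if Im y \<le> 0 then n else - n)"
    unfolding pl_profile_def n_def by simp
  have "cos (ang z) = Re (fst (pl_profile z))" unfolding fz by simp
  also have "\<dots> = - cos (n + ang y)"
    unfolding q(1) fy sy by (simp add: cis_divide cos_add cos_diff algebra_simps)
  also have "\<dots> = cos (pi - (n + ang y))" by simp
  finally have "cos (ang z) = cos (pi - (n + ang y))" .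
  moreover have "0 \<le> pi - (n + ang y)" "pi - (n + ang y) \<le> pi"
    using ang_bounds[of y] nb ang_max_bounds[of y] by linarith+
  ultimately have "ang z = pi - (n + ang y)"
    using cos_inj_pi[OF ang_bounds, of "pi - (n + ang y)" z] by blast
  moreover have "2 * m \<le> pi - ang z" "n \<le> ang y" "m \<le> ang_max z" "n \<le> ang_max y"
    using mb nb ang_max_bounds[of z] ang_max_bounds[of y] by linarith+
  ultimately have n: "n = ang y" "ang z = pi - 2 * ang y" and max: "ang_max y = ang y" "ang_max z = ang y"
    using m ang_max_bounds[of z] ang_max_bounds[of y] by linarith+
  have "height y = - ang_max y" "height z = - ang_max z"
    using n(1) m max hy hz unfolding m_def n_def by linarith+
  then have ly: "- ln (norm y) = log_min y" and lz: "- ln (norm z) = log_min z"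
    using height_min[OF y] height_min[OF z] by auto
  have cos3: "cos (pi / 3) = 1 / 2" by (rule cos_60)
  have a: "ang y \<le> pi / 3" using ang_max_bounds[of y] max by simp
  have "1 / 2 \<le> cos (ang y)" using cos_mono_le_eq[of "pi / 3" "ang y"] a ang_bounds[of y] cos3 by simp
  then have c: "2 * Re (sgn y) \<ge> 1" by (simp add: cos_ang)
  then have "ln (1 / norm y) = ln (2 * Re (sgn y))"
    using ly nz by (simp add: log_min_def ln_div max_def)
  then have "1 / norm y = 2 * Re (sgn y)"
    using nz c by (subst (asm) ln_inj_iff) auto
  then show ny: "norm y = norm (1 - y)" using nz by (simp add: sector_Re_eq Re_sgn)
  have "cos (ang z) \<le> cos (pi / 3)"
    using cos_mono_le_eq[of "ang z" "pi / 3"] ang_bounds[of z] n a by simp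
  then have "2 * Re (sgn z) \<le> 1" by (simp add: cos3 cos_ang)
  then show nz1: "norm z = 1" using lz nz by (simp add: log_min_def max_def split: if_splits)
  have pz: "fst (pl_profile z) = z" using profile_edge(1)[OF z disjI1[OF nz1]] nz1 by (simp add: sgn_div_norm)
  have "pl_profile y = (sgn y, sgn (1 - y))" by (rule profile_edge(1)[OF y disjI2[OF ny]])
  then have "z = - sgn (1 - y) / sgn y" using q(1) pz by simp
  also have "\<dots> = - (1 - y) / y" unfolding sgn_eq ny[symmetric] using nz by simp
  finally show "z = - (1 - y) / y" .
qed

text \<open>The three translates of \<open>A\<close> are closed, so a map pasted from their pieces is continuous as soon as
  it is well defined; because \<open>\<rho>\<close> has order three it suffices to compare \<open>A\<close> with one translate.\<close>

lemma equivariant_extension: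
  fixes \<rho> f :: "'a::topological_space \<Rightarrow> 'a"
  assumes A: "closed A" "continuous_on A f"
    and \<rho>: "\<And>S. continuous_on S \<rho>" "\<And>a. \<rho> (\<rho> (\<rho> a)) = a"
    and eq: "\<And>a b. a \<in> A \<Longrightarrow> b \<in> A \<Longrightarrow> a = \<rho> b \<Longrightarrow> f a = \<rho> (f b)"
  obtains h where "continuous_on (A \<union> \<rho> ` A \<union> \<rho> ` \<rho> ` A) h" "\<And>a. a \<in> A \<Longrightarrow> h a = f a"
    "\<And>a. a \<in> A \<Longrightarrow> h (\<rho> a) = \<rho> (f a)" "\<And>a. a \<in> A \<Longrightarrow> h (\<rho> (\<rho> a)) = \<rho> (\<rho> (f a))"
proof -
  define h where "h x = (if x \<in> A then f x else if \<rho> (\<rho> x) \<in> A then \<rho> (f (\<rho> (\<rho> x))) else \<rho> (\<rho> (f (\<rho> x))))" for x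
  have h1: "h x = f x" if "x \<in> A" for x using that by (simp add: h_def)
  have h2: "h x = \<rho> (f (\<rho> (\<rho> x)))" if "\<rho> (\<rho> x) \<in> A" for x
    using that eq[of x "\<rho> (\<rho> x)"] \<rho>(2)[of x] by (simp add: h_def)
  have h3: "h x = \<rho> (\<rho> (f (\<rho> x)))" if x: "\<rho> x \<in> A" for x
  proof (cases "x \<in> A")
    case True
    have "f (\<rho> x) = \<rho> (f x)" using eq[OF x True] by simp
    then show ?thesis using True \<rho>(2) by (simp add: h_def)
  next
    case False
    show ?thesis
    proof (cases "\<rho> (\<rho> x) \<in> A")
      case True
      have "f (\<rho> (\<rho> x)) = \<rho> (f (\<rho> x))" using eq[OF True x] by simp
      then show ?thesis using h2[OF True] by simp
    qed (use False in \<open>simp add: h_def\<close>)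
  qed
  have i2: "\<rho> ` A = (\<lambda>x. \<rho> (\<rho> x)) -` A"
  proof (intro equalityI subsetI)
    fix x assume "x \<in> (\<lambda>x. \<rho> (\<rho> x)) -` A"
    then show "x \<in> \<rho> ` A" using \<rho>(2)[of x] by (metis imageI vimageD)
  qed (auto simp: \<rho>(2))
  have i3: "\<rho> ` \<rho> ` A = \<rho> -` A"
  proof (intro equalityI subsetI)
    fix x assume "x \<in> \<rho> -` A"
    then show "x \<in> \<rho> ` \<rho> ` A" using \<rho>(2)[of x] by (metis imageI vimageD)
  qed (auto simp: \<rho>(2))
  have c2: "continuous_on UNIV (\<lambda>x. \<rho> (\<rho> x))"
    by (rule continuous_on_compose2[OF \<rho>(1)[of UNIV] \<rho>(1)]) simp
  have cl: "closed (\<rho> ` A)" "closed (\<rho> ` \<rho> ` A)"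
    using closed_vimage[OF A(1) c2, folded i2] closed_vimage[OF A(1) \<rho>(1), folded i3]
    by blast+
  have "continuous_on A h" using A(2) by (rule continuous_on_cong[THEN iffD2, OF refl h1, rotated])
  moreover have "continuous_on (\<rho> ` A) h"
  proof (rule continuous_on_cong[THEN iffD2, OF refl h2])
    have "continuous_on (\<rho> ` A) (\<lambda>x. f (\<rho> (\<rho> x)))"
      by (rule continuous_on_compose2[OF A(2) continuous_on_subset[OF c2]]) (auto simp: \<rho>(2))
    then show "continuous_on (\<rho> ` A) (\<lambda>x. \<rho> (f (\<rho> (\<rho> x))))"
      by (rule continuous_on_compose2[OF \<rho>(1)[of UNIV]]) simp
  qed (auto simp: \<rho>(2))
  moreover have "continuous_on (\<rho> ` \<rho> ` A) h"
  proof (rule continuous_on_cong[THEN iffD2, OF refl h3])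
    have "continuous_on (\<rho> ` \<rho> ` A) (\<lambda>x. f (\<rho> x))"
      by (rule continuous_on_compose2[OF A(2) \<rho>(1)]) (auto simp: \<rho>(2))
    then show "continuous_on (\<rho> ` \<rho> ` A) (\<lambda>x. \<rho> (\<rho> (f (\<rho> x))))"
      by (rule continuous_on_compose2[OF c2]) simp
  qed (auto simp: \<rho>(2))
  ultimately have "continuous_on (A \<union> \<rho> ` A \<union> \<rho> ` \<rho> ` A) h"
    using A(1) cl by (intro continuous_on_closed_Un) auto
  then show thesis by (rule that) (simp_all add: h1 h2 h3 \<rho>(2))
qed

definition sweep_map :: "(MR \<times> torus) set \<Rightarrow> (MR \<times> torus) set" where
  "sweep_map A = A \<union> rot_map ` A \<union> rot_map ` rot_map ` A"

lemma sweep_mapI: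
  "b \<in> A \<Longrightarrow> b \<in> sweep_map A" "b \<in> A \<Longrightarrow> rot_map b \<in> sweep_map A"
  "b \<in> A \<Longrightarrow> rot_map (rot_map b) \<in> sweep_map A"
  unfolding sweep_map_def by blast+

lemma sweep_mapE:
  assumes "a \<in> sweep_map A"
  obtains b where "b \<in> A" "a = b" | b where "b \<in> A" "a = rot_map b"
    | b where "b \<in> A" "a = rot_map (rot_map b)"
  using assms unfolding sweep_map_def by blast

definition profile_point :: "complex \<Rightarrow> MR \<times> torus" where
  "profile_point z = of_zw (fst (pl_profile z)) (snd (pl_profile z))"

definition PLeg :: "(MR \<times> torus) set" where
  "PLeg = profile_point ` sector"

lemma zw_profile_point:
  "z \<noteq> 0 \<Longrightarrow> zco (profile_point z) = fst (pl_profile z)"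
  "z \<noteq> 0 \<Longrightarrow> wco (profile_point z) = snd (pl_profile z)"
  using profile_nonzero[of z] by (simp_all add: profile_point_def)

lemma profile_point_eq_iff:
  assumes "z \<noteq> 0" "y \<noteq> 0"
  shows "profile_point z = rot_map (profile_point y) \<longleftrightarrow> pl_profile z = rot (pl_profile y)"
proof -
  have "(zco (rot_map (profile_point y)), wco (rot_map (profile_point y))) = rot (pl_profile y)"
    unfolding zw_rot_map using zw_profile_point[OF assms(2)] by simp
  moreover have "(zco (profile_point z), wco (profile_point z)) = pl_profile z"
    using zw_profile_point[OF assms(1)] by simp
  ultimately show ?thesis by (metis prod.inject zw_eqI)
qed

lemma continuous_on_profile_point: "continuous_on sector profile_point"
  unfolding profile_point_def
  using profile_nonzero sector_nonzero
  by (intro continuous_on_of_zw_compose continuous_on_profile) auto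

lemma closed_insert_sector: "closed (insert 0 sector)"
proof -
  have "insert 0 sector = {z. norm z \<le> 1} \<inter> {z. norm z \<le> norm (1 - z)}"
    by (auto simp: sector_def)
  moreover have "closed ({z :: complex. norm z \<le> 1} \<inter> {z. norm z \<le> norm (1 - z)})"
    by (intro closed_Int closed_Collect_le continuous_intros)
  ultimately show ?thesis by simp
qed

lemma pl_inverse_PLeg:
  assumes "z \<in> sector"
  shows "pl_inverse (zco (profile_point z), wco (profile_point z)) = z"
  using zw_profile_point[OF sector_nonzero[OF assms]] pl_inverse_profile[OF assms] by simp

lemma closed_PLeg: "closed PLeg"
proof -
  define C where "C = {a :: MR \<times> torus. norm (wco a) = 1}"
  have C: "closed C"
    unfolding C_def by (intro closed_Collect_eq continuous_intros continuous_on_wco)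
  define p where "p a = pl_inverse (zco a, wco a)" for a
  have p: "continuous_on C p"
    unfolding p_def
    by (rule continuous_on_compose2[OF continuous_on_pl_inverse
          continuous_on_Pair[OF continuous_on_zco continuous_on_wco]]) (auto simp: C_def)
  have p0: "p a \<noteq> 0" for a
    by (simp add: p_def pl_inverse_def sgn_zero_iff)
  define D where "D = C \<inter> p -` insert 0 sector"
  have D: "closed D"
    unfolding D_def by (rule continuous_closed_preimage[OF p C closed_insert_sector])
  have pD: "p ` D \<subseteq> sector" using p0 by (auto simp: D_def)
  have "continuous_on D (\<lambda>a. profile_point (p a))"
    by (rule continuous_on_compose2[OF continuous_on_profile_point continuous_on_subset[OF p] pD])
      (simp add: D_def)
  then have "continuous_on D (\<lambda>a. (profile_point (p a), a))"
    by (intro continuous_on_Pair continuous_on_id)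
  moreover have "closed {(x, y). x = (y :: MR \<times> torus)}"
  proof -
    have "closed {q :: (MR \<times> torus) \<times> (MR \<times> torus). fst q = snd q}"
      by (intro closed_Collect_eq continuous_intros)
    then show ?thesis by (simp add: case_prod_unfold)
  qed
  ultimately have "closed (D \<inter> (\<lambda>a. (profile_point (p a), a)) -` {(x, y). x = y})"
    using D by (intro continuous_closed_preimage)
  moreover have "PLeg = D \<inter> (\<lambda>a. (profile_point (p a), a)) -` {(x, y). x = y}"
  proof (intro equalityI subsetI)
    fix a assume "a \<in> PLeg"
    then obtain z where z: "z \<in> sector" "a = profile_point z" by (auto simp: PLeg_def)
    have "p a = z" using pl_inverse_PLeg[OF z(1)] z(2) by (simp add: p_def)
    moreover have "a \<in> C" unfolding C_def z(2)
      using zw_profile_point(2)[OF sector_nonzero[OF z(1)]] norm_snd_profile by simp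
    ultimately show "a \<in> D \<inter> (\<lambda>a. (profile_point (p a), a)) -` {(x, y). x = y}"
      using z by (simp add: D_def)
  next
    fix a assume "a \<in> D \<inter> (\<lambda>a. (profile_point (p a), a)) -` {(x, y). x = y}"
    then have "p a \<in> sector" "a = profile_point (p a)" using pD by auto
    then show "a \<in> PLeg" unfolding PLeg_def by (metis imageI)
  qed
  ultimately show ?thesis by simp
qed

context model
begin

definition leg_point :: "complex \<Rightarrow> MR \<times> torus" where
  "leg_point z = of_zw z (F z)"

definition Leg :: "(MR \<times> torus) set" where
  "Leg = leg_point ` sector"

lemma zw_leg_point:
  "z \<in> sector \<Longrightarrow> zco (leg_point z) = z" "z \<in> sector \<Longrightarrow> wco (leg_point z) = F z"
  using F_sector_nonzero sector_nonzero by (simp_all add: leg_point_def)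

lemma Leg_iff: "a \<in> Leg \<longleftrightarrow> zco a \<in> sector \<and> wco a = F (zco a)"
proof
  assume "zco a \<in> sector \<and> wco a = F (zco a)"
  then have "zco a \<in> sector" "a = leg_point (zco a)"
    using of_zw_zco_wco[of a] by (simp_all add: leg_point_def)
  then show "a \<in> Leg" unfolding Leg_def by (metis imageI)
qed (use zw_leg_point in \<open>auto simp: Leg_def\<close>)

lemma Leg_leg: "a \<in> Leg \<longleftrightarrow> (zco a, wco a) \<in> leg"
  by (auto simp: Leg_iff leg_def)

lemma surface_eq: "surface = sweep_map Leg"
proof -
  have 1: "(zco a, wco a) \<in> rot ` leg \<longleftrightarrow> a \<in> rot_map ` Leg" for a
  proof
    assume "(zco a, wco a) \<in> rot ` leg"
    then obtain z w where zw: "(z, w) \<in> leg" "rot (z, w) = (zco a, wco a)" by auto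
    define b where "b = of_zw z w"
    have b: "(zco b, wco b) = (z, w)" using leg_nonzero[OF zw(1)] by (simp add: b_def)
    have "rot_map b = a" using zw_rot_map[of b] b zw(2) by (intro zw_eqI) simp_all
    then show "a \<in> rot_map ` Leg" using zw(1) b Leg_leg[of b] by (metis imageI)
  next
    assume "a \<in> rot_map ` Leg"
    then show "(zco a, wco a) \<in> rot ` leg" using Leg_leg zw_rot_map by fastforce
  qed
  have 2: "(zco a, wco a) \<in> rot ` rot ` leg \<longleftrightarrow> a \<in> rot_map ` rot_map ` Leg" for a
  proof
    assume "(zco a, wco a) \<in> rot ` rot ` leg"
    then obtain z w where zw: "(z, w) \<in> leg" "rot (rot (z, w)) = (zco a, wco a)" by auto
    define b where "b = of_zw z w"
    have b: "(zco b, wco b) = (z, w)" using leg_nonzero[OF zw(1)] by (simp add: b_def)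
    have "rot_map (rot_map b) = a"
      using zw_rot_map[of b] zw_rot_map[of "rot_map b"] b zw(2) by (intro zw_eqI) simp_all
    then show "a \<in> rot_map ` rot_map ` Leg" using zw(1) b Leg_leg[of b] by (metis imageI)
  next
    assume "a \<in> rot_map ` rot_map ` Leg"
    then obtain b where "b \<in> Leg" "a = rot_map (rot_map b)" by auto
    then show "(zco a, wco a) \<in> rot ` rot ` leg"
      using Leg_leg[of b] zw_rot_map[of b] zw_rot_map[of "rot_map b"] by (metis imageI)
  qed
  show ?thesis
    unfolding surface_def sweep_def sweep_map_def using 1 2 Leg_leg by auto
qed

lemma continuous_on_F_zco: "continuous_on S (\<lambda>a. F (zco a))"
  by (rule continuous_on_compose2[OF continuous_on_F continuous_on_zco]) auto

lemma closed_Leg: "closed Leg"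
proof -
  have "Leg = zco -` insert 0 sector \<inter> {a. wco a = F (zco a)}"
    by (auto simp: Leg_iff)
  moreover have "closed (zco -` insert 0 sector)"
    by (rule closed_vimage[OF closed_insert_sector continuous_on_zco])
  moreover have "closed {a. wco a = F (zco a)}"
    by (intro closed_Collect_eq continuous_on_wco continuous_on_F_zco)
  ultimately show ?thesis by auto
qed

lemma leg_point_rot_imp_edge:
  assumes "z \<in> sector" "y \<in> sector" "leg_point z = rot_map (leg_point y)"
  shows "norm y = norm (1 - y)" "norm z = 1" "z = - (1 - y) / y"
proof -
  have y0: "norm y > 0" using sector_nonzero[OF assms(2)] by simp
  have "(z, F z) = rot (y, F y)"
    using arg_cong[OF assms(3), of zco] arg_cong[OF assms(3), of wco] zw_rot_map[of "leg_point y"]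
      zw_leg_point[OF assms(1)] zw_leg_point[OF assms(2)] by simp
  then have z: "z = - F y / y" by (simp add: rot_def)
  have z1: "norm z \<le> 1" using assms(1) by (simp add: sector_def)
  then have Fy: "norm (F y) \<le> norm y" unfolding z using y0 by (simp add: norm_divide)
  have "norm y \<ge> exp (- R)"
    using norm_F_end(1)[of y] Fy y0 exp_R by fastforce
  then have F: "F y = 1 - y" by (rule F_core)
  then show y: "norm y = norm (1 - y)" using Fy assms(2) by (simp add: sector_def)
  show "z = - (1 - y) / y" using z F by simp
  then show "norm z = 1" using y y0 by (simp add: norm_divide norm_minus_commute)
qed

lemma edge_rot:
  assumes "z \<in> sector" "y \<in> sector" "norm y = norm (1 - y)" "norm z = 1" "z = - (1 - y) / y"
  shows "leg_point z = rot_map (leg_point y)" "profile_point z = rot_map (profile_point y)"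
proof -
  have y0: "y \<noteq> 0" and z0: "z \<noteq> 0" using sector_nonzero assms by auto
  have z1: "1 - z = 1 / y" using assms(5) y0 by (simp add: field_simps)
  have "1 \<le> norm y + norm (1 - y)" using norm_ge_1_sum[of y] by linarith
  then have "norm y \<ge> exp (- R)" using assms(3) exp_R by linarith
  then have Fy: "F y = 1 - y" by (rule F_core)
  have Fz: "F z = 1 - z" using assms(4) exp_R by (intro F_core) linarith
  have "(z, F z) = rot (y, F y)" using Fy Fz z1 assms(5) by (simp add: rot_def)
  then have "(zco (rot_map (leg_point y)), wco (rot_map (leg_point y))) = (z, F z)"
    using zw_rot_map[of "leg_point y"] zw_leg_point[OF assms(2)] by simp
  then show "leg_point z = rot_map (leg_point y)"
    using zw_leg_point[OF assms(1)] by (intro zw_eqI) simp_all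
  have "pl_profile z = rot (pl_profile y)"
    using profile_edge(1)[OF assms(1) disjI1[OF assms(4)]] profile_edge(1)[OF assms(2) disjI2[OF assms(3)]]
      z1 assms(5) assms(3,4) y0
    by (simp add: rot_def sgn_eq norm_divide)
  then show "profile_point z = rot_map (profile_point y)"
    using profile_point_eq_iff[OF z0 y0] by simp
qed

text \<open>The third of the surface and the third of the PL model are graphs over \<open>sector\<close>, and the profile
  map matches them. It extends equivariantly in both directions, since on either side two thirds meet
  in the same edge points. The profile map is the identity far out on the end, and there the surface
  is already a cylinder; \<open>r\<close> is a radius beyond which both happen.\<close>

lemma surface_homeomorphism:
  obtains h k r where "homeomorphism surface (sweep_map PLeg) h k"
    "r > 0" "\<And>a. a \<in> surface \<Longrightarrow> norm (fst a) \<ge> r \<Longrightarrow> h a = a"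
    "\<And>a. a \<in> sweep_map PLeg \<Longrightarrow> norm (fst a) \<ge> r \<Longrightarrow> a \<in> surface \<and> h a = a"
    "\<And>z. z \<in> sector \<Longrightarrow> norm z \<ge> exp (- R - 1) \<Longrightarrow> norm (fst (leg_point z)) < r \<and>
       norm (fst (rot_map (leg_point z))) < r \<and> norm (fst (rot_map (rot_map (leg_point z)))) < r"
proof -
  define f where "f a = profile_point (zco a)" for a
  define g where "g b = leg_point (pl_inverse (zco b, wco b))" for b
  have f: "f (leg_point z) = profile_point z" if "z \<in> sector" for z
    using zw_leg_point(1)[OF that] by (simp add: f_def)
  have g: "g (profile_point z) = leg_point z" if "z \<in> sector" for z
    using pl_inverse_PLeg[OF that] by (simp add: g_def)
  have cf: "continuous_on Leg f"
    unfolding f_def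
    by (rule continuous_on_compose2[OF continuous_on_profile_point continuous_on_zco]) (auto simp: Leg_iff)
  have cleg: "continuous_on sector leg_point"
    unfolding leg_point_def using sector_nonzero F_sector_nonzero
    by (intro continuous_on_of_zw_compose continuous_on_id continuous_on_subset[OF continuous_on_F]) auto
  have cg: "continuous_on PLeg g"
  proof -
    have "continuous_on PLeg (\<lambda>b. pl_inverse (zco b, wco b))"
    proof (rule continuous_on_compose2[OF continuous_on_pl_inverse
          continuous_on_Pair[OF continuous_on_zco continuous_on_wco]], safe)
      fix a b x assume "x \<in> PLeg"
      then obtain z where "z \<in> sector" "x = profile_point z" by (auto simp: PLeg_def)
      then show "norm (snd (zco x, wco x)) = 1"
        using zw_profile_point[OF sector_nonzero] norm_snd_profile by simp
    qed simp
    then show ?thesis unfolding g_def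
      by (rule continuous_on_compose2[OF cleg]) (auto simp: PLeg_def pl_inverse_PLeg)
  qed
  obtain h where h: "continuous_on (sweep_map Leg) h" "\<And>a. a \<in> Leg \<Longrightarrow> h a = f a"
    "\<And>a. a \<in> Leg \<Longrightarrow> h (rot_map a) = rot_map (f a)"
    "\<And>a. a \<in> Leg \<Longrightarrow> h (rot_map (rot_map a)) = rot_map (rot_map (f a))"
  proof (rule equivariant_extension[OF closed_Leg cf continuous_on_rot_map rot_map_rot_map_rot_map])
    fix a b assume "a \<in> Leg" "b \<in> Leg" "a = rot_map b"
    then obtain z y where zy: "z \<in> sector" "y \<in> sector" "a = leg_point z" "b = leg_point y"
      by (auto simp: Leg_def)
    then have "leg_point z = rot_map (leg_point y)" using \<open>a = rot_map b\<close> by simp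
    from edge_rot(2)[OF zy(1,2) leg_point_rot_imp_edge[OF zy(1,2) this]]
    show "f a = rot_map (f b)" using zy f by simp
  qed (rule that, unfold sweep_map_def)
  obtain k where k: "continuous_on (sweep_map PLeg) k" "\<And>a. a \<in> PLeg \<Longrightarrow> k a = g a"
    "\<And>a. a \<in> PLeg \<Longrightarrow> k (rot_map a) = rot_map (g a)"
    "\<And>a. a \<in> PLeg \<Longrightarrow> k (rot_map (rot_map a)) = rot_map (rot_map (g a))"
  proof (rule equivariant_extension[OF closed_PLeg cg continuous_on_rot_map rot_map_rot_map_rot_map])
    fix a b assume "a \<in> PLeg" "b \<in> PLeg" "a = rot_map b"
    then obtain z y where zy: "z \<in> sector" "y \<in> sector" "a = profile_point z" "b = profile_point y"
      by (auto simp: PLeg_def)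
    then have "pl_profile z = rot (pl_profile y)"
      using \<open>a = rot_map b\<close> profile_point_eq_iff sector_nonzero by metis
    from edge_rot(1)[OF zy(1,2) profile_rot_imp_edge[OF zy(1,2) this]]
    show "g a = rot_map (g b)" using zy g by simp
  qed (rule that, unfold sweep_map_def)
  have fg: "f a \<in> PLeg" "g (f a) = a" if "a \<in> Leg" for a
    using that f g by (auto simp: Leg_def PLeg_def)
  have gf: "g a \<in> Leg" "f (g a) = a" if "a \<in> PLeg" for a
    using that f g by (auto simp: Leg_def PLeg_def)
  have hom: "homeomorphism (sweep_map Leg) (sweep_map PLeg) h k"
  proof (rule homeomorphismI[OF h(1) k(1)])
    show "h ` sweep_map Leg \<subseteq> sweep_map PLeg"
    proof (rule image_subsetI)
      fix a assume "a \<in> sweep_map Leg"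
      then show "h a \<in> sweep_map PLeg"
        by (cases rule: sweep_mapE) (simp_all add: h fg sweep_mapI)
    qed
    show "k ` sweep_map PLeg \<subseteq> sweep_map Leg"
    proof (rule image_subsetI)
      fix a assume "a \<in> sweep_map PLeg"
      then show "k a \<in> sweep_map Leg"
        by (cases rule: sweep_mapE) (simp_all add: k gf sweep_mapI)
    qed
    show "k (h a) = a" if "a \<in> sweep_map Leg" for a
      using that by (cases rule: sweep_mapE) (simp_all add: h k fg)
    show "h (k a) = a" if "a \<in> sweep_map PLeg" for a
      using that by (cases rule: sweep_mapE) (simp_all add: h k gf)
  qed
  define Z where "Z = insert 0 sector \<inter> {z. exp (- R - 1) \<le> norm z}"
  have Zs: "Z \<subseteq> sector" by (auto simp: Z_def)
  have "closed {z :: complex. exp (- R - 1) \<le> norm z}"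
    by (intro closed_Collect_le continuous_intros)
  then have "closed Z" unfolding Z_def using closed_insert_sector by (intro closed_Int)
  moreover have "bounded Z"
    by (rule bounded_subset[OF bounded_cball[of 0 1]]) (auto simp: Z_def sector_def)
  ultimately have "compact Z" by (simp add: compact_eq_bounded_closed)
  define K where "K = leg_point ` Z"
  have cK: "compact K" unfolding K_def
    by (rule compact_continuous_image[OF continuous_on_subset[OF cleg Zs] \<open>compact Z\<close>])
  have K: "K \<subseteq> Leg" using Zs by (auto simp: K_def Leg_def)
  define KK where "KK = sweep_map K"
  have "compact (rot_map ` K)"
    by (rule compact_continuous_image[OF continuous_on_rot_map cK])
  moreover from this have "compact (rot_map ` rot_map ` K)"
    by (rule compact_continuous_image[OF continuous_on_rot_map])
  ultimately have cKK: "compact KK" unfolding KK_def sweep_map_def using cK by (intro compact_Un)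
  have KKs: "KK \<subseteq> sweep_map Leg" using K unfolding KK_def sweep_map_def by blast
  have "compact (h ` KK)" by (rule compact_continuous_image[OF continuous_on_subset[OF h(1) KKs] cKK])
  with cKK have "compact (KK \<union> h ` KK)" by (rule compact_Un)
  from compact_continuous_image[OF continuous_on_fst[OF continuous_on_id] this]
  have "compact (fst ` (KK \<union> h ` KK))" .
  then obtain r0 where r0: "r0 > 0" "\<And>x. x \<in> fst ` (KK \<union> h ` KK) \<Longrightarrow> norm x \<le> r0"
    using compact_imp_bounded bounded_pos by metis
  define r where "r = r0 + 1"
  have far: "f a = a" if "a \<in> Leg" "a \<notin> K" for a
  proof -
    obtain z where z: "z \<in> sector" "a = leg_point z" using \<open>a \<in> Leg\<close> by (auto simp: Leg_def)
    then have n: "norm z < exp (- R - 1)" using \<open>a \<notin> K\<close> by (auto simp: K_def Z_def)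
    have "exp (- R - 1) \<le> exp (- 1)" using R by simp
    with n have "norm z \<le> exp (- 1)" by linarith
    then have "pl_profile z = (z, 1)" using sector_nonzero[OF z(1)] by (intro profile_end)
    moreover have "F z = 1" using n sector_nonzero[OF z(1)] by (intro F_end) auto
    ultimately have "profile_point z = leg_point z" by (simp add: profile_point_def leg_point_def)
    then show ?thesis using f[OF z(1)] z(2) by simp
  qed
  have hfar: "h a = a" if a: "a \<in> sweep_map Leg" "a \<notin> KK" for a
  proof -
    have K: "b \<notin> K" if "a = b \<or> a = rot_map b \<or> a = rot_map (rot_map b)" for b
      using that a(2) sweep_mapI[of b K] unfolding KK_def by metis
    from a(1) show ?thesis
      by (cases rule: sweep_mapE) (use K in \<open>simp_all add: h far\<close>)
  qed
  show thesis
  proof (rule that[of h k r])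
    show "homeomorphism surface (sweep_map PLeg) h k" using hom by (simp add: surface_eq)
    show "r > 0" using r0 by (simp add: r_def)
    show "h a = a" if "a \<in> surface" "norm (fst a) \<ge> r" for a
      using that r0(2)[of "fst a"] hfar[of a] unfolding surface_eq r_def by fastforce
    show "a \<in> surface \<and> h a = a" if a: "a \<in> sweep_map PLeg" "norm (fst a) \<ge> r" for a
    proof -
      have ka: "k a \<in> sweep_map Leg" "h (k a) = a"
        using hom a unfolding homeomorphism_def by blast+
      have "k a \<notin> KK"
      proof
        assume "k a \<in> KK"
        then have "a \<in> h ` KK" using ka by (metis imageI)
        then show False using r0(2)[of "fst a"] a by (auto simp: r_def)
      qed
      then have "h (k a) = k a" using hfar ka by blast
      then show ?thesis using ka by (simp add: surface_eq)
    qed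
    show "norm (fst (leg_point z)) < r \<and>
       norm (fst (rot_map (leg_point z))) < r \<and> norm (fst (rot_map (rot_map (leg_point z)))) < r"
      if "z \<in> sector" "norm z \<ge> exp (- R - 1)" for z
    proof -
      have K: "leg_point z \<in> K" using that by (auto simp: K_def Z_def)
      have *: "norm (fst x) < r" if "x \<in> KK" for x
        using r0(2)[of "fst x"] that by (auto simp: r_def)
      show ?thesis using K by (intro conjI *) (auto simp: KK_def sweep_map_def)
    qed
  qed
qed

end

definition tri :: "NR set" where
  "tri = {n. 0 \<le> n $ 1 \<and> 0 \<le> n $ 2 \<and> n $ 1 + n $ 2 \<le> 1 / 2}"

text \<open>The PL lift of the tropical line with legs \<open>(0, 1)\<close>, \<open>(1, 0)\<close>, \<open>(- 1, - 1)\<close>, whose dual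
  polygon is the standard triangle.\<close>

definition tropical_line :: "(MR \<times> torus) set" where
  "tropical_line =
     {(vector [0, x], to_torus (vector [\<theta>, 0])) | x \<theta>. 0 \<le> x} \<union>
     {(vector [x, 0], to_torus (vector [0, \<theta>])) | x \<theta>. 0 \<le> x} \<union>
     {(vector [- x, - x], to_torus (vector [\<theta>, 1 / 2 - \<theta>])) | x \<theta>. 0 \<le> x} \<union>
     {(0, to_torus n) | n. n \<in> tri \<or> - n \<in> tri}"

text \<open>The symmetry acts on the triangle \<open>tri\<close> in the fibre over the vertex as the rotation \<open>rho\<close>; \<open>third\<close>
  is the cone from the barycenter over one edge.\<close>

definition third :: "NR set" where
  "third = {n. 0 \<le> n $ 2 \<and> n $ 2 \<le> n $ 1 \<and> n $ 1 + 2 * n $ 2 \<le> 1 / 2}"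

definition rho :: "NR \<Rightarrow> NR" where
  "rho n = vector [1 / 2 - n $ 1 - n $ 2, n $ 1]"

lemma vec2_zero: "(vector [0, 0] :: real^2) = 0"
  by (simp add: vec_eq_iff forall_2)


lemma tri_eq: "tri = third \<union> rho ` third \<union> rho ` rho ` third"
proof (intro equalityI subsetI)
  fix n assume n: "n \<in> tri"
  have r3: "rho (rho (rho n)) = n" by (simp add: rho_def vec_eq_iff forall_2)
  have "n \<in> third \<or> rho n \<in> third \<or> rho (rho n) \<in> third"
    using n by (simp add: tri_def third_def rho_def) linarith
  then show "n \<in> third \<union> rho ` third \<union> rho ` rho ` third"
    using r3 by (metis UnCI imageI)
qed (auto simp: tri_def third_def rho_def)

lemma rot_map_vertex:
  "rot_map (0, to_torus n) = (0, to_torus (rho n))"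
  "rot_map (0, to_torus (- n)) = (0, to_torus (- rho n))"
proof -
  have "(vector [1 / 2 + n $ 1 + n $ 2, - (n $ 1)] :: NR) - (- rho n) \<in> lattice_N"
    by (simp add: rho_def lattice_N_iff)
  then show "rot_map (0, to_torus (- n)) = (0, to_torus (- rho n))"
    unfolding rot_map_to_torus by (simp add: vec2_zero to_torus_eq_iff)
qed (simp add: rot_map_to_torus vec2_zero rho_def)

lemma profile_point_eq:
  assumes "z \<in> sector"
  defines "\<epsilon> \<equiv> (if Im z \<le> 0 then - 1 else 1)"
  shows "profile_point z = (vector [0, max (height z) 0],
    to_torus (vector [\<epsilon> * ang z / (2 * pi), \<epsilon> * max (- height z) 0 / (2 * pi)]))"
proof -
  have z: "z \<noteq> 0" by (rule sector_nonzero[OF assms(1)])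
  show ?thesis
  proof (rule zw_eqI)
    show "zco (profile_point z) = zco (vector [0, max (height z) 0],
        to_torus (vector [\<epsilon> * ang z / (2 * pi), \<epsilon> * max (- height z) 0 / (2 * pi)]))"
      unfolding zw_profile_point[OF z] zco_to_torus
      by (simp add: pl_profile_def sgn_polar[OF z] \<epsilon>_def)
    show "wco (profile_point z) = wco (vector [0, max (height z) 0],
        to_torus (vector [\<epsilon> * ang z / (2 * pi), \<epsilon> * max (- height z) 0 / (2 * pi)]))"
      unfolding zw_profile_point[OF z] wco_to_torus
      by (simp add: pl_profile_def \<epsilon>_def)
  qed
qed

lemma PLeg_eq:
  "PLeg = {(vector [0, x], to_torus (vector [\<theta>, 0])) | x \<theta>. 0 \<le> x} \<union>
     {(0, to_torus n) | n. n \<in> third \<or> - n \<in> third}" (is "_ = ?A \<union> ?B")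
proof (intro equalityI subsetI)
  fix a assume "a \<in> PLeg"
  then obtain z where z: "z \<in> sector" "a = profile_point z" by (auto simp: PLeg_def)
  define \<epsilon> :: real where "\<epsilon> = (if Im z \<le> 0 then - 1 else 1)"
  have a: "a = (vector [0, max (height z) 0],
    to_torus (vector [\<epsilon> * ang z / (2 * pi), \<epsilon> * max (- height z) 0 / (2 * pi)]))"
    using profile_point_eq[OF z(1)] z(2) by (simp add: \<epsilon>_def)
  show "a \<in> ?A \<union> ?B"
  proof (cases "height z \<ge> 0")
    case True
    then have "max (height z) 0 = height z" "max (- height z) 0 = 0" by simp_all
    then have "a = (vector [0, height z], to_torus (vector [\<epsilon> * ang z / (2 * pi), 0]))" by (simp add: a)
    then show ?thesis using True by blast
  next
    case False
    define n :: NR where "n = vector [ang z / (2 * pi), - height z / (2 * pi)]"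
    have m: "max (- height z) 0 = - height z" "max (height z) 0 = 0" using False by simp_all
    have b: "- height z \<le> ang z" "2 * - height z \<le> pi - ang z"
      using depth_bounds[OF z(1)] ang_max_bounds[of z] m by linarith+
    have "n $ 1 + 2 * n $ 2 = (ang z + 2 * (- height z)) / (2 * pi)"
      by (simp add: n_def field_simps)
    also have "\<dots> \<le> pi / (2 * pi)" using b by (intro divide_right_mono) auto
    finally have "n $ 1 + 2 * n $ 2 \<le> 1 / 2" by simp
    moreover have "n $ 2 \<le> n $ 1" "0 \<le> n $ 2"
      using divide_right_mono[OF b(1), of "2 * pi"] divide_nonneg_pos[of "- height z" "2 * pi"] False
      by (simp_all add: n_def)
    ultimately have "n \<in> third" by (simp add: third_def)
    moreover have "a = (0, to_torus (\<epsilon> *\<^sub>R n))"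
    proof -
      have "vector [\<epsilon> * ang z / (2 * pi), \<epsilon> * - height z / (2 * pi)] = \<epsilon> *\<^sub>R n"
        by (simp add: n_def vec_eq_iff forall_2)
      then show ?thesis unfolding a m by (simp add: vec2_zero)
    qed
    ultimately show ?thesis by (cases "Im z \<le> 0") (auto simp: \<epsilon>_def)
  qed
next
  fix a assume "a \<in> ?A \<union> ?B"
  then consider x \<theta> where "0 \<le> x" "a = (vector [0, x], to_torus (vector [\<theta>, 0]))"
    | n where "n \<in> third" "a = (0, to_torus n)" | n where "n \<in> third" "a = (0, to_torus (- n))"
    by auto
  then show "a \<in> PLeg"
  proof cases
    case 1
    have "x \<ge> - ang_max (cis (2 * pi * \<theta>))" using 1(1) ang_max_bounds(1)[of "cis (2 * pi * \<theta>)"] by linarith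
    then obtain z where z: "z \<in> sector" "sgn z = sgn (cis (2 * pi * \<theta>))" "height z = x"
      by (rule height_surj[OF cis_neq_zero])
    have "profile_point z = a"
    proof (rule zw_eqI)
      show "zco (profile_point z) = zco a" "wco (profile_point z) = wco a"
        using 1(1) unfolding zw_profile_point[OF sector_nonzero[OF z(1)]] 1(2) zco_to_torus wco_to_torus
        by (simp_all add: pl_profile_def z)
    qed
    then show ?thesis using z by (auto simp: PLeg_def)
  next
    case 2
    have n: "0 \<le> n $ 1" "n $ 1 \<le> 1 / 2" "0 \<le> n $ 2" "n $ 2 \<le> n $ 1" "n $ 1 + 2 * n $ 2 \<le> 1 / 2"
      using 2(1) by (auto simp: third_def)
    have p: "0 \<le> 2 * pi * n $ 1" "2 * pi * n $ 1 \<le> pi" using n by (simp_all add: field_simps)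
    have an: "ang (cis (2 * pi * n $ 1)) = 2 * pi * n $ 1"
      using p by (simp add: ang_def arccos_cos)
    have "2 * pi * n $ 2 \<le> ang_max (cis (2 * pi * n $ 1))"
    proof -
      have "2 * pi * n $ 2 \<le> 2 * pi * n $ 1" using n by simp
      moreover have "pi * (n $ 1 + 2 * n $ 2) \<le> pi * (1 / 2)" using n by (intro mult_left_mono) auto
      ultimately show ?thesis unfolding ang_max_def an by (simp add: algebra_simps)
    qed
    then obtain z where z: "z \<in> sector" "sgn z = sgn (cis (2 * pi * n $ 1))" "height z = - (2 * pi * n $ 2)"
      using height_surj[OF cis_neq_zero, of "2 * pi * n $ 1" "- (2 * pi * n $ 2)"] by auto
    have im: "n $ 2 = 0" if "Im z \<le> 0"
    proof -
      have "ang z = 2 * pi * n $ 1" using direction_cong(1)[OF z(2)] an by simp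
      then have "cis (2 * pi * n $ 1) = cis (- (2 * pi * n $ 1))"
        using sgn_polar[OF sector_nonzero[OF z(1)]] that z(2) by simp
      then have "sin (2 * pi * n $ 1) = 0" by (simp add: complex_eq_iff)
      then have "2 * pi * n $ 1 = 0 \<or> 2 * pi * n $ 1 = pi"
        using p sin_gt_zero[of "2 * pi * n $ 1"] by linarith
      then have "n $ 1 = 0 \<or> n $ 1 = 1 / 2" by auto
      then show ?thesis using n by auto
    qed
    have m: "max (height z) 0 = 0" "max (- height z) 0 = 2 * pi * n $ 2" using z n by auto
    have "profile_point z = a"
    proof (rule zw_eqI)
      show "zco (profile_point z) = zco a" "wco (profile_point z) = wco a"
        unfolding zw_profile_point[OF sector_nonzero[OF z(1)]] 2(2) zco_to_torus wco_to_torus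
          pl_profile_def m using im
        by (simp_all add: z(2))
    qed
    then show ?thesis using z by (auto simp: PLeg_def)
  next
    case 3
    have n: "0 \<le> n $ 1" "n $ 1 \<le> 1 / 2" "0 \<le> n $ 2" "n $ 2 \<le> n $ 1" "n $ 1 + 2 * n $ 2 \<le> 1 / 2"
      using 3(1) by (auto simp: third_def)
    have p: "0 \<le> 2 * pi * n $ 1" "2 * pi * n $ 1 \<le> pi" using n by (simp_all add: field_simps)
    have an: "ang (cis (- (2 * pi * n $ 1))) = 2 * pi * n $ 1"
      using p by (simp add: ang_def arccos_cos)
    have "2 * pi * n $ 2 \<le> ang_max (cis (- (2 * pi * n $ 1)))"
    proof -
      have "2 * pi * n $ 2 \<le> 2 * pi * n $ 1" using n by simp
      moreover have "pi * (n $ 1 + 2 * n $ 2) \<le> pi * (1 / 2)" using n by (intro mult_left_mono) auto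
      ultimately show ?thesis unfolding ang_max_def an by (simp add: algebra_simps)
    qed
    then obtain z where z: "z \<in> sector" "sgn z = sgn (cis (- (2 * pi * n $ 1)))" "height z = - (2 * pi * n $ 2)"
      using height_surj[OF cis_neq_zero, of "- (2 * pi * n $ 1)" "- (2 * pi * n $ 2)"] by auto
    have im: "Im z \<le> 0"
    proof (rule ccontr)
      assume "\<not> Im z \<le> 0"
      then have "Im (sgn z) > 0" using sector_nonzero[OF z(1)] by (simp add: Im_sgn)
      then have "sin (2 * pi * n $ 1) < 0" by (simp add: z(2))
      then show False using sin_ge_zero[OF p] by simp
    qed
    have m: "max (height z) 0 = 0" "max (- height z) 0 = 2 * pi * n $ 2" using z n by auto
    have "profile_point z = a"
    proof (rule zw_eqI)
      show "zco (profile_point z) = zco a" "wco (profile_point z) = wco a"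
        unfolding zw_profile_point[OF sector_nonzero[OF z(1)]] 3(2) zco_to_torus wco_to_torus
          pl_profile_def m using im
        by (simp_all add: z(2))
    qed
    then show ?thesis using z by (auto simp: PLeg_def)
  qed
qed

lemma rot_map_leg:
  "rot_map (vector [0, x], to_torus (vector [\<theta>, 0])) = (vector [- x, - x], to_torus (vector [1 / 2 - \<theta>, \<theta>]))"
  "rot_map (vector [- x, - x], to_torus (vector [1 / 2 - \<theta>, \<theta>])) = (vector [x, 0], to_torus (vector [0, 1 / 2 - \<theta>]))"
  by (simp_all add: rot_map_to_torus)

lemma tropical_line_eq: "tropical_line = sweep_map PLeg"
proof (intro equalityI subsetI)
  have legI: "(vector [0, x], to_torus (vector [\<theta>, 0])) \<in> PLeg" if "0 \<le> x" for x \<theta>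
    using that unfolding PLeg_eq by blast
  have triI: "(0, to_torus n) \<in> PLeg" "(0, to_torus (- n)) \<in> PLeg" if "n \<in> third" for n
    using that unfolding PLeg_eq by auto
  fix a assume "a \<in> tropical_line"
  then consider x \<theta> where "0 \<le> x" "a = (vector [0, x], to_torus (vector [\<theta>, 0]))"
    | x \<theta> where "0 \<le> x" "a = (vector [x, 0], to_torus (vector [0, \<theta>]))"
    | x \<theta> where "0 \<le> x" "a = (vector [- x, - x], to_torus (vector [\<theta>, 1 / 2 - \<theta>]))"
    | n where "n \<in> tri" "a = (0, to_torus n) \<or> a = (0, to_torus (- n))"
    unfolding tropical_line_def by auto
  then show "a \<in> sweep_map PLeg"
  proof cases
    case 1
    then show ?thesis using sweep_mapI(1)[OF legI] by simp
  next
    case 2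
    then show ?thesis
      using sweep_mapI(3)[OF legI[OF 2(1), of "1 / 2 - \<theta>"]] unfolding rot_map_leg by simp
  next
    case 3
    then show ?thesis
      using sweep_mapI(2)[OF legI[OF 3(1), of "1 / 2 - \<theta>"]] unfolding rot_map_leg by simp
  next
    case 4
    then consider "n \<in> third" | m where "m \<in> third" "n = rho m" | m where "m \<in> third" "n = rho (rho m)"
      unfolding tri_eq by auto
    then show ?thesis
    proof cases
      case 1
      then show ?thesis using 4(2) sweep_mapI(1)[OF triI(1)] sweep_mapI(1)[OF triI(2)] by auto
    next
      case 2
      then show ?thesis
        using 4(2) sweep_mapI(2)[OF triI(1)[OF 2(1)], unfolded rot_map_vertex(1)]
          sweep_mapI(2)[OF triI(2)[OF 2(1)], unfolded rot_map_vertex(2)]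
        by auto
    next
      case 3
      then show ?thesis
        using 4(2) sweep_mapI(3)[OF triI(1)[OF 3(1)], unfolded rot_map_vertex(1)]
          sweep_mapI(3)[OF triI(2)[OF 3(1)], unfolded rot_map_vertex(2)]
        by auto
    qed
  qed
next
  have triI: "(0, to_torus n) \<in> tropical_line \<and> (0, to_torus (- n)) \<in> tropical_line" if "n \<in> tri" for n
    using that unfolding tropical_line_def by auto
  have sub: "third \<subseteq> tri" "rho ` third \<subseteq> tri" "rho ` rho ` third \<subseteq> tri"
    unfolding tri_eq by auto
  fix a assume "a \<in> sweep_map PLeg"
  then obtain b where b: "b \<in> PLeg" "a = b \<or> a = rot_map b \<or> a = rot_map (rot_map b)"
    by (auto elim: sweep_mapE)
  from b(1) consider x \<theta> where "0 \<le> x" "b = (vector [0, x], to_torus (vector [\<theta>, 0]))"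
    | n where "n \<in> third" "b = (0, to_torus n) \<or> b = (0, to_torus (- n))"
    unfolding PLeg_eq by auto
  then show "a \<in> tropical_line"
  proof cases
    case 1
    have "(vector [0, x], to_torus (vector [\<theta>, 0])) \<in> tropical_line"
      "(vector [x, 0], to_torus (vector [0, 1 / 2 - \<theta>])) \<in> tropical_line"
      using 1(1) unfolding tropical_line_def by blast+
    moreover have "(vector [- x, - x], to_torus (vector [1 / 2 - \<theta>, 1 / 2 - (1 / 2 - \<theta>)])) \<in> tropical_line"
      using 1(1) unfolding tropical_line_def by blast
    ultimately show ?thesis
      using b(2) 1(2) by (auto simp: rot_map_leg)
  next
    case 2
    have "n \<in> tri" "rho n \<in> tri" "rho (rho n) \<in> tri" using sub 2(1) by auto
    from triI[OF this(1)] triI[OF this(2)] triI[OF this(3)] show ?thesis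
      using b(2) 2(2) rot_map_vertex[of n] rot_map_vertex[of "rho n"] by auto
  qed
qed

lemma Arg_cong_sgn: "z \<noteq> 0 \<Longrightarrow> z' \<noteq> 0 \<Longrightarrow> sgn z = sgn z' \<Longrightarrow> Arg z = Arg z'"
  using cis_Arg[of z'] Arg_bounded[of z'] by (intro cis_Arg_unique) auto

lemma snd_of_zw_cong:
  assumes "z \<noteq> 0" "z' \<noteq> 0" "w \<noteq> 0" "w' \<noteq> 0" "sgn z = sgn z'" "sgn w = sgn w'"
  shows "snd (of_zw z w) = snd (of_zw z' w')"
  using Arg_cong_sgn[OF assms(1,2,5)] Arg_cong_sgn[OF assms(3,4,6)] by (simp add: of_zw_def)

lemma snd_rot_map_cong: "snd a = snd b \<Longrightarrow> snd (rot_map a) = snd (rot_map b)"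
  by (simp add: rot_map_def aff_map_def)

text \<open>The arguments of \<open>z\<close> and \<open>1 - z\<close> are two angles of the triangle \<open>0\<close>, \<open>1\<close>, \<open>z\<close>.\<close>

lemma line_coamoeba:
  assumes "z \<in> sector"
  defines "n \<equiv> vector [Arg z / (2 * pi), - Arg (1 - z) / (2 * pi)] :: NR"
  shows "n \<in> tri \<or> - n \<in> tri"
proof -
  have z0: "z \<noteq> 0" using sector_nonzero[OF assms(1)] .
  have upper: "(vector [Arg y / (2 * pi), - Arg (1 - y) / (2 * pi)] :: NR) \<in> tri" if y: "Im y > 0" for y
  proof -
    have "y \<noteq> 0" "1 - y \<noteq> 0" using y by auto
    have a: "0 < Arg y" "Arg y < pi" using y Arg_lt_pi[of y] by auto
    have b: "Arg (1 - y) < 0" "- pi < Arg (1 - y)" using y Arg_less_0[of "1 - y"] mpi_less_Arg by auto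
    define s where "s = Arg y - Arg (1 - y)"
    have "cis s = sgn y * cnj (sgn (1 - y))"
      using cis_Arg[OF \<open>y \<noteq> 0\<close>] cis_Arg[OF \<open>1 - y \<noteq> 0\<close>]
      by (simp add: s_def cis_mult[symmetric] cis_cnj[symmetric] diff_conv_add_uminus del: add_uminus_conv_diff)
    also have "\<dots> = of_real (1 / (norm y * norm (1 - y))) * (y * cnj (1 - y))"
      by (simp add: sgn_eq)
    finally have "Im (cis s) = (1 / (norm y * norm (1 - y))) * Im (y * cnj (1 - y))" by simp
    then have "sin s = (1 / (norm y * norm (1 - y))) * Im y" by (simp add: algebra_simps)
    also have "\<dots> > 0" using y \<open>y \<noteq> 0\<close> \<open>1 - y \<noteq> 0\<close> by (intro mult_pos_pos) auto
    finally have "sin s > 0" .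
    moreover have "s < 2 * pi" using a b by (simp add: s_def)
    ultimately have "s \<le> pi" using sin_le_zero[of s] by (cases "s \<le> pi") linarith+
    then have "s / (2 * pi) \<le> pi / (2 * pi)" by (intro divide_right_mono) auto
    moreover have "Arg (1 - y) / (2 * pi) \<le> 0" using b by (intro divide_nonpos_pos) auto
    ultimately show ?thesis using a by (simp add: tri_def s_def diff_divide_distrib)
  qed
  consider "Im z > 0" | "Im z < 0" | "Im z = 0" by linarith
  then show ?thesis
  proof cases
    case 1
    then show ?thesis using upper[of z] by (simp add: n_def)
  next
    case 2
    have "z \<notin> \<real>" "1 - z \<notin> \<real>" using 2 by (auto simp: complex_is_Real_iff)
    then have "Arg (cnj z) = - Arg z" "Arg (1 - cnj z) = - Arg (1 - z)"
      using Arg_cnj[of z] Arg_cnj[of "1 - z"] by auto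
    then have "- n = vector [Arg (cnj z) / (2 * pi), - Arg (1 - cnj z) / (2 * pi)]"
      by (simp add: n_def vec_eq_iff forall_2)
    then show ?thesis using upper[of "cnj z"] 2 by simp
  next
    case 3
    have "Re z \<le> 1 / 2" using sector_Re[OF assms(1)] by simp
    then have "Arg (1 - z) = 0" using 3 by (subst Arg_real) (auto simp: complex_is_Real_iff)
    moreover have "Arg z = 0 \<or> Arg z = pi" using 3 Arg_eq_0_pi[of z] by (simp add: complex_is_Real_iff)
    ultimately show ?thesis by (auto simp: n_def tri_def)
  qed
qed

lemma norm_rho: "norm (rho n - rho n') \<le> 2 * norm (n - n')"
proof -
  define x where "x = n $ 1 - n' $ 1"
  define y where "y = n $ 2 - n' $ 2"
  have "(norm (rho n - rho n'))\<^sup>2 = (x + y)\<^sup>2 + x\<^sup>2"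
    unfolding power2_norm_eq_inner
    by (simp add: inner_vec_def sum_2 rho_def x_def y_def power2_eq_square algebra_simps)
  also have "\<dots> \<le> 4 * (x\<^sup>2 + y\<^sup>2)"
  proof -
    have "(x + y)\<^sup>2 + x\<^sup>2 = 2 * x\<^sup>2 + y\<^sup>2 + 2 * (x * y)"
      by (simp add: power2_eq_square algebra_simps)
    moreover have "2 * (x * y) \<le> x\<^sup>2 + y\<^sup>2" using sum_squares_bound[of x y] by simp
    moreover have "0 \<le> x\<^sup>2" "0 \<le> y\<^sup>2" by simp_all
    ultimately show ?thesis unfolding distrib_left by linarith
  qed
  also have "\<dots> = (2 * norm (n - n'))\<^sup>2"
    unfolding power_mult_distrib power2_norm_eq_inner
    by (simp add: inner_vec_def sum_2 x_def y_def power2_eq_square)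
  finally show ?thesis by (rule power2_le_imp_le) simp
qed

lemma snd_rot_map: "snd (rot_map (m, to_torus n)) = to_torus (rho n)"
  by (simp add: rot_map_to_torus rho_def)

lemma tropical_line_vertex_rot:
  assumes "(0, to_torus n) \<in> tropical_line"
  shows "(0, to_torus (rho n)) \<in> tropical_line"
proof -
  have "rot_map (0, to_torus n) \<in> sweep_map PLeg"
    using assms unfolding tropical_line_eq
    by (cases rule: sweep_mapE) (auto simp: sweep_mapI rot_map_rot_map_rot_map)
  then show ?thesis by (simp add: rot_map_vertex tropical_line_eq)
qed

lemma tropical_line_retract: "(m, t) \<in> tropical_line \<Longrightarrow> (0, t) \<in> tropical_line"
proof -
  assume a: "(m, t) \<in> tropical_line"
  have 0: "(vector [0, 0], to_torus (vector [\<theta>, 0])) \<in> tropical_line"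
    "(vector [0, 0], to_torus (vector [0, \<theta>])) \<in> tropical_line" for \<theta>
    unfolding tropical_line_def by blast+
  have "(vector [- 0, - 0], to_torus (vector [\<theta>, 1 / 2 - \<theta>])) \<in> tropical_line" for \<theta>
    unfolding tropical_line_def by blast
  with 0 show ?thesis
    using a unfolding tropical_line_def[THEN eqset_imp_iff, of "(m, t)"]
    by (cases "m = 0") (use a in \<open>auto simp: vec2_zero\<close>)
qed

context model
begin

text \<open>Outside the bent region the arguments are those of the line. Inside it \<open>F z\<close> is within the
  bending error of \<open>1\<close>, so that the point on the boundary circle of the triangle is close.\<close>

lemma leg_point_near:
  assumes "z \<in> sector"
  obtains m n n' where "leg_point z = (m, to_torus n)" "(0, to_torus n') \<in> tropical_line" "norm (n - n') \<le> \<delta>"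
proof (cases "norm z \<ge> exp (- R)")
  case True
  have z0: "z \<noteq> 0" using sector_nonzero[OF assms] .
  define n :: NR where "n = vector [Arg z / (2 * pi), - Arg (1 - z) / (2 * pi)]"
  have "leg_point z = (fst (leg_point z), to_torus n)"
    by (simp add: leg_point_def of_zw_def F_core[OF True] n_def)
  moreover have "(0, to_torus n) \<in> tropical_line"
    using line_coamoeba[OF assms] unfolding tropical_line_def n_def by blast
  ultimately show ?thesis using that[of _ n n] \<delta> by simp
next
  case False
  have z0: "z \<noteq> 0" using sector_nonzero[OF assms] .
  define n :: NR where "n = vector [Arg z / (2 * pi), Im (bend z) / (2 * pi)]"
  define n' :: NR where "n' = vector [Arg z / (2 * pi), 0]"
  have b: "norm (bend z) \<le> \<delta>" using norm_bend[OF z0] False by simp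
  then have "\<bar>Im (bend z)\<bar> \<le> \<delta>" using abs_Im_le_cmod[of "bend z"] by linarith
  moreover have "F z = exp (- bend z)" using False by (simp add: F_def)
  moreover have "\<bar>Im (- bend z)\<bar> < pi"
    using \<open>\<bar>Im (bend z)\<bar> \<le> \<delta>\<close> \<delta> pi_gt3 by simp
  then have "Arg (exp (- bend z)) = Im (- bend z)"
    by (intro Arg_exp) linarith+
  ultimately have "leg_point z = (fst (leg_point z), to_torus n)"
    by (simp add: leg_point_def of_zw_def n_def)
  moreover have "(0, to_torus n') \<in> tropical_line"
  proof -
    have "(vector [0, 0], to_torus n') \<in> tropical_line"
      unfolding tropical_line_def n'_def by blast
    then show ?thesis by (simp add: vec2_zero)
  qed
  moreover have "norm (n - n') \<le> \<delta>"
  proof -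
    have "n - n' = (Im (bend z) / (2 * pi)) *\<^sub>R axis 2 1"
      by (simp add: n_def n'_def vec_eq_iff forall_2 axis_def)
    then have "norm (n - n') = \<bar>Im (bend z)\<bar> / (2 * pi)" by simp
    also have "\<dots> \<le> \<bar>Im (bend z)\<bar> / 1" using pi_gt3 by (intro divide_left_mono) auto
    finally show ?thesis using \<open>\<bar>Im (bend z)\<bar> \<le> \<delta>\<close> by simp
  qed
  ultimately show ?thesis using that by blast
qed

lemma surface_near:
  assumes "a \<in> surface"
  obtains t where "(0, t) \<in> tropical_line" "dist (snd a) t \<le> 4 * \<delta>"
proof -
  obtain b where b: "b \<in> Leg" "a = b \<or> a = rot_map b \<or> a = rot_map (rot_map b)"
    using assms unfolding surface_eq by (auto elim: sweep_mapE)
  then obtain z where "z \<in> sector" "b = leg_point z" by (auto simp: Leg_def)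
  then obtain m n n' where mn: "b = (m, to_torus n)" "(0, to_torus n') \<in> tropical_line" "norm (n - n') \<le> \<delta>"
    using leg_point_near by metis
  have "norm (rho n - rho n') \<le> 2 * \<delta>" using norm_rho[of n n'] mn(3) by linarith
  moreover have "norm (rho (rho n) - rho (rho n')) \<le> 2 * (2 * \<delta>)"
    using norm_rho[of "rho n" "rho n'"] calculation by linarith
  moreover note d = dist_to_torus_le[unfolded dist_norm]
  have "snd (rot_map b) = to_torus (rho n)" "snd (rot_map (rot_map b)) = to_torus (rho (rho n))"
    unfolding mn(1) snd_rot_map by (simp_all add: rot_map_to_torus rho_def)
  moreover note t = tropical_line_vertex_rot[OF mn(2)] tropical_line_vertex_rot[OF tropical_line_vertex_rot[OF mn(2)]]
  ultimately show ?thesis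
    using b(2) mn \<delta> d[of n n'] d[of "rho n" "rho n'"] d[of "rho (rho n)" "rho (rho n')"]
      that[of "to_torus n'"] that[of "to_torus (rho n')"] that[of "to_torus (rho (rho n'))"]
    by (auto simp: dist_norm)
qed

lemma F_not_nonpos:
  assumes "Im z \<noteq> 0"
  shows "F z \<notin> \<real>\<^sub>\<le>\<^sub>0"
proof (cases "norm z \<ge> exp (- R)")
  case True
  then show ?thesis using assms by (auto simp: F_core complex_nonpos_Reals_iff)
next
  case False
  have "z \<noteq> 0" using assms by auto
  then have "norm (bend z) \<le> \<delta>" using norm_bend False by simp
  then have "\<bar>Im (bend z)\<bar> \<le> 1 / 4" using \<delta> abs_Im_le_cmod[of "bend z"] by linarith
  then have "cos (Im (bend z)) > 0" using pi_gt3 by (intro cos_gt_zero_pi) linarith+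
  then have "Re (F z) > 0" using False by (simp add: F_def Re_exp)
  then show ?thesis by (auto simp: complex_nonpos_Reals_iff)
qed

text \<open>Along a ray of \<open>sector\<close> the argument of \<open>F\<close> moves continuously from its extremal value on the
  edge to \<open>0\<close>, so every point of the fibre of the tropical line over its vertex is attained.\<close>

lemma fibre_attained:
  assumes z: "z \<in> sector" and h: "height z \<le> 0"
  obtains y where "y \<in> sector" "norm y \<ge> exp (- R - 1)" "snd (leg_point y) = snd (profile_point z)"
proof -
  note result = that
  have z0: "z \<noteq> 0" using sector_nonzero[OF z] .
  define y where "y x = of_real (exp (- x)) * sgn z" for x :: real
  have y0: "y x \<noteq> 0" "sgn (y x) = sgn z" "norm (y x) = exp (- x)" for x
    using z0 by (simp_all add: y_def sgn_scale norm_mult norm_sgn sgn_zero_iff)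
  have ysec: "y x \<in> sector" if "log_min z \<le> x" for x
    using sector_iff[OF y0(1)] direction_cong(3)[OF y0(2)] that by (simp add: y0(3))
  have Fend: "F (y (R + 1)) = 1"
    using y0 by (intro F_end) simp_all
  have le: "log_min z \<le> R + 1" using log_min_bounds[of z] R by linarith
  define m where "m = max (- height z) 0"
  have m: "0 \<le> m" "m \<le> ang_max z" using depth_bounds[OF z] by (simp_all add: m_def)
  have goal: thesis if x: "log_min z \<le> x" "x \<le> R + 1" "sgn (F (y x)) = snd (pl_profile z)" for x
  proof (rule result[of "y x"])
    show "y x \<in> sector" using ysec x by blast
    show "exp (- R - 1) \<le> norm (y x)" using x by (simp add: y0(3))
    show "snd (leg_point (y x)) = snd (profile_point z)"
      unfolding leg_point_def profile_point_def
    proof (rule snd_of_zw_cong)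
      show "sgn (y x) = sgn (fst (pl_profile z))" using y0 sgn_fst_profile by simp
      show "sgn (F (y x)) = sgn (snd (pl_profile z))"
        using x(3) norm_snd_profile[of z] by (simp add: sgn_div_norm)
    qed (use y0 profile_nonzero[OF z0] F_sector_nonzero[OF ysec[OF x(1)]] in auto)
  qed
  have pz: "snd (pl_profile z) = (if Im z \<le> 0 then cis m else cis (- m))"
    by (simp add: pl_profile_def m_def)
  show thesis
  proof (cases "Im z = 0")
    case True
    then have "Im (sgn z) = 0" by (simp add: Im_sgn)
    then have "sin (ang z) = 0" using sgn_polar[OF z0] by (auto split: if_splits)
    then have "ang z = 0 \<or> ang z = pi"
      using ang_bounds[of z] sin_gt_zero[of "ang z"] by linarith
    then have "ang_max z = 0" by (auto simp: ang_max_def)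
    then have "snd (pl_profile z) = 1" using m pz by simp
    then show thesis using goal[OF le] Fend by simp
  next
    case False
    define \<epsilon> :: real where "\<epsilon> = (if Im z \<le> 0 then - 1 else 1)"
    have Imy: "Im (y x) \<noteq> 0" for x using False z0 by (simp add: y_def Im_sgn)
    define \<phi> where "\<phi> x = - \<epsilon> * Arg (F (y x))" for x
    have cont: "continuous_on {log_min z..R + 1} \<phi>"
    proof -
      have "continuous_on {log_min z..R + 1} y" unfolding y_def by (intro continuous_intros)
      then have "continuous_on {log_min z..R + 1} (\<lambda>x. F (y x))"
        by (rule continuous_on_compose2[OF continuous_on_F]) (use y0 in auto)
      then show ?thesis
        unfolding \<phi>_def using F_not_nonpos[OF Imy] by (intro continuous_intros)
    qed
    define e where "e = y (log_min z)"
    have e: "e \<in> sector" "- ln (norm e) = log_min e"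
      using ysec direction_cong(3)[OF y0(2)] by (simp_all add: e_def y0(3))
    have e0: "norm e > 0" using sector_nonzero[OF e(1)] by simp
    have edge: "norm e = 1 \<or> norm e = norm (1 - e)"
    proof (cases "2 * Re (sgn e) \<le> 1")
      case True
      then show ?thesis using e e0 by (simp add: log_min_def)
    next
      case False
      then have "ln (1 / norm e) = ln (2 * Re (sgn e))" using e e0 by (simp add: log_min_def ln_div max_def)
      then have "1 / norm e = 2 * Re (sgn e)" using e0 False by (subst (asm) ln_inj_iff) auto
      then show ?thesis using e0 by (simp add: sector_Re_eq Re_sgn)
    qed
    have ne: "norm e \<ge> exp (- R)"
      using edge norm_ge_1_sum[of e] exp_R by linarith
    have hm: "max (- height e) 0 = ang_max e" using profile_edge(2)[OF e(1) edge] ang_max_bounds(1)[of e] by simp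
    have "sgn (1 - e) = (if Im e \<le> 0 then cis (ang_max e) else cis (- ang_max e))"
      using arg_cong[OF profile_edge(1)[OF e(1) edge], of snd] unfolding pl_profile_def snd_conv hm by simp
    moreover have "ang_max e = ang_max z" using direction_cong(2)[OF y0(2)] by (simp add: e_def)
    moreover have "Im e \<le> 0 \<longleftrightarrow> Im z \<le> 0"
      using z0 by (simp add: e_def y_def Im_sgn mult_le_0_iff divide_le_0_iff)
    ultimately have "sgn (F e) = cis (- \<epsilon> * ang_max z)" by (simp add: F_core[OF ne] \<epsilon>_def)
    moreover have "0 \<le> ang_max z" "ang_max z < pi"
      using ang_max_bounds[of z] pi_gt_zero by linarith+
    then have "- pi < - \<epsilon> * ang_max z" "- \<epsilon> * ang_max z \<le> pi" by (auto simp: \<epsilon>_def)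
    ultimately have "Arg (F e) = - \<epsilon> * ang_max z" by (intro cis_Arg_unique)
    then have "\<phi> (log_min z) = ang_max z" by (simp add: \<phi>_def e_def[symmetric] \<epsilon>_def)
    moreover have "\<phi> (R + 1) = 0" using Arg_of_real[of 1] by (simp add: \<phi>_def Fend)
    ultimately obtain x where x: "log_min z \<le> x" "x \<le> R + 1" "\<phi> x = m"
      using IVT2'[of \<phi> "R + 1" m "log_min z", OF _ _ le cont] m by auto
    have "Arg (F (y x)) = - \<epsilon> * m" using x(3) by (auto simp: \<phi>_def \<epsilon>_def split: if_splits)
    then have "sgn (F (y x)) = cis (- \<epsilon> * m)"
      using cis_Arg[of "F (y x)"] F_sector_nonzero[OF ysec[OF x(1)]] by simp
    then show thesis using goal[OF x(1,2)] pz by (simp add: \<epsilon>_def)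
  qed
qed

end

text \<open>A higher precision \<open>\<epsilon>\<close> is bought by bending farther out, that is, by a larger \<open>r\<close>. This is no
  loss: dilations of \<open>M\<^sub>\<real>\<close> preserve Lagrangians and cones, and so the radius can be scaled down
  afterwards. The symplectic form leaves no such freedom in the torus direction, where the precision
  has to come from the model.\<close>

theorem smoothing_of_tropical_line:
  assumes "\<epsilon> > 0"
  obtains S h k r where "lagrangian_submanifold S" "homeomorphism S tropical_line h k" "r > 0"
    "\<And>a. a \<in> S \<Longrightarrow> norm (fst a) \<ge> r \<Longrightarrow> h a = a"
    "\<And>a. a \<in> tropical_line \<Longrightarrow> norm (fst a) \<ge> r \<Longrightarrow> a \<in> S \<and> h a = a"
    "\<And>a. a \<in> S \<Longrightarrow> \<exists>t. (0, t) \<in> tropical_line \<and> dist (snd a) t < \<epsilon>"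
    "\<And>t. (0, t) \<in> tropical_line \<Longrightarrow> \<exists>m. (m, t) \<in> S \<and> norm m < r"
proof -
  define \<delta> where "\<delta> = min (1 / 4) (\<epsilon> / 8)"
  have small: "0 < \<delta>" "\<delta> \<le> 1 / 4" "4 * \<delta> < \<epsilon>" using assms by (auto simp: \<delta>_def min_def)
  obtain cut cut1 Gam R where "model cut cut1 Gam R \<delta>"
    by (rule model_exists[OF small(1,2)])
  note prec = small(3)
  from \<open>model cut cut1 Gam R \<delta>\<close> interpret model cut cut1 Gam R \<delta> .
  obtain h k r where hk: "homeomorphism surface (sweep_map PLeg) h k"
    "r > 0" "\<And>a. a \<in> surface \<Longrightarrow> norm (fst a) \<ge> r \<Longrightarrow> h a = a"
    "\<And>a. a \<in> sweep_map PLeg \<Longrightarrow> norm (fst a) \<ge> r \<Longrightarrow> a \<in> surface \<and> h a = a"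
    "\<And>z. z \<in> sector \<Longrightarrow> norm z \<ge> exp (- R - 1) \<Longrightarrow> norm (fst (leg_point z)) < r \<and>
       norm (fst (rot_map (leg_point z))) < r \<and> norm (fst (rot_map (rot_map (leg_point z)))) < r"
    by (rule surface_homeomorphism) (rule that)
  show thesis
  proof (rule that[of surface h k r])
    show "lagrangian_submanifold surface" by (rule lagrangian_surface)
    show "homeomorphism surface tropical_line h k" using hk(1) by (simp add: tropical_line_eq)
    show "\<exists>t. (0, t) \<in> tropical_line \<and> dist (snd a) t < \<epsilon>" if "a \<in> surface" for a
      using surface_near[OF that] prec by (metis le_less_trans)
    show "\<exists>m. (m, t) \<in> surface \<and> norm m < r" if t: "(0, t) \<in> tropical_line" for t
    proof -
      obtain b where b: "b \<in> PLeg" "(0, t) = b \<or> (0, t) = rot_map b \<or> (0, t) = rot_map (rot_map b)"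
        using t unfolding tropical_line_eq by (auto elim: sweep_mapE)
      then obtain z where z: "z \<in> sector" "b = profile_point z" by (auto simp: PLeg_def)
      have rot0: "fst a = 0" if "fst (rot_map a) = 0" for a
      proof -
        obtain m n where a: "a = (m, to_torus n)" by (metis surj_pair to_torus_rep)
        show ?thesis using that by (simp add: a rot_map_to_torus vec_eq_iff forall_2)
      qed
      have "fst b = 0" using b(2) rot0[of b] rot0[of "rot_map b"] by (metis fst_conv)
      then have "max (height z) 0 = 0"
        using profile_point_eq[OF z(1)] z(2) by (simp add: vec_eq_iff forall_2)
      then have "height z \<le> 0" by linarith
      then obtain y where y: "y \<in> sector" "norm y \<ge> exp (- R - 1)" "snd (leg_point y) = snd b"
        using fibre_attained[OF z(1)] z(2) by metis
      have L: "leg_point y \<in> Leg" using y by (simp add: Leg_def)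
      note s = snd_rot_map_cong[OF y(3)] snd_rot_map_cong[OF snd_rot_map_cong[OF y(3)]]
      have "\<exists>a. a \<in> surface \<and> snd a = t \<and> norm (fst a) < r"
        using b(2) hk(5)[OF y(1,2)] s y(3) sweep_mapI[OF L] unfolding surface_eq by (metis snd_conv)
      then show ?thesis by (metis prod.collapse)
    qed
  qed (use hk tropical_line_eq in auto)
qed

section \<open>Unimodular triangles\<close>

definition frame :: "NR \<Rightarrow> NR \<Rightarrow> NR \<Rightarrow> NR" where
  "frame u w n = n $ 1 *\<^sub>R u + n $ 2 *\<^sub>R w"

lemma linear_frame: "linear (frame u w)"
  by (rule linearI) (simp_all add: frame_def algebra_simps)

lemma lattice_iso_frame:
  assumes "lattice_basis u w"
  shows "lattice_iso (frame u w)"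
proof -
  have uw: "u \<in> lattice_N" "w \<in> lattice_N" and
    uniq: "\<And>n. n \<in> lattice_N \<Longrightarrow> \<exists>!(a :: int, b :: int). n = of_int a *\<^sub>R u + of_int b *\<^sub>R w"
    using assms by (auto simp: lattice_basis_def)
  have ex: "\<exists>c. c \<in> lattice_N \<and> frame u w c = n" if n: "n \<in> lattice_N" for n
  proof -
    obtain a b :: int where "n = of_int a *\<^sub>R u + of_int b *\<^sub>R w" using uniq[OF n] by auto
    then show ?thesis
      by (intro exI[of _ "vector [of_int a, of_int b]"]) (simp add: frame_def lattice_N_iff)
  qed
  have ax: "axis i 1 \<in> lattice_N" for i :: 2 by (auto simp: lattice_N_def axis_def)
  obtain c1 c2 where c: "frame u w c1 = axis 1 1" "frame u w c2 = axis 2 1"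
    "c1 \<in> lattice_N" "c2 \<in> lattice_N"
    using ex ax by metis
  have surj: "frame u w (n $ 1 *\<^sub>R c1 + n $ 2 *\<^sub>R c2) = n" for n
    using c linear_frame[of u w]
    by (simp add: linear_add linear_cmul vec_eq_iff forall_2 axis_def)
  then have "surj (frame u w)" by (rule surjI)
  moreover from this have inj: "inj (frame u w)"
    by (intro linear_surjective_imp_injective[OF linear_frame]) simp_all
  ultimately have "bij (frame u w)" by (simp add: bij_def)
  moreover have "frame u w n \<in> lattice_N \<longleftrightarrow> n \<in> lattice_N" for n
  proof
    assume "frame u w n \<in> lattice_N"
    then obtain c where "c \<in> lattice_N" "frame u w c = frame u w n" using ex by blast
    then show "n \<in> lattice_N" using injD[OF inj] by metis
  next
    assume "n \<in> lattice_N"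
    then show "frame u w n \<in> lattice_N"
      using uw by (auto simp: frame_def lattice_N_iff)
  qed
  ultimately show ?thesis using linear_frame by (simp add: lattice_iso_def)
qed

text \<open>The dual basis: \<open>adjoint (inv (frame u w))\<close> expresses a vector by its products with \<open>u\<close>, \<open>w\<close>.\<close>

lemma dual_frame:
  assumes "lattice_iso (frame u w)"
  shows "adjoint (inv (frame u w)) m \<bullet> u = m $ 1" "adjoint (inv (frame u w)) m \<bullet> w = m $ 2"
    "adjoint (inv (frame u w)) (vector [d \<bullet> u, d \<bullet> w]) = d"
proof -
  have 1: "adjoint (inv (frame u w)) m \<bullet> u = m $ 1" for m
    using adjoint_inv_inner[OF assms, of m "vector [1, 0]"] by (simp add: frame_def inner_vec_def sum_2)
  have 2: "adjoint (inv (frame u w)) m \<bullet> w = m $ 2" for m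
    using adjoint_inv_inner[OF assms, of m "vector [0, 1]"] by (simp add: frame_def inner_vec_def sum_2)
  show "adjoint (inv (frame u w)) m \<bullet> u = m $ 1" "adjoint (inv (frame u w)) m \<bullet> w = m $ 2"
    by (rule 1 2)+
  have "surj (frame u w)" using assms by (simp add: lattice_iso_def bij_is_surj)
  have "adjoint (inv (frame u w)) (vector [d \<bullet> u, d \<bullet> w]) \<bullet> n = d \<bullet> n" for n
  proof -
    obtain c where "n = frame u w c" using \<open>surj (frame u w)\<close> by (metis surjD)
    then show ?thesis by (simp add: frame_def inner_add_right 1 2)
  qed
  then show "adjoint (inv (frame u w)) (vector [d \<bullet> u, d \<bullet> w]) = d" using vector_eq_rdot by blast
qed

text \<open>Unimodularity enters through the frame \<open>B\<close> of edge vectors: it is a lattice isomorphism that carries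
  the standard triangle to the given one, so all triangles have the same local model.\<close>

locale unimodular_triangle =
  fixes v0 v1 v2 :: NR
  assumes lattice: "v0 \<in> lattice_N" "v1 \<in> lattice_N" "v2 \<in> lattice_N"
    and basis: "lattice_basis (v1 - v0) (v2 - v0)"
begin

abbreviation "B \<equiv> frame (v1 - v0) (v2 - v0)"

lemma B: "lattice_iso B"
  by (rule lattice_iso_frame[OF basis])

lemma inj_B: "inj B" and bij_B: "bij B"
  using B by (auto simp: lattice_iso_def bij_is_inj)

lemma hull_eq: "convex hull {v0, v1, v2} = {v0 + B n | n. 0 \<le> n $ 1 \<and> 0 \<le> n $ 2 \<and> n $ 1 + n $ 2 \<le> 1}"
proof -
  have "convex hull {v0, v1, v2} = {v0 + x *\<^sub>R (v1 - v0) + y *\<^sub>R (v2 - v0) | x y. 0 \<le> x \<and> 0 \<le> y \<and> x + y \<le> 1}"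
    by (rule convex_hull_3_alt)
  also have "\<dots> = {v0 + B n | n. 0 \<le> n $ 1 \<and> 0 \<le> n $ 2 \<and> n $ 1 + n $ 2 \<le> 1}" (is "?L = ?R")
  proof (intro equalityI subsetI)
    fix p assume "p \<in> ?L"
    then obtain x y where "p = v0 + B (vector [x, y])" "0 \<le> x" "0 \<le> y" "x + y \<le> 1"
      by (auto simp: frame_def add.assoc)
    then show "p \<in> ?R" by (intro CollectI exI[of _ "vector [x, y]"]) simp
  next
    fix p assume "p \<in> ?R"
    then obtain n where "p = v0 + B n" "0 \<le> n $ 1" "0 \<le> n $ 2" "n $ 1 + n $ 2 \<le> 1" by blast
    then show "p \<in> ?L" by (intro CollectI exI[of _ "n $ 1"] exI[of _ "n $ 2"]) (simp add: frame_def add.assoc)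
  qed
  finally show ?thesis .
qed

lemma distinct: "v0 \<noteq> v1" "v0 \<noteq> v2" "v1 \<noteq> v2"
proof -
  have 1: "B (vector [1, 0]) = v1 - v0" and 2: "B (vector [0, 1]) = v2 - v0" and 0: "B 0 = 0"
    by (simp_all add: frame_def)
  have "vector [1, 0] \<noteq> (0 :: NR)" "vector [0, 1] \<noteq> (0 :: NR)" "vector [1, 0] \<noteq> (vector [0, 1] :: NR)"
    by (auto simp: vec_eq_iff forall_2)
  then show "v0 \<noteq> v1" "v0 \<noteq> v2" "v1 \<noteq> v2"
    using 0 1 2 injD[OF inj_B] by (metis right_minus_eq)+
qed

lemma lattice_points:
  assumes "p \<in> lattice_N" "p \<in> convex hull {v0, v1, v2}"
  shows "p \<in> {v0, v1, v2}"
proof -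
  obtain n where n: "p = v0 + B n" "0 \<le> n $ 1" "0 \<le> n $ 2" "n $ 1 + n $ 2 \<le> 1"
    using assms(2) unfolding hull_eq by blast
  then have "B n \<in> lattice_N" using lattice_N_diff[OF assms(1) lattice(1)] by simp
  then have "n \<in> lattice_N" using B by (simp add: lattice_iso_def)
  then obtain a b :: int where ab: "n $ 1 = of_int a" "n $ 2 = of_int b"
    by (auto simp: lattice_N_iff elim!: Ints_cases)
  have "0 \<le> a" "0 \<le> b" "a + b \<le> 1" using n by (simp_all add: ab flip: of_int_add)
  then consider "a = 0" "b = 0" | "a = 1" "b = 0" | "a = 0" "b = 1" by linarith
  then show ?thesis using n(1) ab by cases (simp_all add: frame_def)
qed

lemma affine_independent: "\<not> affine_dependent {v0, v1, v2}"
proof -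
  have "independent {v1 - v0, v2 - v0}"
  proof
    assume "dependent {v1 - v0, v2 - v0}"
    moreover have "v1 - v0 \<noteq> v2 - v0" using distinct by simp
    ultimately obtain x y where xy: "x *\<^sub>R (v1 - v0) + y *\<^sub>R (v2 - v0) = 0" "x \<noteq> 0 \<or> y \<noteq> 0"
      using dependent_finite[of "{v1 - v0, v2 - v0}"] by auto
    then have "B (vector [x, y]) = B 0" by (simp add: frame_def)
    then have "vector [x, y] = (0 :: NR)" by (rule injD[OF inj_B])
    then show False using xy(2) by (simp add: vec_eq_iff forall_2)
  qed
  moreover have "{v1 - v0, v2 - v0} = (\<lambda>x. - v0 + x) ` ({v0, v1, v2} - {v0})"
    using distinct by auto
  ultimately show ?thesis
    using affine_dependent_iff_dependent2[of v0 "{v0, v1, v2}"] by simp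
qed

lemma extreme_points:
  assumes "X \<subseteq> {v0, v1, v2}"
  shows "v extreme_point_of convex hull X \<longleftrightarrow> v \<in> X"
  using extreme_point_of_convex_hull_affine_independent[of X v]
    affine_independent_subset[OF affine_independent assms] by blast


lemma interior_B_tri:
  assumes "0 < n $ 1" "0 < n $ 2" "n $ 1 + n $ 2 < 1 / 2"
  shows "v0 + 2 *\<^sub>R B n \<in> rel_interior (convex hull {v0, v1, v2})"
proof -
  define u where "u v = (if v = v0 then 1 - 2 * n $ 1 - 2 * n $ 2 else if v = v1 then 2 * n $ 1 else 2 * n $ 2)" for v
  have u: "u v0 = 1 - 2 * n $ 1 - 2 * n $ 2" "u v1 = 2 * n $ 1" "u v2 = 2 * n $ 2"
    using distinct by (auto simp: u_def)
  have "rel_interior (convex hull {v0, v1, v2}) =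
      {y. \<exists>u. (\<forall>x\<in>{v0, v1, v2}. 0 < u x) \<and> sum u {v0, v1, v2} = 1 \<and> (\<Sum>x\<in>{v0, v1, v2}. u x *\<^sub>R x) = y}"
    by (rule rel_interior_convex_hull_explicit[OF affine_independent])
  moreover have "(\<Sum>x\<in>{v0, v1, v2}. u x *\<^sub>R x) = v0 + 2 *\<^sub>R B n"
  proof -
    have "(\<Sum>x\<in>{v0, v1, v2}. u x *\<^sub>R x) = u v0 *\<^sub>R v0 + u v1 *\<^sub>R v1 + u v2 *\<^sub>R v2"
      using distinct by simp
    then show ?thesis unfolding u by (simp add: frame_def algebra_simps)
  qed
  moreover have "sum u {v0, v1, v2} = 1" "\<forall>x\<in>{v0, v1, v2}. 0 < u x"
    using distinct u assms by auto
  ultimately show ?thesis by blast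
qed

end

lemma to_torus_cong: "x - y \<in> lattice_N \<Longrightarrow> to_torus x = to_torus y"
  by (simp add: to_torus_eq_iff)

lemma C_cell_subset:
  assumes "e = convex hull X" "\<And>p. p \<in> e \<Longrightarrow> to_torus ((1 / 2) *\<^sub>R p) \<in> T"
    "\<And>p. p \<in> e \<Longrightarrow> - to_torus ((1 / 2) *\<^sub>R p) \<in> T"
  shows "C_cell e \<subseteq> T"
proof -
  have "t \<in> T \<and> - t \<in> T" if t: "t \<in> C_plus e" for t
  proof -
    obtain y k where y: "t = to_torus y" "k \<in> lattice_N"
      "2 *\<^sub>R (y - k) extreme_point_of e \<or> 2 *\<^sub>R (y - k) \<in> rel_interior e"
      using t by (auto simp: C_plus_def)
    then have "2 *\<^sub>R (y - k) \<in> e"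
      using rel_interior_subset by (auto simp: extreme_point_of_def)
    moreover have "t = to_torus ((1 / 2) *\<^sub>R (2 *\<^sub>R (y - k)))"
      unfolding y(1) using y(2) by (intro to_torus_cong) simp
    ultimately show ?thesis using assms by metis
  qed
  then show ?thesis by (auto simp: C_cell_def C_minus_def)
qed

lemma C_plusI: "p extreme_point_of e \<or> p \<in> rel_interior e \<Longrightarrow> to_torus ((1 / 2) *\<^sub>R p) \<in> C_plus e"
  unfolding C_plus_def by (intro CollectI exI[of _ "(1 / 2) *\<^sub>R p"] conjI refl bexI[of _ 0]) (auto simp: lattice_N_zero)

text \<open>The two half-edges of an edge close up to a full circle.\<close>

lemma C_cell_edge:
  assumes "v \<in> lattice_N" "w \<in> lattice_N" "v \<noteq> w"
  shows "C_cell (convex hull {v, w}) = range (\<lambda>\<theta>. to_torus ((1 / 2) *\<^sub>R v + \<theta> *\<^sub>R (w - v)))" (is "_ = range ?c")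
proof
  have per: "?c (\<theta> + of_int k) = ?c \<theta>" for \<theta> and k :: int
  proof (rule to_torus_cong)
    have "of_int k *\<^sub>R (w - v) \<in> lattice_N" using assms by (auto simp: lattice_N_iff)
    then show "(1 / 2) *\<^sub>R v + (\<theta> + of_int k) *\<^sub>R (w - v) - ((1 / 2) *\<^sub>R v + \<theta> *\<^sub>R (w - v)) \<in> lattice_N"
      by (simp add: algebra_simps)
  qed
  have neg: "- ?c \<theta> = ?c (- \<theta>)" for \<theta>
    unfolding uminus_to_torus
  proof (rule to_torus_cong)
    have "- ((1 / 2) *\<^sub>R v + \<theta> *\<^sub>R (w - v)) - ((1 / 2) *\<^sub>R v + - \<theta> *\<^sub>R (w - v)) = - v"
      by (simp add: vec_eq_iff)
    then show "- ((1 / 2) *\<^sub>R v + \<theta> *\<^sub>R (w - v)) - ((1 / 2) *\<^sub>R v + - \<theta> *\<^sub>R (w - v)) \<in> lattice_N"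
      using lattice_N_minus[OF assms(1)] by simp
  qed
  have seg: "convex hull {v, w} = closed_segment v w" by (rule segment_convex_hull[symmetric])
  show "C_cell (convex hull {v, w}) \<subseteq> range ?c"
  proof (rule C_cell_subset[OF refl])
    fix p assume "p \<in> convex hull {v, w}"
    then obtain s where p: "p = (1 - s) *\<^sub>R v + s *\<^sub>R w" unfolding seg by (auto simp: closed_segment_def)
    have "(1 / 2) *\<^sub>R p = (1 / 2) *\<^sub>R v + (s / 2) *\<^sub>R (w - v)"
      unfolding p by (simp add: vec_eq_iff field_simps)
    then show "to_torus ((1 / 2) *\<^sub>R p) \<in> range ?c" "- to_torus ((1 / 2) *\<^sub>R p) \<in> range ?c"
      using neg[of "s / 2"] rangeI[of ?c "s / 2"] rangeI[of ?c "- (s / 2)"] by simp_all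
  qed
  have plus: "?c \<theta> \<in> C_plus (convex hull {v, w})" if "0 \<le> \<theta>" "\<theta> \<le> 1 / 2" for \<theta>
  proof -
    define p where "p = (1 - 2 * \<theta>) *\<^sub>R v + (2 * \<theta>) *\<^sub>R w"
    have p: "p extreme_point_of closed_segment v w \<or> p \<in> rel_interior (closed_segment v w)"
    proof (cases "\<theta> = 0 \<or> \<theta> = 1 / 2")
      case True
      then have "2 * \<theta> = 0 \<or> 2 * \<theta> = 1" by auto
      then have "p = v \<or> p = w" unfolding p_def by (elim disjE) simp_all
      then show ?thesis using extreme_point_of_segment by auto
    next
      case False
      then have "p \<in> open_segment v w"
        using that assms(3) unfolding in_segment p_def
        by (intro conjI exI[of _ "2 * \<theta>"]) auto
      then show ?thesis using assms(3) by (simp add: rel_interior_closed_segment)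
    qed
    have "(1 / 2) *\<^sub>R p = (1 / 2) *\<^sub>R v + \<theta> *\<^sub>R (w - v)" by (simp add: p_def vec_eq_iff field_simps)
    then show ?thesis using C_plusI[OF p] by (simp add: seg)
  qed
  show "range ?c \<subseteq> C_cell (convex hull {v, w})"
  proof (rule image_subsetI)
    fix \<theta> :: real
    define f where "f = \<theta> - of_int \<lfloor>\<theta>\<rfloor>"
    have f: "0 \<le> f" "f < 1" unfolding f_def by linarith+
    have t: "?c \<theta> = ?c f" using per[of f "\<lfloor>\<theta>\<rfloor>"] by (simp add: f_def)
    show "?c \<theta> \<in> C_cell (convex hull {v, w})"
    proof (cases "f \<le> 1 / 2")
      case True
      then show ?thesis using plus[OF f(1)] by (simp add: t C_cell_def)
    next
      case False
      have "- (1 - f) = f - 1" by simp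
      then have "?c f = ?c (- (1 - f))" using per[of "f - 1" 1] by simp
      also have "\<dots> = - ?c (1 - f)" by (rule neg[symmetric])
      finally show ?thesis
        using plus[of "1 - f"] f False unfolding t C_cell_def C_minus_def by simp
    qed
  qed
qed

section \<open>Duality between the subdivision and the tropical curve\<close>

lemma finite_bounded_lattice:
  assumes "bounded P"
  shows "finite (P \<inter> lattice_N)"
proof -
  obtain b where b: "\<And>x. x \<in> P \<Longrightarrow> norm x \<le> b" using assms bounded_iff by blast
  define k where "k = \<lceil>b\<rceil>"
  have "P \<inter> lattice_N \<subseteq> (\<lambda>(i :: int, j :: int). vector [of_int i, of_int j]) ` ({- k..k} \<times> {- k..k})"
  proof
    fix x assume x: "x \<in> P \<inter> lattice_N"
    then obtain i j :: int where ij: "x $ 1 = of_int i" "x $ 2 = of_int j"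
      by (auto simp: lattice_N_iff elim!: Ints_cases)
    have "\<bar>x $ 1\<bar> \<le> b" "\<bar>x $ 2\<bar> \<le> b"
      using b[of x] x component_le_norm_cart[of x] by (meson IntD1 order_trans)+
    then have "\<bar>i\<bar> \<le> k" "\<bar>j\<bar> \<le> k" unfolding ij k_def by linarith+
    moreover have "x = vector [of_int i, of_int j]" using ij by (simp add: vec_eq_iff forall_2)
    ultimately show "x \<in> (\<lambda>(i :: int, j :: int). vector [of_int i, of_int j]) ` ({- k..k} \<times> {- k..k})"
      by (intro image_eqI[of _ _ "(i, j)"]) auto
  qed
  then show ?thesis by (rule finite_subset) auto
qed

locale unimodal_subdivision =
  fixes P :: "NR set" and \<nu> :: "NR \<Rightarrow> real" and \<P> :: "NR set set"
  assumes polytope: "lattice_polytope P" and regular: "regular_subdivision P \<nu> \<P>"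
    and unimodal: "unimodal \<P>"
begin

lemma finite_cells: "finite \<P>" and union_cells: "\<Union>\<P> = P"
  and faces: "\<And>Q Q'. Q \<in> \<P> \<Longrightarrow> Q' \<in> \<P> \<Longrightarrow> Q \<inter> Q' face_of Q"
  and domains: "\<P> = linearity_domains P \<nu>" and convex_\<nu>: "convex_on P \<nu>"
  using regular by (auto simp: regular_subdivision_def lattice_subdivision_def)

lemma triangle:
  assumes "Q \<in> \<P>"
  obtains v0 v1 v2 where "unimodular_triangle v0 v1 v2" "Q = convex hull {v0, v1, v2}"
  using assms unimodal unfolding unimodal_def elementary_simplex_def unimodular_triangle_def by auto

definition verts :: "NR set \<Rightarrow> NR set" where
  "verts Q = Q \<inter> lattice_N"

lemma verts_eq: "unimodular_triangle v0 v1 v2 \<Longrightarrow> Q = convex hull {v0, v1, v2} \<Longrightarrow> verts Q = {v0, v1, v2}"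
proof -
  assume u: "unimodular_triangle v0 v1 v2" and Q: "Q = convex hull {v0, v1, v2}"
  interpret unimodular_triangle v0 v1 v2 by (rule u)
  show ?thesis
    using lattice_points lattice hull_subset[of "{v0, v1, v2}" convex] unfolding verts_def Q by blast
qed

lemma cell_subset: "Q \<in> \<P> \<Longrightarrow> Q \<subseteq> P"
  using union_cells by blast

lemma bounded_P: "bounded P"
  using polytope by (auto simp: lattice_polytope_def intro: bounded_convex_hull finite_imp_bounded)

lemma finite_lattice: "finite (P \<inter> lattice_N)"
  by (rule finite_bounded_lattice[OF bounded_P])

lemma convex_P: "convex P"
  using polytope by (auto simp: lattice_polytope_def)

lemma affine_on_cell:
  assumes "Q \<in> \<P>"
  obtains m c where "\<And>v. v \<in> Q \<Longrightarrow> \<nu> v = v \<bullet> m + c"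
  using assms domains unfolding linearity_domains_def is_affine_on_def by blast

lemma cell_maximal:
  assumes "Q \<in> \<P>" "Q \<subseteq> D" "D \<subseteq> P" "convex D" "is_affine_on \<nu> D"
  shows "D = Q"
  using assms domains unfolding linearity_domains_def by blast

text \<open>The affine function of a cell supports \<open>\<nu>\<close>, because a cell has interior points; by maximality
  of the cell it touches \<open>\<nu>\<close> nowhere else.\<close>

lemma cell_contact:
  assumes Q: "Q \<in> \<P>" and aff: "\<And>v. v \<in> Q \<Longrightarrow> \<nu> v = v \<bullet> m + c" and y: "y \<in> P"
  shows "\<nu> y \<ge> y \<bullet> m + c" and "\<nu> y = y \<bullet> m + c \<Longrightarrow> y \<in> Q"
proof -
  obtain v0 v1 v2 where u: "unimodular_triangle v0 v1 v2" and Qe: "Q = convex hull {v0, v1, v2}"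
    by (rule triangle[OF Q])
  interpret unimodular_triangle v0 v1 v2 by (rule u)
  have supp: "\<nu> y \<ge> y \<bullet> m + c" if y: "y \<in> P" for y
  proof -
    have "surj B" using bij_B by (simp add: bij_def)
    then obtain n where "B n = y - v0" by (metis surjD)
    then have n: "y = v0 + B n" by simp
    define K where "K = 3 * (1 + \<bar>n $ 1\<bar> + \<bar>n $ 2\<bar>)"
    define s where "s = 1 / K"
    have K: "K \<ge> 3" by (simp add: K_def)
    have s0: "0 < s" using K by (simp add: s_def)
    have "s * K = 1" using K by (simp add: s_def)
    then have s3: "s * \<bar>n $ 1\<bar> + s * \<bar>n $ 2\<bar> + s = 1 / 3" by (simp add: K_def algebra_simps)
    have "0 \<le> s * \<bar>n $ 1\<bar>" "0 \<le> s * \<bar>n $ 2\<bar>" using s0 by simp_all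
    with s0 s3 have s: "0 < s" "s \<le> 1 / 3" "s * \<bar>n $ 1\<bar> + s * \<bar>n $ 2\<bar> + s = 1 / 3"
      by linarith+
    define q1 :: NR where "q1 = vector [1 / 3, 1 / 3]"
    define q' :: NR where "q' = q1 + s *\<^sub>R (q1 - n)"
    have sn: "s * n $ i \<le> s * \<bar>n $ i\<bar>" "- (s * n $ i) \<le> s * \<bar>n $ i\<bar>" "0 \<le> s * \<bar>n $ i\<bar>" for i
      using s0 mult_left_mono[of "n $ i" "\<bar>n $ i\<bar>" s] mult_left_mono[of "- (n $ i)" "\<bar>n $ i\<bar>" s]
      by simp_all
    have "q' $ 1 = 1 / 3 + s / 3 - s * n $ 1" "q' $ 2 = 1 / 3 + s / 3 - s * n $ 2"
      by (simp_all add: q'_def q1_def algebra_simps)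
    then have "0 \<le> q' $ 1" "0 \<le> q' $ 2" "q' $ 1 + q' $ 2 \<le> 1"
      using s(1,3) sn[of 1] sn[of 2] by linarith+
    then have q'Q: "v0 + B q' \<in> Q" unfolding Qe hull_eq by blast
    have q1Q: "v0 + B q1 \<in> Q" unfolding Qe hull_eq by (intro CollectI exI[of _ q1]) (simp add: q1_def)
    define t where "t = s / (1 + s)"
    have t: "0 < t" "t < 1" "(1 - t) * (1 + s) = 1" "(1 - t) * s = t"
      using s by (simp_all add: t_def field_simps)
    have "(1 - t) *\<^sub>R q' + t *\<^sub>R n = ((1 - t) * (1 + s)) *\<^sub>R q1 + (t - (1 - t) * s) *\<^sub>R n"
      by (simp add: q'_def algebra_simps)
    then have "(1 - t) *\<^sub>R q' + t *\<^sub>R n = q1" using t by simp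
    then have "B q1 = B ((1 - t) *\<^sub>R q' + t *\<^sub>R n)" by simp
    also have "\<dots> = (1 - t) *\<^sub>R B q' + t *\<^sub>R B n"
      by (simp only: linear_add[OF linear_frame] linear_cmul[OF linear_frame])
    finally have "B q1 = (1 - t) *\<^sub>R B q' + t *\<^sub>R B n" .
    then have comb: "v0 + B q1 = (1 - t) *\<^sub>R (v0 + B q') + t *\<^sub>R y"
      by (simp add: n algebra_simps)
    have "\<nu> (v0 + B q1) \<le> (1 - t) * \<nu> (v0 + B q') + t * \<nu> y"
      unfolding comb using cell_subset[OF Q] q'Q y t by (intro convex_onD[OF convex_\<nu>]) auto
    moreover have "\<nu> (v0 + B q1) = (1 - t) * (\<nu> (v0 + B q')) + t * (y \<bullet> m + c)"
    proof -
      have "\<nu> (v0 + B q1) = (v0 + B q1) \<bullet> m + c" by (rule aff[OF q1Q])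
      also have "\<dots> = (1 - t) * ((v0 + B q') \<bullet> m + c) + t * (y \<bullet> m + c)"
        unfolding comb by (simp add: inner_add_left algebra_simps)
      finally show ?thesis using aff[OF q'Q] by simp
    qed
    ultimately have "t * (y \<bullet> m + c) \<le> t * \<nu> y" by linarith
    then show ?thesis using t(1) by simp
  qed
  then show "\<nu> y \<ge> y \<bullet> m + c" using y by blast
  define D where "D = {y \<in> P. \<nu> y = y \<bullet> m + c}"
  have "convex D"
  proof (rule convexI)
    fix x z :: NR and a b :: real
    assume xz: "x \<in> D" "z \<in> D" and ab: "0 \<le> a" "0 \<le> b" "a + b = 1"
    have xP: "a *\<^sub>R x + b *\<^sub>R z \<in> P" using convexD[OF convex_P] xz ab by (auto simp: D_def)
    have "a = 1 - b" using ab by simp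
    have "\<nu> (a *\<^sub>R x + b *\<^sub>R z) \<le> a * \<nu> x + b * \<nu> z"
      unfolding \<open>a = 1 - b\<close> using xz ab by (intro convex_onD[OF convex_\<nu>]) (auto simp: D_def)
    also have "\<dots> = a * (x \<bullet> m) + b * (z \<bullet> m) + (a + b) * c"
      using xz by (simp add: D_def algebra_simps)
    also have "\<dots> = (a *\<^sub>R x + b *\<^sub>R z) \<bullet> m + c" using ab by (simp add: inner_add_left)
    finally show "a *\<^sub>R x + b *\<^sub>R z \<in> D" using supp[OF xP] xP by (simp add: D_def)
  qed
  moreover have "is_affine_on \<nu> D" by (auto simp: is_affine_on_def D_def)
  moreover have "Q \<subseteq> D" using aff cell_subset[OF Q] by (auto simp: D_def)
  ultimately have "D = Q" by (intro cell_maximal[OF Q]) (auto simp: D_def)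
  then show "\<nu> y = y \<bullet> m + c \<Longrightarrow> y \<in> Q" using y by (auto simp: D_def)
qed

definition mins :: "MR \<Rightarrow> NR set" where
  "mins m = {v \<in> P \<inter> lattice_N. v \<bullet> m + \<nu> v = legendre P \<nu> m}"

text \<open>The vertex of the tropical curve dual to a cell \<open>Q\<close> is the point at which the functions
  \<open>v \<bullet> m + \<nu> v\<close> with \<open>v \<in> Q\<close> agree. It is determined by the slope of \<open>\<nu>\<close> on \<open>Q\<close>.\<close>

definition dual_vertex :: "NR set \<Rightarrow> MR" where
  "dual_vertex Q = (SOME m. \<exists>c. \<forall>v\<in>Q. \<nu> v = v \<bullet> (- m) + c)"

lemma dual_vertex:
  assumes "Q \<in> \<P>"
  obtains c where "\<And>v. v \<in> Q \<Longrightarrow> v \<bullet> dual_vertex Q + \<nu> v = c"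
    "\<And>v. v \<in> P \<Longrightarrow> v \<bullet> dual_vertex Q + \<nu> v \<ge> c"
    "\<And>v. v \<in> P \<Longrightarrow> v \<bullet> dual_vertex Q + \<nu> v = c \<Longrightarrow> v \<in> Q"
proof -
  obtain m c where "\<And>v. v \<in> Q \<Longrightarrow> \<nu> v = v \<bullet> m + c" using affine_on_cell[OF assms] by blast
  then have "\<exists>m. \<exists>c. \<forall>v\<in>Q. \<nu> v = v \<bullet> (- m) + c" by (intro exI[of _ "- m"] exI[of _ c]) simp
  then have "\<exists>c. \<forall>v\<in>Q. \<nu> v = v \<bullet> (- dual_vertex Q) + c" unfolding dual_vertex_def by (rule someI_ex)
  then obtain c where c: "\<And>v. v \<in> Q \<Longrightarrow> \<nu> v = v \<bullet> (- dual_vertex Q) + c" by blast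
  show ?thesis
  proof (rule that)
    show "v \<bullet> dual_vertex Q + \<nu> v = c" if "v \<in> Q" for v using c[OF that] by simp
    show "v \<bullet> dual_vertex Q + \<nu> v \<ge> c" if "v \<in> P" for v
      using cell_contact(1)[OF assms c that] by simp
    show "v \<in> Q" if "v \<in> P" "v \<bullet> dual_vertex Q + \<nu> v = c" for v
      using cell_contact(2)[OF assms c that(1)] that(2) by simp
  qed
qed

lemma legendre_le: "v \<in> P \<Longrightarrow> v \<in> lattice_N \<Longrightarrow> legendre P \<nu> m \<le> v \<bullet> m + \<nu> v"
  unfolding legendre_def using finite_lattice by (intro Min_le) auto

lemma legendre_eqI:
  assumes "v \<in> P" "v \<in> lattice_N" "\<And>w. w \<in> P \<Longrightarrow> w \<in> lattice_N \<Longrightarrow> v \<bullet> m + \<nu> v \<le> w \<bullet> m + \<nu> w"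
  shows "legendre P \<nu> m = v \<bullet> m + \<nu> v"
  unfolding legendre_def using finite_lattice assms by (intro Min_eqI) auto

lemma mins_dual_vertex:
  assumes "Q \<in> \<P>"
  shows "mins (dual_vertex Q) = verts Q"
proof -
  obtain c where c: "\<And>v. v \<in> Q \<Longrightarrow> v \<bullet> dual_vertex Q + \<nu> v = c"
    "\<And>v. v \<in> P \<Longrightarrow> v \<bullet> dual_vertex Q + \<nu> v \<ge> c"
    "\<And>v. v \<in> P \<Longrightarrow> v \<bullet> dual_vertex Q + \<nu> v = c \<Longrightarrow> v \<in> Q"
    using dual_vertex[OF assms] by metis
  obtain v0 v1 v2 where u: "unimodular_triangle v0 v1 v2" and Qe: "Q = convex hull {v0, v1, v2}"
    by (rule triangle[OF assms])
  have v0: "v0 \<in> Q" "v0 \<in> lattice_N" using verts_eq[OF u Qe] by (auto simp: verts_def)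
  then have "legendre P \<nu> (dual_vertex Q) = v0 \<bullet> dual_vertex Q + \<nu> v0"
    using c cell_subset[OF assms] by (intro legendre_eqI) auto
  then have "legendre P \<nu> (dual_vertex Q) = c" using c(1) v0 by simp
  then show ?thesis using c cell_subset[OF assms] by (auto simp: mins_def verts_def)
qed

lemma mins_verts_imp_dual_vertex:
  assumes "Q \<in> \<P>" "verts Q \<subseteq> mins m"
  shows "m = dual_vertex Q"
proof -
  obtain v0 v1 v2 where u: "unimodular_triangle v0 v1 v2" and Qe: "Q = convex hull {v0, v1, v2}"
    by (rule triangle[OF assms(1)])
  interpret unimodular_triangle v0 v1 v2 by (rule u)
  have v: "verts Q = {v0, v1, v2}" by (rule verts_eq[OF u Qe])
  define d where "d = m - dual_vertex Q"
  have val: "x \<bullet> m' + \<nu> x = legendre P \<nu> m'" if "x \<in> mins m'" for x m'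
    using that by (simp add: mins_def)
  have eq: "x \<bullet> d = v0 \<bullet> d" if x: "x \<in> {v0, v1, v2}" for x
  proof -
    have 1: "x \<in> mins m" "v0 \<in> mins m" using assms(2) x unfolding v by blast+
    have 2: "x \<in> mins (dual_vertex Q)" "v0 \<in> mins (dual_vertex Q)"
      using mins_dual_vertex[OF assms(1)] x unfolding v by blast+
    show ?thesis
      unfolding d_def inner_diff_right using val[OF 1(1)] val[OF 1(2)] val[OF 2(1)] val[OF 2(2)] by linarith
  qed
  then have "d \<bullet> (v1 - v0) = 0" "d \<bullet> (v2 - v0) = 0"
    using eq[of v1] eq[of v2] by (simp_all add: inner_diff_right inner_commute)
  then have "d = 0" using dual_frame(3)[OF B, of d] linear_0[OF linear_adjoint_inv[OF B]]
    by (simp add: vec2_zero)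
  then show ?thesis by (simp add: d_def)
qed

lemma dual_vertex_inj:
  assumes "Q \<in> \<P>" "Q' \<in> \<P>" "dual_vertex Q = dual_vertex Q'"
  shows "Q = Q'"
proof -
  have v: "verts Q = verts Q'" using mins_dual_vertex assms by metis
  have "Q = convex hull (verts Q)" if Q: "Q \<in> \<P>" for Q
    by (rule triangle[OF Q]) (use verts_eq in auto)
  then show ?thesis using v assms by metis
qed

lemma mins_nonempty: "\<P> \<noteq> {} \<Longrightarrow> mins m \<noteq> {}"
proof -
  assume "\<P> \<noteq> {}"
  then obtain Q where Q: "Q \<in> \<P>" by blast
  obtain v0 v1 v2 where "unimodular_triangle v0 v1 v2" "Q = convex hull {v0, v1, v2}"
    by (rule triangle[OF Q])
  then have "v0 \<in> verts Q" using verts_eq by blast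
  then have "P \<inter> lattice_N \<noteq> {}" using cell_subset[OF Q] by (auto simp: verts_def)
  then have "legendre P \<nu> m \<in> (\<lambda>v. v \<bullet> m + \<nu> v) ` (P \<inter> lattice_N)"
    unfolding legendre_def using finite_lattice by (intro Min_in) auto
  then show ?thesis by (auto simp: mins_def)
qed

text \<open>There are finitely many competitors, and strict inequalities persist nearby.\<close>

lemma mins_upper_semicontinuous:
  assumes "\<P> \<noteq> {}"
  obtains \<delta> where "\<delta> > 0" "\<And>m'. dist m' m < \<delta> \<Longrightarrow> mins m' \<subseteq> mins m"
proof -
  obtain w where w: "w \<in> mins m" using mins_nonempty[OF assms] by blast
  define U where "U = (\<Inter>v\<in>(P \<inter> lattice_N) - mins m. {m'. w \<bullet> m' + \<nu> w < v \<bullet> m' + \<nu> v})"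
  have "open U"
    unfolding U_def using finite_lattice
    by (intro open_INT ballI open_Collect_less continuous_intros) auto
  moreover have "m \<in> U"
  proof -
    have "w \<bullet> m + \<nu> w < v \<bullet> m + \<nu> v" if "v \<in> (P \<inter> lattice_N) - mins m" for v
      using legendre_le[of v m] w that by (force simp: mins_def)
    then show ?thesis by (simp add: U_def)
  qed
  ultimately obtain \<delta> where \<delta>: "\<delta> > 0" "ball m \<delta> \<subseteq> U" using openE by blast
  have "mins m' \<subseteq> mins m" if "dist m' m < \<delta>" for m'
  proof
    fix v assume v: "v \<in> mins m'"
    have "m' \<in> U" using that \<delta> by (auto simp: dist_commute)
    show "v \<in> mins m"
    proof (rule ccontr)
      assume "v \<notin> mins m"
      then have "v \<in> (P \<inter> lattice_N) - mins m" using v by (auto simp: mins_def)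
      then have "w \<bullet> m' + \<nu> w < v \<bullet> m' + \<nu> v" using \<open>m' \<in> U\<close> unfolding U_def by blast
      then show False using legendre_le[of w m'] w v by (auto simp: mins_def)
    qed
  qed
  with \<delta> that show thesis by blast
qed

text \<open>Suppose that there is a third minimizer \<open>u\<close>. If it lies on the line through \<open>v\<close> and \<open>w\<close>, it belongs
  to the contact set of \<open>Q\<close> and hence is the third vertex of \<open>Q\<close>. Otherwise some cell \<open>Q'\<close> has the
  edge from \<open>v\<close> to \<open>w\<close> and contains a point slightly off the midpoint in the direction of \<open>u\<close>; by
  convexity the remaining vertex of \<open>Q'\<close> is a minimizer. In both cases all vertices of a cell are
  minimizers, and \<open>m\<close> is a vertex of the tropical curve.\<close>

lemma mins_edge:
  assumes Q: "Q \<in> \<P>" and vw: "v \<in> verts Q" "w \<in> verts Q" "v \<noteq> w" "v \<in> mins m" "w \<in> mins m"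
    and m: "\<And>Q. Q \<in> \<P> \<Longrightarrow> m \<noteq> dual_vertex Q"
  shows "mins m = {v, w}"
proof (rule ccontr)
  assume "mins m \<noteq> {v, w}"
  then obtain u where u: "u \<in> mins m" "u \<noteq> v" "u \<noteq> w" using vw by blast
  define g where "g y = \<nu> y + y \<bullet> m - legendre P \<nu> m" for y
  have inP: "x \<in> P" "x \<in> lattice_N" "g x = 0" if "x \<in> mins m" for x
    using that by (auto simp: mins_def g_def)
  have third: "x \<in> mins m" if "x \<in> P" "x \<in> lattice_N" "g x = 0" for x
    using that by (auto simp: mins_def g_def)
  obtain m1 c1 where aff: "\<And>x. x \<in> Q \<Longrightarrow> \<nu> x = x \<bullet> m1 + c1" using affine_on_cell[OF Q] by blast
  obtain a0 a1 a2 where ta: "unimodular_triangle a0 a1 a2" and Qa: "Q = convex hull {a0, a1, a2}"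
    by (rule triangle[OF Q])
  note Qv = verts_eq[OF ta Qa]
  show False
  proof (cases "collinear {v, w, u}")
    case True
    then obtain s where s: "u = s *\<^sub>R v + (1 - s) *\<^sub>R w"
      using vw(3) collinear_3_expand[of v u w] by (metis insert_commute)
    have "v \<in> Q" "w \<in> Q" using vw by (auto simp: verts_def)
    then have "v \<bullet> m1 + c1 = legendre P \<nu> m - v \<bullet> m" "w \<bullet> m1 + c1 = legendre P \<nu> m - w \<bullet> m"
      using aff inP(3)[OF vw(4)] inP(3)[OF vw(5)] by (auto simp: g_def)
    then have "s * (v \<bullet> m1 + c1) + (1 - s) * (w \<bullet> m1 + c1)
        = s * (legendre P \<nu> m - v \<bullet> m) + (1 - s) * (legendre P \<nu> m - w \<bullet> m)" by simp
    then have "u \<bullet> m1 + c1 = legendre P \<nu> m - u \<bullet> m"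
      unfolding s by (simp add: inner_add_left algebra_simps)
    then have "\<nu> u = u \<bullet> m1 + c1" using inP(3)[OF u(1)] by (simp add: g_def)
    then have "u \<in> Q" using cell_contact(2)[OF Q aff inP(1)[OF u(1)]] by blast
    then have "u \<in> verts Q" using inP(2)[OF u(1)] by (simp add: verts_def)
    then have "verts Q = {v, w, u}" using vw(1,2,3) u(2,3) unfolding Qv by auto
    then have "verts Q \<subseteq> mins m" using vw(4,5) u(1) by simp
    then show False using m[OF Q] mins_verts_imp_dual_vertex[OF Q] by simp
  next
    case False
    define p where "p = (1 / 2) *\<^sub>R v + (1 / 2) *\<^sub>R w"
    have pP: "p \<in> P" unfolding p_def using convexD[OF convex_P] inP vw by simp
    have gconv: "convex_on P g"
    proof -
      have "convex_on P (\<lambda>y. y \<bullet> m - legendre P \<nu> m)"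
        using convex_P by (intro convex_onI) (auto simp: inner_add_left algebra_simps)
      from convex_on_add[OF convex_\<nu> this] show ?thesis by (simp add: g_def[abs_def] algebra_simps)
    qed
    have "g p \<le> (1 - 1 / 2) * g v + 1 / 2 * g w"
      using convex_onD[OF gconv, of "1 / 2" v w] inP vw by (simp add: p_def)
    then have gp: "g p \<le> 0" using inP vw by simp
    have "closed (\<Union>{Q' \<in> \<P>. p \<notin> Q'})"
    proof (intro closed_Union ballI)
      fix Q' assume "Q' \<in> {Q' \<in> \<P>. p \<notin> Q'}"
      then obtain b0 b1 b2 where "Q' = convex hull {b0, b1, b2}" using triangle by blast
      then show "closed Q'" by (simp add: compact_imp_closed finite_imp_compact_convex_hull)
    qed (use finite_cells in simp)
    then have "open (- \<Union>{Q' \<in> \<P>. p \<notin> Q'})" "p \<in> - \<Union>{Q' \<in> \<P>. p \<notin> Q'}" by auto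
    then obtain \<epsilon> where \<epsilon>: "\<epsilon> > 0" "ball p \<epsilon> \<subseteq> - \<Union>{Q' \<in> \<P>. p \<notin> Q'}" using openE by blast
    define s where "s = min (1 / 2) (\<epsilon> / (2 * (norm (u - p) + 1)))"
    have "0 < 2 * (norm (u - p) + 1)" by (simp add: add_nonneg_pos)
    then have "0 < \<epsilon> / (2 * (norm (u - p) + 1))" using \<epsilon>(1) by (rule divide_pos_pos[rotated])
    then have s: "0 < s" "s < 1" unfolding s_def by linarith+
    define y where "y = (1 - s) *\<^sub>R p + s *\<^sub>R u"
    have yP: "y \<in> P" unfolding y_def using convexD[OF convex_P pP inP(1)[OF u(1)]] s by simp
    have "dist p y = s * norm (u - p)"
    proof -
      have "y - p = s *\<^sub>R (u - p)" by (simp add: y_def algebra_simps)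
      then have "norm (y - p) = s * norm (u - p)" using s by simp
      then show ?thesis by (simp add: dist_norm norm_minus_commute)
    qed
    also have "\<dots> \<le> (\<epsilon> / (2 * (norm (u - p) + 1))) * norm (u - p)"
      by (intro mult_right_mono) (auto simp: s_def)
    also have "\<dots> < \<epsilon>"
    proof -
      have "\<epsilon> * norm (u - p) < \<epsilon> * (2 * (norm (u - p) + 1))"
        using \<epsilon>(1) by (intro mult_strict_left_mono) (simp_all add: add_nonneg_pos)
      moreover have "0 < 2 * (norm (u - p) + 1)" by (simp add: add_nonneg_pos)
      ultimately show ?thesis by (simp add: divide_less_eq)
    qed
    finally have "y \<in> ball p \<epsilon>" by simp
    moreover obtain Q' where Q': "Q' \<in> \<P>" "y \<in> Q'" using yP union_cells by blast
    ultimately have pQ': "p \<in> Q'" using \<epsilon>(2) by blast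
    have pseg: "p \<in> open_segment v w"
      unfolding in_segment p_def using vw(3) by (intro conjI exI[of _ "1 / 2"]) (auto simp: algebra_simps)
    have vwQ: "v \<in> Q" "w \<in> Q" using vw by (auto simp: verts_def)
    have "p \<in> Q"
    proof -
      have "convex Q" by (simp add: Qa)
      then show ?thesis unfolding p_def using convexD[of Q] vwQ by simp
    qed
    then have "v \<in> Q \<inter> Q' \<and> w \<in> Q \<inter> Q'"
      using face_ofD[OF faces[OF Q Q'(1)] pseg vwQ] pQ' by blast
    then have vwQ': "v \<in> verts Q'" "w \<in> verts Q'" using vw by (auto simp: verts_def)
    obtain b0 b1 b2 where tb: "unimodular_triangle b0 b1 b2" and Qb: "Q' = convex hull {b0, b1, b2}"
      by (rule triangle[OF Q'(1)])
    note vb = verts_eq[OF tb Qb]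
    obtain b where b: "verts Q' = {v, w, b}" using vwQ' vw(3) unfolding vb by blast
    have "y \<in> convex hull {v, w, b}" using Q'(2) Qb vb b by simp
    then obtain \<alpha> \<beta> \<gamma> where abc: "0 \<le> \<alpha>" "0 \<le> \<beta>" "0 \<le> \<gamma>" "\<alpha> + \<beta> + \<gamma> = 1" "y = \<alpha> *\<^sub>R v + \<beta> *\<^sub>R w + \<gamma> *\<^sub>R b"
      unfolding convex_hull_3 by blast
    obtain m2 c2 where aff2: "\<And>x. x \<in> Q' \<Longrightarrow> \<nu> x = x \<bullet> m2 + c2" using affine_on_cell[OF Q'(1)] by blast
    have bQ: "v \<in> Q'" "w \<in> Q'" "b \<in> Q'" "b \<in> lattice_N" using b by (auto simp: verts_def)
    have "g y = \<alpha> * g v + \<beta> * g w + \<gamma> * g b"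
    proof -
      have "legendre P \<nu> m = (\<alpha> + \<beta> + \<gamma>) * legendre P \<nu> m" "c2 = (\<alpha> + \<beta> + \<gamma>) * c2" using abc by simp_all
      then show ?thesis
        unfolding g_def aff2[OF Q'(2)] aff2[OF bQ(1)] aff2[OF bQ(2)] aff2[OF bQ(3)]
        unfolding abc(5) by (simp add: inner_add_left algebra_simps)
    qed
    then have gy: "g y = \<gamma> * g b" using inP vw by simp
    have "g y \<le> (1 - s) * g p + s * g u"
      unfolding y_def using convex_onD[OF gconv, of s p u] s pP inP[OF u(1)] by simp
    also have "\<dots> \<le> 0" using gp s inP[OF u(1)] by (simp add: mult_nonneg_nonpos)
    finally have "\<gamma> * g b \<le> 0" using gy by simp
    have gb: "g b \<ge> 0"
      using legendre_le[of b m] bQ cell_subset[OF Q'(1)] by (auto simp: g_def)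
    have "\<gamma> \<noteq> 0"
    proof
      assume "\<gamma> = 0"
      then have "(1 - s) *\<^sub>R p + s *\<^sub>R u = \<alpha> *\<^sub>R v + \<beta> *\<^sub>R w" using abc(5) by (simp add: y_def)
      then have e: "s *\<^sub>R u = \<alpha> *\<^sub>R v + \<beta> *\<^sub>R w - (1 - s) *\<^sub>R p"
        by (simp only: eq_diff_eq add.commute)
      have "u = (1 / s) *\<^sub>R (s *\<^sub>R u)" using s(1) by simp
      also have "\<dots> = (1 / s) *\<^sub>R (\<alpha> *\<^sub>R v + \<beta> *\<^sub>R w - (1 - s) *\<^sub>R p)" unfolding e ..
      also have "\<dots> = ((\<alpha> - (1 - s) / 2) / s) *\<^sub>R v + ((\<beta> - (1 - s) / 2) / s) *\<^sub>R w"
        using s(1) by (simp add: p_def vec_eq_iff field_simps)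
      also have "(\<beta> - (1 - s) / 2) / s = 1 - (\<alpha> - (1 - s) / 2) / s"
        using abc(4) \<open>\<gamma> = 0\<close> s by (simp add: field_simps)
      finally have "u = ((\<alpha> - (1 - s) / 2) / s) *\<^sub>R v + (1 - (\<alpha> - (1 - s) / 2) / s) *\<^sub>R w" .
      then have "collinear {v, u, w}" using collinear_3_expand[of v u w] by blast
      then show False using False by (simp add: insert_commute)
    qed
    then have "g b = 0" using \<open>\<gamma> * g b \<le> 0\<close> gb abc(3)
      by (metis antisym mult_nonneg_nonneg mult_eq_0_iff)
    then have "b \<in> mins m" using third bQ cell_subset[OF Q'(1)] by blast
    then have "verts Q' \<subseteq> mins m" unfolding b using vw(4,5) by simp
    then show False using m[OF Q'(1)] mins_verts_imp_dual_vertex[OF Q'(1)] by simp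
  qed
qed

end

section \<open>Local structure of the PL lift\<close>

lemma C_cell_uminus: "t \<in> C_cell e \<Longrightarrow> - t \<in> C_cell e"
proof -
  have mm: "- (- t) = t" for t :: torus
  proof -
    obtain n where "t = to_torus n" by (metis to_torus_rep)
    then show ?thesis by (simp add: uminus_to_torus)
  qed
  show "t \<in> C_cell e \<Longrightarrow> - t \<in> C_cell e"
    unfolding C_cell_def C_minus_def using mm by auto
qed

lemma lattice_iso_comp: "lattice_iso f \<Longrightarrow> lattice_iso g \<Longrightarrow> lattice_iso (f \<circ> g)"
  unfolding lattice_iso_def by (auto intro: linear_compose bij_comp)

lemma lattice_iso_swap: "lattice_iso (frame u w) \<Longrightarrow> lattice_iso (frame w u)"
proof -
  assume f: "lattice_iso (frame u w)"
  define g :: "NR \<Rightarrow> NR" where "g n = vector [n $ 2, n $ 1]" for n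
  have "linear g" by (rule linearI) (simp_all add: g_def vec_eq_iff forall_2)
  moreover have "bij g" by (rule o_bij[of g]) (auto simp: g_def fun_eq_iff vec_eq_iff forall_2)
  ultimately have "lattice_iso g" by (auto simp: lattice_iso_def lattice_N_iff g_def)
  moreover have "frame w u = frame u w \<circ> g" by (auto simp: fun_eq_iff frame_def g_def)
  ultimately show ?thesis using lattice_iso_comp[OF f] by simp
qed

text \<open>With the swap, this provides a lattice basis that starts with any prescribed edge of the triangle.\<close>

lemma lattice_iso_third: "lattice_iso (frame u w) \<Longrightarrow> lattice_iso (frame (w - u) u)"
proof -
  assume f: "lattice_iso (frame u w)"
  define g :: "NR \<Rightarrow> NR" where "g n = vector [n $ 2 - n $ 1, n $ 1]" for n
  have "linear g" by (rule linearI) (simp_all add: g_def vec_eq_iff forall_2 algebra_simps)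
  moreover have "bij g"
    by (rule o_bij[of "\<lambda>n. vector [n $ 2, n $ 1 + n $ 2]"]) (auto simp: g_def fun_eq_iff vec_eq_iff forall_2)
  moreover have "g n \<in> lattice_N \<longleftrightarrow> n \<in> lattice_N" for n
  proof
    assume a: "g n \<in> lattice_N"
    then have "n $ 2 - n $ 1 + n $ 1 \<in> \<int>" unfolding lattice_N_iff g_def by (intro Ints_add) auto
    then show "n \<in> lattice_N" using a by (simp add: lattice_N_iff g_def)
  qed (auto simp: lattice_N_iff g_def)
  ultimately have "lattice_iso g" by (simp add: lattice_iso_def)
  moreover have "frame (w - u) u = frame u w \<circ> g" by (auto simp: fun_eq_iff frame_def g_def algebra_simps)
  ultimately show ?thesis using lattice_iso_comp[OF f] by simp
qed

lemma lagrangian_at_cylinder: "wco a = 1 \<Longrightarrow> lagrangian_at {a. wco a = 1} a"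
proof -
  have *: "lagrangian_at {a. wco a = 1} (of_zw z (exp (- 0)))" if "z \<noteq> 0" for z
  proof (rule lagrangian_at_graph[where \<Omega> = "- {0}" and W = UNIV and G = "\<lambda>_. 0" and H = "\<lambda>_. 0"])
    show "Ck_on k (\<lambda>_ :: complex. 0 :: complex) {u. exp u \<in> - {0}}" for k by (rule Ck_on_const)
    show "Im (D \<i>) = Re (D 1)" if "((\<lambda>_. 0 :: complex) has_derivative D) (at u)" for u D
      using has_derivative_unique[OF that has_derivative_const] by simp
  qed (use that in auto)
  show "wco a = 1 \<Longrightarrow> lagrangian_at {a. wco a = 1} a"
    using *[of "zco a"] of_zw_zco_wco[of a] by simp
qed

lemma wco_eq_1_iff: "wco a = 1 \<longleftrightarrow> (\<exists>x \<theta>. a = (vector [0, x], to_torus (vector [\<theta>, 0])))"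
proof
  assume "wco a = 1"
  then have "a = of_zw (zco a) 1" using of_zw_zco_wco[of a] by simp
  then show "\<exists>x \<theta>. a = (vector [0, x], to_torus (vector [\<theta>, 0]))"
    using Arg_of_real[of 1] by (simp add: of_zw_def) blast
qed (auto simp: wco_to_torus)

context unimodal_subdivision
begin

text \<open>The edges and triangles of the subdivision are the hulls of two or more vertices of a cell, and
  \<open>m\<close> lies on the dual face exactly if these vertices are minimizers at \<open>m\<close>. This removes faces and
  dimensions from the description.\<close>

lemma PL_lift_iff:
  "(m, t) \<in> PL_lift P \<nu> \<P> \<longleftrightarrow>
    (\<exists>Q\<in>\<P>. \<exists>X\<subseteq>verts Q. 2 \<le> card X \<and> X \<subseteq> mins m \<and> t \<in> C_cell (convex hull X))"
proof
  assume "(m, t) \<in> PL_lift P \<nu> \<P>"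
  then obtain e Q where e: "Q \<in> \<P>" "e face_of Q" "aff_dim e = 1 \<or> aff_dim e = 2"
    "m \<in> dual_face P \<nu> e" "t \<in> C_cell e"
    by (auto simp: PL_lift_def cells_def)
  obtain v0 v1 v2 where u: "unimodular_triangle v0 v1 v2" and Qe: "Q = convex hull {v0, v1, v2}"
    by (rule triangle[OF e(1)])
  interpret unimodular_triangle v0 v1 v2 by (rule u)
  obtain X where X: "X \<subseteq> {v0, v1, v2}" "e = convex hull X"
    using e(2) face_of_convex_hull_affine_independent[OF affine_independent, of e] unfolding Qe by blast
  have ind: "\<not> affine_dependent X" by (rule affine_independent_subset[OF affine_independent X(1)])
  have "int (card X) = aff_dim e + 1"
    using aff_dim_affine_independent[OF ind] by (simp add: X(2) aff_dim_convex_hull)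
  then have "2 \<le> card X" using e(3) by linarith
  moreover have Xv: "X \<subseteq> verts Q" using X verts_eq[OF u Qe] by simp
  moreover have "X \<subseteq> mins m"
    using e(4) Xv extreme_points[OF X(1)] cell_subset[OF e(1)] unfolding dual_face_def mins_def X(2) verts_def by blast
  ultimately show "\<exists>Q\<in>\<P>. \<exists>X\<subseteq>verts Q. 2 \<le> card X \<and> X \<subseteq> mins m \<and> t \<in> C_cell (convex hull X)"
    using e X by blast
next
  assume "\<exists>Q\<in>\<P>. \<exists>X\<subseteq>verts Q. 2 \<le> card X \<and> X \<subseteq> mins m \<and> t \<in> C_cell (convex hull X)"
  then obtain Q X where e: "Q \<in> \<P>" "X \<subseteq> verts Q" "2 \<le> card X" "X \<subseteq> mins m" "t \<in> C_cell (convex hull X)" by blast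
  obtain v0 v1 v2 where u: "unimodular_triangle v0 v1 v2" and Qe: "Q = convex hull {v0, v1, v2}"
    by (rule triangle[OF e(1)])
  interpret unimodular_triangle v0 v1 v2 by (rule u)
  have X: "X \<subseteq> {v0, v1, v2}" using e verts_eq[OF u Qe] by simp
  have ind: "\<not> affine_dependent X" by (rule affine_independent_subset[OF affine_independent X])
  have "card X \<le> card {v0, v1, v2}" using X by (intro card_mono) auto
  also have "\<dots> \<le> 3" by (simp add: card_insert_if)
  finally have c: "card X \<le> 3" .
  have "int (card X) = aff_dim (convex hull X) + 1"
    using aff_dim_affine_independent[OF ind] by (simp add: aff_dim_convex_hull)
  then have "aff_dim (convex hull X) \<in> {1, 2}" using e(3) c by auto
  moreover have "convex hull X \<in> cells \<P>"
    unfolding cells_def using e(1) X face_of_convex_hull_affine_independent[OF affine_independent] Qe by blast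
  moreover have "m \<in> dual_face P \<nu> (convex hull X)"
    using e(4) extreme_points[OF X] unfolding dual_face_def mins_def by blast
  ultimately show "(m, t) \<in> PL_lift P \<nu> \<P>" using e(5) unfolding PL_lift_def by blast
qed

text \<open>The functions of the vertices of \<open>Q\<close> agree at the dual vertex, so only their linear parts matter.\<close>

lemma subset_mins_iff:
  assumes Q: "Q \<in> \<P>" and sub: "mins m \<subseteq> verts Q" and X: "X \<subseteq> verts Q" "X \<noteq> {}"
  shows "X \<subseteq> mins m \<longleftrightarrow> (\<forall>v\<in>X. \<forall>w\<in>verts Q. v \<bullet> (m - dual_vertex Q) \<le> w \<bullet> (m - dual_vertex Q))"
proof -
  obtain c where c: "\<And>v. v \<in> Q \<Longrightarrow> v \<bullet> dual_vertex Q + \<nu> v = c"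
    using dual_vertex[OF Q] by metis
  have val: "v \<bullet> m + \<nu> v = c + v \<bullet> (m - dual_vertex Q)" if "v \<in> verts Q" for v
    using c[of v] that by (simp add: verts_def inner_diff_right)
  have VP: "v \<in> P" "v \<in> lattice_N" if "v \<in> verts Q" for v
    using that cell_subset[OF Q] by (auto simp: verts_def)
  show ?thesis
  proof (intro iffI ballI)
    fix v w assume vw: "X \<subseteq> mins m" "v \<in> X" "w \<in> verts Q"
    then have "v \<in> mins m" "v \<in> verts Q" using X(1) by blast+
    then have "v \<bullet> m + \<nu> v \<le> w \<bullet> m + \<nu> w"
      using legendre_le[OF VP[OF vw(3)], of m] by (simp add: mins_def)
    then show "v \<bullet> (m - dual_vertex Q) \<le> w \<bullet> (m - dual_vertex Q)"
      using val[OF \<open>v \<in> verts Q\<close>] val[OF vw(3)] by linarith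
  next
    assume le: "\<forall>v\<in>X. \<forall>w\<in>verts Q. v \<bullet> (m - dual_vertex Q) \<le> w \<bullet> (m - dual_vertex Q)"
    obtain w where w: "w \<in> mins m" using mins_nonempty[of m] Q by blast
    show "X \<subseteq> mins m"
    proof
      fix v assume v: "v \<in> X"
      have vQ: "v \<in> verts Q" and wQ: "w \<in> verts Q" using v w sub X(1) by blast+
      have "v \<bullet> m + \<nu> v \<le> w \<bullet> m + \<nu> w"
        using le v wQ val[OF vQ] val[OF wQ] by fastforce
      moreover have "w \<bullet> m + \<nu> w = legendre P \<nu> m" using w by (simp add: mins_def)
      moreover have "legendre P \<nu> m \<le> v \<bullet> m + \<nu> v" by (rule legendre_le[OF VP[OF vQ]])
      ultimately show "v \<in> mins m" using VP[OF vQ] by (simp add: mins_def)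
    qed
  qed
qed

text \<open>Near the dual vertex of \<open>Q\<close> the minimizers are vertices of \<open>Q\<close>, and in the frame of \<open>Q\<close> the four
  possibilities for two or three of them are the three legs and the two triangles of the model. The
  shift by \<open>v0 / 2\<close> comes from the factor \<open>2\<close> in the definition of the lift; it also turns the
  inversion of the torus into \<open>n \<mapsto> - n\<close> because \<open>v0\<close> is a lattice point. The model is a cone, which is
  why the scale \<open>s\<close> is arbitrary.\<close>

lemma PL_lift_at_vertex:
  assumes Q: "Q \<in> \<P>" and u: "unimodular_triangle v0 v1 v2" and Qe: "Q = convex hull {v0, v1, v2}"
    and sub: "mins m \<subseteq> verts Q" and s: "s > 0"
  shows "(m, t) \<in> PL_lift P \<nu> \<P> \<longleftrightarrow>
    (m, t) \<in> aff_map (dual_vertex Q) s (frame (v1 - v0) (v2 - v0)) ((1 / 2) *\<^sub>R v0) ` tropical_line"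
    (is "_ \<longleftrightarrow> _ \<in> ?F ` _")
proof -
  interpret unimodular_triangle v0 v1 v2 by (rule u)
  note vQ = verts_eq[OF u Qe]
  define d where "d = m - dual_vertex Q"
  define A where "A = adjoint (inv B)"
  have A: "A x \<bullet> (v1 - v0) = x $ 1" "A x \<bullet> (v2 - v0) = x $ 2" "A (vector [d \<bullet> (v1 - v0), d \<bullet> (v2 - v0)]) = d" for x
    unfolding A_def by (rule dual_frame[OF B])+
  have linA: "linear A" unfolding A_def by (rule linear_adjoint_inv[OF B])
  have F: "?F (x, to_torus n) = (dual_vertex Q + s *\<^sub>R A x, to_torus (B n + (1 / 2) *\<^sub>R v0))" for x n
    by (simp add: aff_map_to_torus[OF B] A_def)
  have min: "X \<subseteq> mins m \<longleftrightarrow> (\<forall>v\<in>X. v \<bullet> d \<le> v0 \<bullet> d \<and> v \<bullet> d \<le> v1 \<bullet> d \<and> v \<bullet> d \<le> v2 \<bullet> d)"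
    if "X \<subseteq> {v0, v1, v2}" "X \<noteq> {}" for X
    using subset_mins_iff[OF Q sub] that unfolding vQ d_def by simp
  have x: "d \<bullet> (v1 - v0) = v1 \<bullet> d - v0 \<bullet> d" "d \<bullet> (v2 - v0) = v2 \<bullet> d - v0 \<bullet> d"
    by (simp_all add: inner_diff_right inner_commute)
  have m: "m = dual_vertex Q + s *\<^sub>R A (vector [(v1 \<bullet> d - v0 \<bullet> d) / s, (v2 \<bullet> d - v0 \<bullet> d) / s])"
  proof -
    have "vector [(v1 \<bullet> d - v0 \<bullet> d) / s, (v2 \<bullet> d - v0 \<bullet> d) / s] = (1 / s) *\<^sub>R (vector [d \<bullet> (v1 - v0), d \<bullet> (v2 - v0)] :: MR)"
      by (simp add: x vec_eq_iff forall_2)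
    then have "s *\<^sub>R A (vector [(v1 \<bullet> d - v0 \<bullet> d) / s, (v2 \<bullet> d - v0 \<bullet> d) / s]) = d"
      using A(3) s by (simp add: linear_cmul[OF linA])
    then show ?thesis by (simp add: d_def)
  qed
  have Cx: "C_cell (convex hull {v0, v1}) = range (\<lambda>\<theta>. to_torus (B (vector [\<theta>, 0]) + (1 / 2) *\<^sub>R v0))"
    "C_cell (convex hull {v0, v2}) = range (\<lambda>\<theta>. to_torus (B (vector [0, \<theta>]) + (1 / 2) *\<^sub>R v0))"
    using C_cell_edge[of v0 v1] C_cell_edge[of v0 v2] lattice distinct by (simp_all add: frame_def add.commute)
  have e12: "B (vector [\<theta>, 1 / 2 - \<theta>]) + (1 / 2) *\<^sub>R v0 = (1 / 2) *\<^sub>R v2 + \<theta> *\<^sub>R (v1 - v2)" for \<theta>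
    by (simp add: frame_def vec_eq_iff field_simps)
  have C12: "C_cell (convex hull {v1, v2}) = range (\<lambda>\<theta>. to_torus (B (vector [\<theta>, 1 / 2 - \<theta>]) + (1 / 2) *\<^sub>R v0))"
    using C_cell_edge[of v2 v1] lattice distinct unfolding e12 by (simp add: insert_commute)
  have neg: "- to_torus (B n + (1 / 2) *\<^sub>R v0) = to_torus (B (- n) + (1 / 2) *\<^sub>R v0)" for n
    unfolding uminus_to_torus
  proof (rule to_torus_cong)
    have "- (B n + (1 / 2) *\<^sub>R v0) - (B (- n) + (1 / 2) *\<^sub>R v0) = - v0"
      by (simp add: linear_neg[OF linear_frame] vec_eq_iff)
    then show "- (B n + (1 / 2) *\<^sub>R v0) - (B (- n) + (1 / 2) *\<^sub>R v0) \<in> lattice_N"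
      using lattice_N_minus[OF lattice(1)] by simp
  qed
  show ?thesis
  proof
    assume "(m, t) \<in> PL_lift P \<nu> \<P>"
    then obtain Q' X where X0: "Q' \<in> \<P>" "X \<subseteq> verts Q'" "2 \<le> card X" "X \<subseteq> mins m" "t \<in> C_cell (convex hull X)"
      unfolding PL_lift_iff by blast
    have X: "X \<subseteq> {v0, v1, v2}" using X0(4) sub vQ by simp
    have "X \<noteq> {}" using X0(3) by auto
    note le = X0(4)[unfolded min[OF X this]]
    have "\<not> X \<subseteq> {x}" for x using X0(3) card_mono[of "{x}" X] by auto
    then consider "X = {v0, v1}" | "X = {v0, v2}" | "X = {v1, v2}" | "X = {v0, v1, v2}"
      using X by blast
    then show "(m, t) \<in> ?F ` tropical_line"
    proof cases
      case 1
      then obtain \<theta> where "t = to_torus (B (vector [\<theta>, 0]) + (1 / 2) *\<^sub>R v0)" using X0(5) Cx by auto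
      moreover have "v1 \<bullet> d - v0 \<bullet> d = 0" "0 \<le> (v2 \<bullet> d - v0 \<bullet> d) / s" using le 1 s by auto
      ultimately have "(m, t) = ?F (vector [0, (v2 \<bullet> d - v0 \<bullet> d) / s], to_torus (vector [\<theta>, 0]))"
        unfolding F using m by simp
      moreover have "(vector [0, (v2 \<bullet> d - v0 \<bullet> d) / s], to_torus (vector [\<theta>, 0])) \<in> tropical_line"
        unfolding tropical_line_def using \<open>0 \<le> (v2 \<bullet> d - v0 \<bullet> d) / s\<close> by blast
      ultimately show ?thesis by (metis imageI)
    next
      case 2
      then obtain \<theta> where "t = to_torus (B (vector [0, \<theta>]) + (1 / 2) *\<^sub>R v0)" using X0(5) Cx by auto
      moreover have "v2 \<bullet> d - v0 \<bullet> d = 0" "0 \<le> (v1 \<bullet> d - v0 \<bullet> d) / s" using le 2 s by auto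
      ultimately have "(m, t) = ?F (vector [(v1 \<bullet> d - v0 \<bullet> d) / s, 0], to_torus (vector [0, \<theta>]))"
        unfolding F using m by simp
      moreover have "(vector [(v1 \<bullet> d - v0 \<bullet> d) / s, 0], to_torus (vector [0, \<theta>])) \<in> tropical_line"
        unfolding tropical_line_def using \<open>0 \<le> (v1 \<bullet> d - v0 \<bullet> d) / s\<close> by blast
      ultimately show ?thesis by (metis imageI)
    next
      case 3
      then obtain \<theta> where t: "t = to_torus (B (vector [\<theta>, 1 / 2 - \<theta>]) + (1 / 2) *\<^sub>R v0)" using X0(5) C12 by auto
      define y where "y = (v0 \<bullet> d - v1 \<bullet> d) / s"
      have "v2 \<bullet> d = v1 \<bullet> d" "v1 \<bullet> d \<le> v0 \<bullet> d" using le 3 by auto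
      then have y: "(v1 \<bullet> d - v0 \<bullet> d) / s = - y" "(v2 \<bullet> d - v0 \<bullet> d) / s = - y" "0 \<le> y"
        using s by (simp_all add: y_def field_simps)
      have "(m, t) = ?F (vector [- y, - y], to_torus (vector [\<theta>, 1 / 2 - \<theta>]))"
        unfolding F t using m unfolding y by simp
      moreover have "(vector [- y, - y], to_torus (vector [\<theta>, 1 / 2 - \<theta>])) \<in> tropical_line"
        unfolding tropical_line_def using y(3) by blast
      ultimately show ?thesis by (metis imageI)
    next
      case 4
      then have "v1 \<bullet> d - v0 \<bullet> d = 0" "v2 \<bullet> d - v0 \<bullet> d = 0" using le by auto
      then have m0: "m = dual_vertex Q" using m linear_0[OF linA] by (simp add: vec2_zero)
      have F0: "?F (0, to_torus n) = (m, to_torus (B n + (1 / 2) *\<^sub>R v0))" for n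
        unfolding F m0 by (simp add: linear_0[OF linA])
      have "C_cell (convex hull X) \<subseteq> {t. (m, t) \<in> ?F ` tropical_line}"
      proof (rule C_cell_subset[OF refl])
        fix p assume "p \<in> convex hull X"
        then obtain n where n: "p = v0 + B n" "0 \<le> n $ 1" "0 \<le> n $ 2" "n $ 1 + n $ 2 \<le> 1"
          unfolding 4 hull_eq by blast
        define n' where "n' = (1 / 2) *\<^sub>R n"
        have "n' \<in> tri" using n by (simp add: n'_def tri_def)
        then have tl: "(0, to_torus n') \<in> tropical_line" "(0, to_torus (- n')) \<in> tropical_line"
          unfolding tropical_line_def by auto
        have p: "(1 / 2) *\<^sub>R p = B n' + (1 / 2) *\<^sub>R v0"
          unfolding n(1) n'_def linear_cmul[OF linear_frame] by (simp add: algebra_simps)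
        have "(m, to_torus (B n' + (1 / 2) *\<^sub>R v0)) \<in> ?F ` tropical_line"
          using imageI[OF tl(1), of ?F] unfolding F0 .
        moreover have "(m, to_torus (B (- n') + (1 / 2) *\<^sub>R v0)) \<in> ?F ` tropical_line"
          using imageI[OF tl(2), of ?F] unfolding F0 .
        ultimately show "to_torus ((1 / 2) *\<^sub>R p) \<in> {t. (m, t) \<in> ?F ` tropical_line}"
          "- to_torus ((1 / 2) *\<^sub>R p) \<in> {t. (m, t) \<in> ?F ` tropical_line}"
          unfolding p neg mem_Collect_eq .
      qed
      then show ?thesis using X0(5) by blast
    qed
  next
    assume "(m, t) \<in> ?F ` tropical_line"
    then obtain a where a: "a \<in> tropical_line" "?F a = (m, t)" by (rule imageE) (rule that, simp_all only:)
    have key: "(m, t) \<in> PL_lift P \<nu> \<P>"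
      if "X \<subseteq> {v0, v1, v2}" "2 \<le> card X" "\<forall>v\<in>X. v \<bullet> d \<le> v0 \<bullet> d \<and> v \<bullet> d \<le> v1 \<bullet> d \<and> v \<bullet> d \<le> v2 \<bullet> d"
        "t \<in> C_cell (convex hull X)" for X
      unfolding PL_lift_iff using Q that min[OF that(1)] vQ by (intro bexI[of _ Q] exI[of _ X]) auto
    have vd: "v1 \<bullet> d - v0 \<bullet> d = s * y $ 1" "v2 \<bullet> d - v0 \<bullet> d = s * y $ 2" if "d = s *\<^sub>R A y" for y
      unfolding x[symmetric] unfolding that by (simp_all only: inner_scaleR_left A)
    have card: "2 \<le> card {v0, v1}" "2 \<le> card {v0, v2}" "2 \<le> card {v1, v2}" "2 \<le> card {v0, v1, v2}"
      using distinct by auto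
    consider y \<theta> where "0 \<le> y" "a = (vector [0, y], to_torus (vector [\<theta>, 0]))"
      | y \<theta> where "0 \<le> y" "a = (vector [y, 0], to_torus (vector [0, \<theta>]))"
      | y \<theta> where "0 \<le> y" "a = (vector [- y, - y], to_torus (vector [\<theta>, 1 / 2 - \<theta>]))"
      | n where "n \<in> tri" "a = (0, to_torus n) \<or> a = (0, to_torus (- n))"
      using a(1) unfolding tropical_line_def by auto
    then show "(m, t) \<in> PL_lift P \<nu> \<P>"
    proof cases
      case 1
      have d: "d = s *\<^sub>R A (vector [0, y])" and t: "t = to_torus (B (vector [\<theta>, 0]) + (1 / 2) *\<^sub>R v0)"
        using a(2) unfolding 1(2) F d_def by auto
      have "v1 \<bullet> d - v0 \<bullet> d = 0" "v2 \<bullet> d - v0 \<bullet> d = s * y" using vd[OF d] by simp_all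
      moreover have "0 \<le> s * y" using 1(1) s by simp
      ultimately show ?thesis
      proof (intro key[of "{v0, v1}"])
        show "t \<in> C_cell (convex hull {v0, v1})" unfolding Cx t by (rule rangeI)
      qed (use card in simp_all)
    next
      case 2
      have d: "d = s *\<^sub>R A (vector [y, 0])" and t: "t = to_torus (B (vector [0, \<theta>]) + (1 / 2) *\<^sub>R v0)"
        using a(2) unfolding 2(2) F d_def by auto
      have "v1 \<bullet> d - v0 \<bullet> d = s * y" "v2 \<bullet> d - v0 \<bullet> d = 0" using vd[OF d] by simp_all
      moreover have "0 \<le> s * y" using 2(1) s by simp
      ultimately show ?thesis
      proof (intro key[of "{v0, v2}"])
        show "t \<in> C_cell (convex hull {v0, v2})" unfolding Cx t by (rule rangeI)
      qed (use card in simp_all)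
    next
      case 3
      have d: "d = s *\<^sub>R A (vector [- y, - y])" and t: "t = to_torus (B (vector [\<theta>, 1 / 2 - \<theta>]) + (1 / 2) *\<^sub>R v0)"
        using a(2) unfolding 3(2) F d_def by auto
      have "v1 \<bullet> d - v0 \<bullet> d = - (s * y)" "v2 \<bullet> d - v0 \<bullet> d = - (s * y)" using vd[OF d] by simp_all
      moreover have "0 \<le> s * y" using 3(1) s by simp
      ultimately show ?thesis
      proof (intro key[of "{v1, v2}"])
        show "t \<in> C_cell (convex hull {v1, v2})" unfolding C12 t by (rule rangeI)
      qed (use card in simp_all)
    next
      case 4
      have d0: "d = 0" using a(2) 4(2) by (auto simp: F d_def linear_0[OF linA])
      define \<tau> where "\<tau> = to_torus (B n + (1 / 2) *\<^sub>R v0)"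
      have t: "t = \<tau> \<or> t = - \<tau>"
        using a(2) 4(2) unfolding \<tau>_def neg by (auto simp: F)
      have "\<exists>X. X \<subseteq> {v0, v1, v2} \<and> 2 \<le> card X \<and> \<tau> \<in> C_cell (convex hull X)"
      proof -
        have n: "0 \<le> n $ 1" "0 \<le> n $ 2" "n $ 1 + n $ 2 \<le> 1 / 2" using 4(1) by (auto simp: tri_def)
        consider "n $ 2 = 0" | "n $ 1 = 0" | "n $ 1 + n $ 2 = 1 / 2" | "0 < n $ 1" "0 < n $ 2" "n $ 1 + n $ 2 < 1 / 2"
          using n by linarith
        then show ?thesis
        proof cases
          case 1
          then have n: "n = vector [n $ 1, 0]" by (simp add: vec_eq_iff forall_2)
          have "\<tau> \<in> C_cell (convex hull {v0, v1})"
            unfolding Cx \<tau>_def by (subst n) (rule rangeI)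
          then show ?thesis using card by (intro exI[of _ "{v0, v1}"]) simp
        next
          case 2
          then have n: "n = vector [0, n $ 2]" by (simp add: vec_eq_iff forall_2)
          have "\<tau> \<in> C_cell (convex hull {v0, v2})"
            unfolding Cx \<tau>_def by (subst n) (rule rangeI)
          then show ?thesis using card by (intro exI[of _ "{v0, v2}"]) simp
        next
          case 3
          then have n: "n = vector [n $ 1, 1 / 2 - n $ 1]" by (simp add: vec_eq_iff forall_2)
          have "\<tau> \<in> C_cell (convex hull {v1, v2})"
            unfolding C12 \<tau>_def by (subst n) (rule rangeI)
          then show ?thesis using card by (intro exI[of _ "{v1, v2}"]) simp
        next
          case 4
          have h: "(1 / 2) *\<^sub>R (v0 + 2 *\<^sub>R B n) = B n + (1 / 2) *\<^sub>R v0" by (simp add: algebra_simps)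
          have "\<tau> \<in> C_plus (convex hull {v0, v1, v2})"
            using C_plusI[OF disjI2[OF interior_B_tri[OF 4]]] unfolding h \<tau>_def .
          then have "\<tau> \<in> C_cell (convex hull {v0, v1, v2})" unfolding C_cell_def by (rule UnI1)
          then show ?thesis using card by (intro exI[of _ "{v0, v1, v2}"]) simp
        qed
      qed
      then obtain X where X: "X \<subseteq> {v0, v1, v2}" "2 \<le> card X" "\<tau> \<in> C_cell (convex hull X)" by blast
      then have "t \<in> C_cell (convex hull X)" using t C_cell_uminus[OF X(3)] by (elim disjE) simp_all
      then show ?thesis using X by (intro key[of X]) (auto simp: d0)
    qed
  qed
qed

text \<open>Away from the vertices only two functions compete, and the lift is locally the product of the
  segment on which they agree with a circle in the dual direction, a flat cylinder.\<close>

lemma lagrangian_at_PL_lift: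
  assumes p: "(m, t) \<in> PL_lift P \<nu> \<P>" and m: "\<And>Q. Q \<in> \<P> \<Longrightarrow> m \<noteq> dual_vertex Q"
  shows "lagrangian_at (PL_lift P \<nu> \<P>) (m, t)"
proof -
  obtain Q X where Q: "Q \<in> \<P>" "X \<subseteq> verts Q" "2 \<le> card X" "X \<subseteq> mins m" "t \<in> C_cell (convex hull X)"
    using p unfolding PL_lift_iff by blast
  obtain v0 v1 v2 where u: "unimodular_triangle v0 v1 v2" and Qe: "Q = convex hull {v0, v1, v2}"
    by (rule triangle[OF Q(1)])
  interpret unimodular_triangle v0 v1 v2 by (rule u)
  note vQ = verts_eq[OF u Qe]
  have "\<not> X \<subseteq> {x}" for x using Q(3) card_mono[of "{x}" X] by auto
  then consider "v0 \<in> X" "v1 \<in> X" | "v0 \<in> X" "v2 \<in> X" | "v1 \<in> X" "v2 \<in> X"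
    using Q(2) unfolding vQ by blast
  then obtain v w c where vw: "v \<in> X" "w \<in> X" "v \<noteq> w" "lattice_iso (frame (w - v) c)"
  proof cases
    case 1
    then show thesis using that[of v0 v1 "v2 - v0"] distinct B by simp
  next
    case 2
    then show thesis using that[of v0 v2 "v1 - v0"] distinct lattice_iso_swap[OF B] by simp
  next
    case 3
    then show thesis using that[of v1 v2 "v1 - v0"] distinct lattice_iso_third[OF B] by simp
  qed
  have mins: "mins m = {v, w}" using Q vw m by (intro mins_edge[OF Q(1)]) auto
  have Xe: "X = {v, w}" using Q(4) mins vw by blast
  have lat: "v \<in> lattice_N" "w \<in> lattice_N" using Q(2) vw by (auto simp: verts_def)
  have PN: "v \<in> P \<inter> lattice_N" "w \<in> P \<inter> lattice_N" using mins by (auto simp: mins_def)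
  have ne: "\<P> \<noteq> {}" using Q by blast
  obtain \<delta> where \<delta>: "\<delta> > 0" "\<And>m'. dist m' m < \<delta> \<Longrightarrow> mins m' \<subseteq> mins m"
    using mins_upper_semicontinuous[OF ne] by blast
  define F where "F = aff_map m 1 (frame (w - v) c) ((1 / 2) *\<^sub>R v)"
  define A where "A = adjoint (inv (frame (w - v) c))"
  have F: "F (x, to_torus n) = (m + A x, to_torus (frame (w - v) c n + (1 / 2) *\<^sub>R v))" for x n
    by (simp add: F_def aff_map_to_torus[OF vw(4)] A_def)
  have Fcyl: "a \<in> F ` {a. wco a = 1} \<longleftrightarrow> (fst a - m) \<bullet> (w - v) = 0 \<and> snd a \<in> C_cell (convex hull {v, w})" for a
  proof
    assume "a \<in> F ` {a. wco a = 1}"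
    then obtain y \<theta> where "a = F (vector [0, y], to_torus (vector [\<theta>, 0]))" by (auto simp: wco_eq_1_iff)
    then show "(fst a - m) \<bullet> (w - v) = 0 \<and> snd a \<in> C_cell (convex hull {v, w})"
      using dual_frame(1)[OF vw(4)] C_cell_edge[OF lat vw(3)]
      by (auto simp: F A_def frame_def add.commute)
  next
    assume a: "(fst a - m) \<bullet> (w - v) = 0 \<and> snd a \<in> C_cell (convex hull {v, w})"
    then obtain \<theta> where "snd a = to_torus ((1 / 2) *\<^sub>R v + \<theta> *\<^sub>R (w - v))" using C_cell_edge[OF lat vw(3)] by auto
    then have "a = F (vector [0, (fst a - m) \<bullet> c], to_torus (vector [\<theta>, 0]))"
      using a dual_frame(3)[OF vw(4), of "fst a - m"] unfolding F A_def[symmetric]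
      by (simp add: prod_eq_iff frame_def add.commute)
    moreover have "(vector [0, (fst a - m) \<bullet> c], to_torus (vector [\<theta>, 0])) \<in> {a. wco a = 1}"
      unfolding mem_Collect_eq wco_eq_1_iff by blast
    ultimately show "a \<in> F ` {a. wco a = 1}" by (rule image_eqI)
  qed
  define V where "V = {a :: MR \<times> torus. dist (fst a) m < \<delta>}"
  have "open V" unfolding V_def by (intro open_Collect_less continuous_intros)
  have iffV: "a \<in> PL_lift P \<nu> \<P> \<longleftrightarrow> a \<in> F ` {a. wco a = 1}" if a: "a \<in> V" for a
  proof -
    obtain m' t' where a': "a = (m', t')" by (cases a)
    have sub: "mins m' \<subseteq> {v, w}" using \<delta>(2)[of m'] a a' mins by (simp add: V_def)
    have "v \<in> mins m" "w \<in> mins m" unfolding mins by simp_all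
    then have val: "v \<bullet> m + \<nu> v = w \<bullet> m + \<nu> w" by (simp add: mins_def)
    have iff: "{v, w} \<subseteq> mins m' \<longleftrightarrow> (m' - m) \<bullet> (w - v) = 0"
    proof -
      have e: "(m' - m) \<bullet> (w - v) = (w \<bullet> m' + \<nu> w) - (v \<bullet> m' + \<nu> v)"
        using val by (simp add: inner_diff_left inner_diff_right inner_commute)
      obtain x where x: "x \<in> mins m'" using mins_nonempty[OF ne] by blast
      show ?thesis unfolding e
      proof
        assume "w \<bullet> m' + \<nu> w - (v \<bullet> m' + \<nu> v) = 0"
        then show "{v, w} \<subseteq> mins m'" using x sub PN by (auto simp: mins_def)
      qed (auto simp: mins_def)
    qed
    have "(m', t') \<in> PL_lift P \<nu> \<P> \<longleftrightarrow> {v, w} \<subseteq> mins m' \<and> t' \<in> C_cell (convex hull {v, w})"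
    proof
      assume "(m', t') \<in> PL_lift P \<nu> \<P>"
      then obtain Y where Y: "2 \<le> card Y" "Y \<subseteq> mins m'" "t' \<in> C_cell (convex hull Y)"
        unfolding PL_lift_iff by blast
      have "\<not> Y \<subseteq> {x}" for x using Y(1) card_mono[of "{x}" Y] by auto
      then have "Y = {v, w}" using Y(2) sub by blast
      then show "{v, w} \<subseteq> mins m' \<and> t' \<in> C_cell (convex hull {v, w})" using Y by blast
    next
      assume "{v, w} \<subseteq> mins m' \<and> t' \<in> C_cell (convex hull {v, w})"
      then show "(m', t') \<in> PL_lift P \<nu> \<P>"
        unfolding PL_lift_iff using Q Xe by blast
    qed
    then show ?thesis unfolding a' Fcyl iff by simp
  qed
  have loc: "F ` {a. wco a = 1} \<inter> V = PL_lift P \<nu> \<P> \<inter> V"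
    unfolding set_eq_iff Int_iff by (intro allI rev_conj_cong refl iffV[symmetric])
  have pV: "(m, t) \<in> V" using \<delta>(1) by (simp add: V_def)
  then have "(m, t) \<in> F ` {a. wco a = 1}" using p loc by blast
  then obtain a where a: "wco a = 1" "(m, t) = F a" by blast
  have "lagrangian_at (F ` {a. wco a = 1}) (F a)"
    unfolding F_def by (rule lagrangian_at_aff_map[OF lagrangian_at_cylinder[OF a(1)] vw(4)]) simp
  then show ?thesis using lagrangian_at_local[OF _ \<open>open V\<close> pV loc] a(2) by simp
qed

end

section \<open>Gluing\<close>

text \<open>The local homeomorphisms are the identity near the boundary of their domains \<open>V i\<close>, so they can be
  continued by the identity.\<close>

lemma homeomorphic_patch:
  fixes L L' :: "'a::t2_space set" and V K :: "'i \<Rightarrow> 'a set"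
  assumes V: "\<And>i. i \<in> I \<Longrightarrow> open (V i)" "\<And>i j. i \<in> I \<Longrightarrow> j \<in> I \<Longrightarrow> i \<noteq> j \<Longrightarrow> V i \<inter> V j = {}"
    and K: "closed (\<Union>i\<in>I. K i)" "\<And>i. i \<in> I \<Longrightarrow> K i \<subseteq> V i"
    and off: "L - (\<Union>i\<in>I. K i) = L' - (\<Union>i\<in>I. K i)"
    and hk: "\<And>i. i \<in> I \<Longrightarrow> homeomorphism (L \<inter> V i) (L' \<inter> V i) (h i) (k i)"
    and id: "\<And>i x. i \<in> I \<Longrightarrow> x \<in> L \<inter> V i - K i \<Longrightarrow> h i x = x"
  shows "L homeomorphic L'"
proof -
  define glue :: "('i \<Rightarrow> 'a \<Rightarrow> 'a) \<Rightarrow> 'a \<Rightarrow> 'a"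
    where "glue f x = (if \<exists>i\<in>I. x \<in> V i then f (THE i. i \<in> I \<and> x \<in> V i) x else x)" for f x
  have the: "(THE j. j \<in> I \<and> x \<in> V j) = i" if "i \<in> I" "x \<in> V i" for i x
    using that V(2) by (intro the_equality) blast+
  have in_V: "glue f x = f i x" if "i \<in> I" "x \<in> V i" for f i x
    using that the[OF that] by (auto simp: glue_def)
  have out_V: "glue f x = x" if "\<And>i. i \<in> I \<Longrightarrow> x \<notin> V i" for f x
    using that by (auto simp: glue_def)
  have main: "continuous_on M (glue f)" "\<And>x. x \<in> M \<Longrightarrow> glue f x \<in> M'"
    "\<And>x. x \<in> M \<Longrightarrow> glue g (glue f x) = x"
    if off: "M - (\<Union>i\<in>I. K i) = M' - (\<Union>i\<in>I. K i)"
      and fg: "\<And>i. i \<in> I \<Longrightarrow> homeomorphism (M \<inter> V i) (M' \<inter> V i) (f i) (g i)"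
      and id: "\<And>i x. i \<in> I \<Longrightarrow> x \<in> M \<inter> V i - K i \<Longrightarrow> f i x = x" for M M' f g
  proof -
    have id': "glue f x = x" if "x \<in> M" "x \<notin> (\<Union>i\<in>I. K i)" for x
    proof (cases "\<exists>i\<in>I. x \<in> V i")
      case True
      then obtain i where "i \<in> I" "x \<in> V i" by blast
      then show ?thesis using in_V id that by auto
    qed (simp add: glue_def)
    show "continuous_on M (glue f)"
      unfolding continuous_on_eq_continuous_within
    proof
      fix x assume x: "x \<in> M"
      show "continuous (at x within M) (glue f)"
      proof (cases "x \<in> (\<Union>i\<in>I. K i)")
        case True
        then obtain i where i: "i \<in> I" "x \<in> V i" using K(2) by blast
        have "continuous_on (M \<inter> V i) (glue f)"
          using homeomorphism_cont1[OF fg[OF i(1)]] in_V[OF i(1)]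
          by (subst continuous_on_cong[OF refl]) auto
        then have "continuous (at x within (M \<inter> V i)) (glue f)"
          using x i by (auto simp: continuous_on_eq_continuous_within)
        moreover have "at x within (M \<inter> V i) = at x within M"
          using at_within_nhd[OF i(2) V(1)[OF i(1)], of M "M \<inter> V i"] by (simp add: Int_ac)
        ultimately show ?thesis by simp
      next
        case False
        define U where "U = - (\<Union>i\<in>I. K i)"
        have "open U" unfolding U_def by (rule open_Compl[OF K(1)])
        have "x \<in> U" using False by (simp add: U_def)
        have "continuous_on (M \<inter> U) (glue f)"
          using id' by (subst continuous_on_cong[OF refl, of _ _ "\<lambda>x. x"]) (auto simp: U_def intro: continuous_on_id)
        then have "continuous (at x within (M \<inter> U)) (glue f)"
          using x \<open>x \<in> U\<close> by (auto simp: continuous_on_eq_continuous_within)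
        moreover have "at x within (M \<inter> U) = at x within M"
          using at_within_nhd[OF \<open>x \<in> U\<close> \<open>open U\<close>, of M "M \<inter> U"] by (simp add: Int_ac)
        ultimately show ?thesis by simp
      qed
    qed
    fix x assume x: "x \<in> M"
    show "glue f x \<in> M'" "glue g (glue f x) = x"
    proof -
      have "glue f x \<in> M' \<and> glue g (glue f x) = x"
      proof (cases "\<exists>i\<in>I. x \<in> V i")
        case True
        then obtain i where i: "i \<in> I" "x \<in> V i" by blast
        have xi: "x \<in> M \<inter> V i" using x i by blast
        have "f i x \<in> M' \<inter> V i" using homeomorphism_image1[OF fg[OF i(1)]] xi by blast
        then show ?thesis
          using in_V[OF i] in_V[OF i(1), of "f i x"] homeomorphism_apply1[OF fg[OF i(1)] xi] by simp
      next
        case False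
        then have "x \<notin> (\<Union>i\<in>I. K i)" using K(2) by blast
        then have "x \<in> M'" using off x by blast
        moreover have "glue f x = x" for f by (rule out_V) (use False in blast)
        ultimately show ?thesis by simp
      qed
      then show "glue f x \<in> M'" "glue g (glue f x) = x" by auto
    qed
  qed
  have id_k: "k i y = y" if iy: "i \<in> I" "y \<in> L' \<inter> V i - K i" for i y
  proof -
    have "y \<notin> (\<Union>i\<in>I. K i)" using iy V(2) K(2) by blast
    then have y: "y \<in> L \<inter> V i - K i" using off iy by blast
    show ?thesis using id[OF iy(1) y] homeomorphism_apply1[OF hk[OF iy(1)], of y] y by simp
  qed
  have h: "\<And>x. x \<in> L \<Longrightarrow> glue h x \<in> L'" "\<And>x. x \<in> L \<Longrightarrow> glue k (glue h x) = x"
    by (rule main(2)[OF off hk id], assumption+) (rule main(3)[OF off hk id], assumption+)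
  have k: "\<And>x. x \<in> L' \<Longrightarrow> glue k x \<in> L" "\<And>x. x \<in> L' \<Longrightarrow> glue h (glue k x) = x"
    by (rule main(2)[OF off[symmetric] homeomorphism_symD[OF hk] id_k], assumption+)
      (rule main(3)[OF off[symmetric] homeomorphism_symD[OF hk] id_k], assumption+)
  have "homeomorphism L L' (glue h) (glue k)"
  proof (rule homeomorphismI)
    show "continuous_on L (glue h)" by (rule main(1)[OF off hk id])
    show "continuous_on L' (glue k)" by (rule main(1)[OF off[symmetric] homeomorphism_symD[OF hk] id_k])
    show "glue h ` L \<subseteq> L'" using h(1) by (rule image_subsetI)
    show "glue k ` L' \<subseteq> L" using k(1) by (rule image_subsetI)
  qed (use h(2) k(2) in auto)
  then show ?thesis unfolding homeomorphic_def by blast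
qed

text \<open>A lattice isomorphism descends to a Lipschitz map of the torus.\<close>

lemma dist_snd_aff_map:
  assumes B: "lattice_iso B" and C: "\<And>x. norm (B x) \<le> C * norm x" "0 \<le> C"
  shows "dist (snd (aff_map c s B b a)) (snd (aff_map c s B b a')) \<le> C * dist (snd a) (snd a')"
proof -
  obtain m n where a: "a = (m, to_torus n)" by (metis surj_pair to_torus_rep)
  obtain m' n' where a': "a' = (m', to_torus n')" by (metis surj_pair to_torus_rep)
  obtain l where l: "l \<in> lattice_N" "infdist (n - n') lattice_N = norm (n - n' - l)"
    using infdist_lattice_attained by blast
  have lin: "linear B" using B by (simp add: lattice_iso_def)
  have Bl: "B l \<in> lattice_N" using B l by (simp add: lattice_iso_def)
  have "dist (snd (aff_map c s B b a)) (snd (aff_map c s B b a')) = infdist (B n - B n') lattice_N"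
    unfolding a a' by (simp add: aff_map_to_torus[OF B] dist_torus.abs_eq)
  also have "\<dots> \<le> dist (B n - B n') (B l)" by (rule infdist_le[OF Bl])
  also have "\<dots> = norm (B (n - n' - l))" by (simp add: dist_norm linear_diff[OF lin])
  also have "\<dots> \<le> C * norm (n - n' - l)" by (rule C(1))
  also have "norm (n - n' - l) = dist (snd a) (snd a')" unfolding a a' by (simp add: dist_torus.abs_eq l)
  finally show ?thesis .
qed

lemma dist_prod_le: "dist (a :: MR \<times> torus) b \<le> dist (fst a) (fst b) + dist (snd a) (snd b)"
  unfolding dist_prod_def by (rule sqrt_sum_squares_le_sum) simp_all

context unimodal_subdivision
begin

text \<open>There are finitely many cells and their dual vertices are distinct, so one radius serves all.\<close>

lemma separating_radius:
  obtains \<rho> where "\<rho> > 0"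
    "\<And>Q m. Q \<in> \<P> \<Longrightarrow> dist m (dual_vertex Q) < 2 * \<rho> \<Longrightarrow> mins m \<subseteq> verts Q"
    "\<And>Q Q'. Q \<in> \<P> \<Longrightarrow> Q' \<in> \<P> \<Longrightarrow> Q \<noteq> Q' \<Longrightarrow> 4 * \<rho> \<le> dist (dual_vertex Q) (dual_vertex Q')"
proof -
  have "\<exists>d. d > 0 \<and> (\<forall>m. dist m (dual_vertex Q) < d \<longrightarrow> mins m \<subseteq> verts Q)" if Q: "Q \<in> \<P>" for Q
  proof -
    have "\<P> \<noteq> {}" using Q by blast
    obtain \<delta> where \<delta>: "\<delta> > 0" "\<And>m. dist m (dual_vertex Q) < \<delta> \<Longrightarrow> mins m \<subseteq> mins (dual_vertex Q)"
      by (rule mins_upper_semicontinuous[OF \<open>\<P> \<noteq> {}\<close>]) (rule that)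
    show ?thesis
      by (rule exI[of _ \<delta>]) (use \<delta> mins_dual_vertex[OF Q] in simp)
  qed
  then obtain d where d: "\<And>Q. Q \<in> \<P> \<Longrightarrow> d Q > 0 \<and> (\<forall>m. dist m (dual_vertex Q) < d Q \<longrightarrow> mins m \<subseteq> verts Q)"
    by metis
  define S where "S = insert 1 ((\<lambda>Q. d Q / 2) ` \<P> \<union>
    {dist (dual_vertex Q) (dual_vertex Q') / 4 | Q Q'. Q \<in> \<P> \<and> Q' \<in> \<P> \<and> Q \<noteq> Q'})"
  have "finite {dist (dual_vertex Q) (dual_vertex Q') / 4 | Q Q'. Q \<in> \<P> \<and> Q' \<in> \<P> \<and> Q \<noteq> Q'}"
    by (rule finite_subset[of _ "(\<lambda>(Q, Q'). dist (dual_vertex Q) (dual_vertex Q') / 4) ` (\<P> \<times> \<P>)"])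
      (force, use finite_cells in simp)
  then have fin: "finite S" using finite_cells by (simp add: S_def)
  have pos: "0 < x" if "x \<in> S" for x
  proof -
    consider "x = 1" | Q where "Q \<in> \<P>" "x = d Q / 2"
      | Q Q' where "Q \<in> \<P>" "Q' \<in> \<P>" "Q \<noteq> Q'" "x = dist (dual_vertex Q) (dual_vertex Q') / 4"
      using \<open>x \<in> S\<close> unfolding S_def by blast
    then show ?thesis
    proof cases
      case 2
      then show ?thesis using d[of Q] by simp
    next
      case 3
      then have "dual_vertex Q \<noteq> dual_vertex Q'" using dual_vertex_inj by blast
      then show ?thesis unfolding 3(4) by simp
    qed simp
  qed
  have le: "Min S \<le> x" if "x \<in> S" for x using fin that by simp
  have "Min S \<in> S" using fin by (intro Min_in) (auto simp: S_def)
  show thesis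
  proof (rule that[of "Min S"])
    show "Min S > 0" using pos \<open>Min S \<in> S\<close> by blast
    show "mins m \<subseteq> verts Q" if "Q \<in> \<P>" "dist m (dual_vertex Q) < 2 * Min S" for Q m
    proof -
      have "Min S \<le> d Q / 2" by (rule le, unfold S_def) (use that(1) in blast)
      then show ?thesis using d[OF that(1)] that(2) by auto
    qed
    show "4 * Min S \<le> dist (dual_vertex Q) (dual_vertex Q')" if "Q \<in> \<P>" "Q' \<in> \<P>" "Q \<noteq> Q'" for Q Q'
    proof -
      have "Min S \<le> dist (dual_vertex Q) (dual_vertex Q') / 4" by (rule le, unfold S_def) (use that in blast)
      then show ?thesis by simp
    qed
  qed
qed

lemma vertex_charts:
  obtains B b C where
    "\<And>Q. Q \<in> \<P> \<Longrightarrow> lattice_iso (B Q)" "C > 0"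
    "\<And>Q x. Q \<in> \<P> \<Longrightarrow> norm (B Q x) \<le> C * norm x"
    "\<And>Q x. Q \<in> \<P> \<Longrightarrow> norm (adjoint (inv (B Q)) x) \<le> C * norm x"
    "\<And>Q s m t. Q \<in> \<P> \<Longrightarrow> s > 0 \<Longrightarrow> mins m \<subseteq> verts Q \<Longrightarrow>
      (m, t) \<in> PL_lift P \<nu> \<P> \<longleftrightarrow> (m, t) \<in> aff_map (dual_vertex Q) s (B Q) (b Q) ` tropical_line"
proof -
  have "\<exists>B b C. lattice_iso B \<and> C > 0 \<and> (\<forall>x. norm (B x) \<le> C * norm x) \<and>
      (\<forall>x. norm (adjoint (inv B) x) \<le> C * norm x) \<and>
      (\<forall>s m t. s > 0 \<longrightarrow> mins m \<subseteq> verts Q \<longrightarrow>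
      ((m, t) \<in> PL_lift P \<nu> \<P> \<longleftrightarrow> (m, t) \<in> aff_map (dual_vertex Q) s B b ` tropical_line))" if Q: "Q \<in> \<P>" for Q
  proof -
    obtain v0 v1 v2 where u: "unimodular_triangle v0 v1 v2" and Qe: "Q = convex hull {v0, v1, v2}"
      by (rule triangle[OF Q])
    interpret unimodular_triangle v0 v1 v2 by (rule u)
    obtain C1 where C1: "C1 > 0" "\<And>x. norm (B x) \<le> C1 * norm x"
      using linear_bounded_pos[OF linear_frame] by blast
    obtain C2 where C2: "C2 > 0" "\<And>x. norm (adjoint (inv B) x) \<le> C2 * norm x"
      using linear_bounded_pos[OF linear_adjoint_inv[OF B]] by blast
    have C12: "norm (B x) \<le> (C1 + C2) * norm x" "norm (adjoint (inv B) x) \<le> (C1 + C2) * norm x" for x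
    proof -
      have "0 \<le> C1 * norm x" "0 \<le> C2 * norm x" using C1(1) C2(1) by simp_all
      then show "norm (B x) \<le> (C1 + C2) * norm x" "norm (adjoint (inv B) x) \<le> (C1 + C2) * norm x"
        using C1(2)[of x] C2(2)[of x] unfolding distrib_right by linarith+
    qed
    show ?thesis
    proof (intro exI conjI allI impI)
      show "lattice_iso B" by (rule B)
      show "C1 + C2 > 0" using C1(1) C2(1) by linarith
      show "norm (B x) \<le> (C1 + C2) * norm x" "norm (adjoint (inv B) x) \<le> (C1 + C2) * norm x" for x
        by (rule C12)+
      show "(m, t) \<in> PL_lift P \<nu> \<P> \<longleftrightarrow> (m, t) \<in> aff_map (dual_vertex Q) s B ((1 / 2) *\<^sub>R v0) ` tropical_line"
        if "s > 0" "mins m \<subseteq> verts Q" for s m t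
        by (rule PL_lift_at_vertex[OF Q u Qe that(2,1)])
    qed
  qed
  then obtain B b Cf where f: "\<And>Q. Q \<in> \<P> \<Longrightarrow> lattice_iso (B Q) \<and> Cf Q > (0 :: real) \<and> (\<forall>x. norm (B Q x) \<le> Cf Q * norm x) \<and>
      (\<forall>x. norm (adjoint (inv (B Q)) x) \<le> Cf Q * norm x) \<and>
      (\<forall>s m t. s > 0 \<longrightarrow> mins m \<subseteq> verts Q \<longrightarrow>
      ((m, t) \<in> PL_lift P \<nu> \<P> \<longleftrightarrow> (m, t) \<in> aff_map (dual_vertex Q) s (B Q) (b Q) ` tropical_line))"
    by metis
  define C where "C = 1 + sum Cf \<P>"
  have le: "Cf Q \<le> C" if "Q \<in> \<P>" for Q
  proof -
    have "Cf Q \<le> sum Cf \<P>" using f that finite_cells by (intro member_le_sum) (auto intro: less_imp_le)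
    then show ?thesis by (simp add: C_def)
  qed
  have "0 \<le> sum Cf \<P>" using f by (intro sum_nonneg) (auto intro: less_imp_le)
  then have "C > 0" by (simp add: C_def)
  have mono: "y \<le> C * norm x" if "Q \<in> \<P>" "y \<le> Cf Q * norm x" for Q y and x :: NR
    using that(2) mult_right_mono[OF le[OF that(1)], of "norm x"] by simp
  show thesis
  proof (rule that[of B C b])
    show "lattice_iso (B Q)" if "Q \<in> \<P>" for Q using f[OF that] by (rule conjunct1)
    show "C > 0" by fact
    show "norm (B Q x) \<le> C * norm x" if "Q \<in> \<P>" for Q x
      by (rule mono[OF that]) (use f[OF that] in simp)
    show "norm (adjoint (inv (B Q)) x) \<le> C * norm x" if "Q \<in> \<P>" for Q x
      by (rule mono[OF that]) (use f[OF that] in simp)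
    show "(m, t) \<in> PL_lift P \<nu> \<P> \<longleftrightarrow> (m, t) \<in> aff_map (dual_vertex Q) s (B Q) (b Q) ` tropical_line"
      if "Q \<in> \<P>" "s > 0" "mins m \<subseteq> verts Q" for Q s m t
      using f[OF that(1)] that(2,3) by (elim conjE allE impE)
  qed
qed

text \<open>The model for precision \<open>t\<close> is scaled such that the part on which it differs from the tropical line
  lies within distance \<open>\<rho> t\<close> of the vertex. The error in \<open>M\<^sub>\<real>\<close> is at most the diameter of this part;
  the error in the torus is at most the Lipschitz constant of the frame times \<open>t\<close>. For points of the
  PL lift that were removed, the model has a point with the same torus coordinate, because it
  covers the whole fibre over the vertex.\<close>

lemma smoothing:
  obtains D where "\<And>t. 0 < t \<Longrightarrow> t \<le> 1 \<Longrightarrow> \<exists>L. lagrangian_submanifold L \<and>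
    L homeomorphic PL_lift P \<nu> \<P> \<and> (\<forall>\<epsilon>>D * t. hausdorff_close \<epsilon> L (PL_lift P \<nu> \<P>))"
proof -
  obtain \<rho> where \<rho>: "\<rho> > 0"
    "\<And>Q m. Q \<in> \<P> \<Longrightarrow> dist m (dual_vertex Q) < 2 * \<rho> \<Longrightarrow> mins m \<subseteq> verts Q"
    "\<And>Q Q'. Q \<in> \<P> \<Longrightarrow> Q' \<in> \<P> \<Longrightarrow> Q \<noteq> Q' \<Longrightarrow> 4 * \<rho> \<le> dist (dual_vertex Q) (dual_vertex Q')"
    by (rule separating_radius) (rule that)
  obtain B b C where B: "\<And>Q. Q \<in> \<P> \<Longrightarrow> lattice_iso (B Q)" and C: "C > 0"
    "\<And>Q x. Q \<in> \<P> \<Longrightarrow> norm (B Q x) \<le> C * norm x"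
    "\<And>Q x. Q \<in> \<P> \<Longrightarrow> norm (adjoint (inv (B Q)) x) \<le> C * norm x"
    and chart: "\<And>Q s m t. Q \<in> \<P> \<Longrightarrow> s > 0 \<Longrightarrow> mins m \<subseteq> verts Q \<Longrightarrow>
      (m, t) \<in> PL_lift P \<nu> \<P> \<longleftrightarrow> (m, t) \<in> aff_map (dual_vertex Q) s (B Q) (b Q) ` tropical_line"
    by (rule vertex_charts) (rule that)
  define PL where "PL = PL_lift P \<nu> \<P>"
  define V where "V Q = {a :: MR \<times> torus. dist (fst a) (dual_vertex Q) < 2 * \<rho>}" for Q
  define K where "K Q = {a :: MR \<times> torus. dist (fst a) (dual_vertex Q) \<le> \<rho>}" for Q
  have oV: "open (V Q)" for Q unfolding V_def by (intro open_Collect_less continuous_intros)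
  have cK: "closed (K Q)" for Q unfolding K_def by (intro closed_Collect_le continuous_intros)
  have KV: "K Q \<subseteq> V Q" for Q using \<rho>(1) by (auto simp: K_def V_def)
  have cKK: "closed (\<Union>Q\<in>\<P>. K Q)" using finite_cells cK by (intro closed_UN) auto
  have disj: "V Q \<inter> V Q' = {}" if "Q \<in> \<P>" "Q' \<in> \<P>" "Q \<noteq> Q'" for Q Q'
  proof -
    have "\<not> (dist (fst a) (dual_vertex Q) < 2 * \<rho> \<and> dist (fst a) (dual_vertex Q') < 2 * \<rho>)" for a :: "MR \<times> torus"
      using dist_triangle2[of "dual_vertex Q" "dual_vertex Q'" "fst a"] \<rho>(3)[OF that]
      by (auto simp: dist_commute)
    then show ?thesis by (auto simp: V_def)
  qed
  have step: "\<exists>L. lagrangian_submanifold L \<and> L homeomorphic PL \<and>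
    (\<forall>\<epsilon>>(3 * \<rho> + C) * t. hausdorff_close \<epsilon> L PL)" if t: "0 < t" "t \<le> 1" for t
  proof -
    obtain S h k r where S: "lagrangian_submanifold S" and hk: "homeomorphism S tropical_line h k" and r: "r > 0"
      and h_id: "\<And>a. a \<in> S \<Longrightarrow> norm (fst a) \<ge> r \<Longrightarrow> h a = a"
      and T_id: "\<And>a. a \<in> tropical_line \<Longrightarrow> norm (fst a) \<ge> r \<Longrightarrow> a \<in> S \<and> h a = a"
      and close1: "\<And>a. a \<in> S \<Longrightarrow> \<exists>\<tau>. (0, \<tau>) \<in> tropical_line \<and> dist (snd a) \<tau> < t"
      and close2: "\<And>\<tau>. (0, \<tau>) \<in> tropical_line \<Longrightarrow> \<exists>m. (m, \<tau>) \<in> S \<and> norm m < r"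
      by (rule smoothing_of_tropical_line[OF t(1)]) (rule that)
    \<comment> \<open>The frame stretches \<open>M\<^sub>\<real>\<close> by at most \<open>C\<close>, so radius \<open>r\<close> becomes at most \<open>\<rho> t\<close>.\<close>
    define s where "s = \<rho> * t / (C * r)"
    have s: "s > 0" using \<rho> t C r by (simp add: s_def)
    define A where "A Q = adjoint (inv (B Q))" for Q
    define F where "F Q = aff_map (dual_vertex Q) s (B Q) (b Q)" for Q
    have fstF: "fst (F Q a) = dual_vertex Q + s *\<^sub>R A Q (fst a)" for Q a
      by (simp add: F_def aff_map_def A_def)
    have A_small: "norm (s *\<^sub>R A Q x) \<le> \<rho> * t" if "Q \<in> \<P>" "norm x \<le> r" for Q x
    proof -
      have "norm (A Q x) \<le> C * r"
        using C(3)[OF that(1), of x] mult_left_mono[OF that(2), of C] C(1) unfolding A_def by linarith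
      then have "s * norm (A Q x) \<le> s * (C * r)" using s by (intro mult_left_mono) auto
      also have "\<dots> = \<rho> * t" using C r by (simp add: s_def)
      finally show ?thesis using s by simp
    qed
    have \<rho>t: "\<rho> * t \<le> \<rho>" using \<rho>(1) t mult_left_mono[of t 1 \<rho>] by simp
    have inK: "F Q a \<in> K Q" if "Q \<in> \<P>" "norm (fst a) < r" for Q a
      using A_small[of Q "fst a"] that \<rho>t by (simp add: K_def fstF dist_norm)
    have "\<exists>g. (\<forall>a. g (F Q a) = a) \<and> (\<forall>a. F Q (g a) = a) \<and> continuous_on UNIV g" if Q: "Q \<in> \<P>" for Q
    proof -
      obtain g where "\<And>a. g (aff_map (dual_vertex Q) s (B Q) (b Q) a) = a"
        "\<And>a. aff_map (dual_vertex Q) s (B Q) (b Q) (g a) = a" "continuous_on UNIV g"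
        by (rule aff_map_homeomorphism[OF B[OF Q] less_imp_neq[OF s, symmetric], where c = "dual_vertex Q" and b = "b Q"])
          (rule that)
      then show ?thesis by (intro exI[of _ g]) (simp add: F_def)
    qed
    then obtain G where G: "\<And>Q a. Q \<in> \<P> \<Longrightarrow> G Q (F Q a) = a" "\<And>Q a. Q \<in> \<P> \<Longrightarrow> F Q (G Q a) = a"
      "\<And>Q. Q \<in> \<P> \<Longrightarrow> continuous_on UNIV (G Q)" by metis
    have PLV: "a \<in> PL \<longleftrightarrow> a \<in> F Q ` tropical_line" if "Q \<in> \<P>" "a \<in> V Q" for Q a
    proof -
      have "dist (fst a) (dual_vertex Q) < 2 * \<rho>" using that(2) by (simp add: V_def)
      from chart[OF that(1) s \<rho>(2)[OF that(1) this], of "snd a"] show ?thesis by (simp add: PL_def F_def)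
    qed
    define L where "L = {a. (\<exists>Q\<in>\<P>. a \<in> V Q \<and> a \<in> F Q ` S) \<or> (a \<in> PL \<and> (\<forall>Q\<in>\<P>. a \<notin> V Q))}"
    have LV: "a \<in> L \<longleftrightarrow> a \<in> F Q ` S" if "Q \<in> \<P>" "a \<in> V Q" for Q a
    proof -
      have "Q' = Q" if Q': "Q' \<in> \<P>" "a \<in> V Q'" for Q'
        using disj[OF Q'(1) \<open>Q \<in> \<P>\<close>] Q'(2) \<open>a \<in> V Q\<close> by blast
      then show ?thesis unfolding L_def mem_Collect_eq using that by blast
    qed
    have far: "F Q c \<in> F Q ` S \<longleftrightarrow> c \<in> S" "F Q c \<in> F Q ` tropical_line \<longleftrightarrow> c \<in> tropical_line" if "Q \<in> \<P>" for Q c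
    proof -
      have "inj (F Q)" by (rule inj_on_inverseI[of _ "G Q"]) (rule G(1)[OF that])
      then show "F Q c \<in> F Q ` S \<longleftrightarrow> c \<in> S" "F Q c \<in> F Q ` tropical_line \<longleftrightarrow> c \<in> tropical_line"
        by (rule inj_image_mem_iff)+
    qed
    have ST: "c \<in> S \<longleftrightarrow> c \<in> tropical_line" if "norm (fst c) \<ge> r" for c
    proof
      assume c: "c \<in> S"
      then have "h c \<in> tropical_line" using homeomorphism_image1[OF hk] by blast
      then show "c \<in> tropical_line" using h_id[OF c that] by simp
    qed (use T_id[OF _ that] in simp)
    have offV: "a \<in> L \<longleftrightarrow> a \<in> PL" if "Q \<in> \<P>" "a \<in> V Q" "a \<notin> K Q" for Q a
    proof -
      have "norm (fst (G Q a)) \<ge> r"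
        using inK[OF that(1), of "G Q a"] that(3) unfolding G(2)[OF that(1)] by (intro leI notI) blast
      then have "G Q a \<in> S \<longleftrightarrow> G Q a \<in> tropical_line" by (rule ST)
      then show ?thesis
        using LV[OF that(1,2)] PLV[OF that(1,2)] far[OF that(1), of "G Q a"] G(2)[OF that(1)] by simp
    qed
    have off: "a \<in> L \<longleftrightarrow> a \<in> PL" if "a \<notin> (\<Union>Q\<in>\<P>. K Q)" for a
    proof (cases "\<exists>Q\<in>\<P>. a \<in> V Q")
      case True
      then show ?thesis using offV that by blast
    qed (auto simp: L_def)
    have lag: "lagrangian_submanifold L"
      unfolding lagrangian_submanifold_iff
    proof
      fix p assume p: "p \<in> L"
      show "lagrangian_at L p"
      proof (cases "\<exists>Q\<in>\<P>. p \<in> V Q")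
        case True
        then obtain Q where Q: "Q \<in> \<P>" "p \<in> V Q" by blast
        then obtain c where c: "c \<in> S" "p = F Q c" using LV[OF Q] p by blast
        have "lagrangian_at (F Q ` S) p"
          unfolding c(2) F_def using S c(1) s
          by (intro lagrangian_at_aff_map B Q(1)) (auto simp: lagrangian_submanifold_iff)
        moreover have "F Q ` S \<inter> V Q = L \<inter> V Q"
          unfolding set_eq_iff Int_iff by (intro allI rev_conj_cong refl LV[OF Q(1), symmetric])
        ultimately show ?thesis by (rule lagrangian_at_local[OF _ oV Q(2)])
      next
        case False
        then have pK: "p \<in> - (\<Union>Q\<in>\<P>. K Q)" using KV by blast
        then have pPL: "(fst p, snd p) \<in> PL_lift P \<nu> \<P>" using off p by (simp add: PL_def)
        have "fst p \<noteq> dual_vertex Q" if "Q \<in> \<P>" for Q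
          using False that \<rho>(1) by (auto simp: V_def)
        from lagrangian_at_PL_lift[OF pPL this] have "lagrangian_at PL p" by (simp add: PL_def)
        moreover have "PL \<inter> - (\<Union>Q\<in>\<P>. K Q) = L \<inter> - (\<Union>Q\<in>\<P>. K Q)"
          unfolding set_eq_iff Int_iff Compl_iff by (intro allI rev_conj_cong refl off[symmetric])
        ultimately show ?thesis by (rule lagrangian_at_local[OF _ open_Compl[OF cKK] pK])
      qed
    qed
    have hom: "L homeomorphic PL"
    proof (subst homeomorphic_sym, rule homeomorphic_patch[where I = \<P> and V = V and K = K
          and h = "\<lambda>Q a. F Q (k (G Q a))" and k = "\<lambda>Q a. F Q (h (G Q a))"])
      show "open (V Q)" for Q by (rule oV)
      show "V Q \<inter> V Q' = {}" if "Q \<in> \<P>" "Q' \<in> \<P>" "Q \<noteq> Q'" for Q Q' using disj that by blast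
      show "closed (\<Union>Q\<in>\<P>. K Q)" by (rule cKK)
      show "K Q \<subseteq> V Q" for Q by (rule KV)
      show "PL - (\<Union>Q\<in>\<P>. K Q) = L - (\<Union>Q\<in>\<P>. K Q)"
        unfolding set_eq_iff Diff_iff by (intro allI rev_conj_cong refl off[symmetric])
      have kS: "k c \<in> S" "h (k c) = c" if "c \<in> tropical_line" for c
        using homeomorphism_image2[OF hk] homeomorphism_apply2[OF hk] that by auto
      have hT: "h c \<in> tropical_line" "k (h c) = c" if "c \<in> S" for c
        using homeomorphism_image1[OF hk] homeomorphism_apply1[OF hk] that by auto
      have k_id: "k c = c" if "c \<in> tropical_line" "norm (fst c) \<ge> r" for c
        using T_id[OF that] hT[of c] by simp
      have k_small: "norm (fst (k c)) < r" if "c \<in> tropical_line" "norm (fst c) < r" for c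
      proof (rule ccontr)
        assume "\<not> norm (fst (k c)) < r"
        then have "h (k c) = k c" using h_id[OF kS(1)[OF that(1)]] by simp
        then show False using kS(2)[OF that(1)] that(2) \<open>\<not> norm (fst (k c)) < r\<close> by simp
      qed
      have h_small: "norm (fst (h c)) < r" if "c \<in> S" "norm (fst c) < r" for c
      proof (rule ccontr)
        assume "\<not> norm (fst (h c)) < r"
        then have "k (h c) = h c" using k_id[OF hT(1)[OF that(1)]] by simp
        then show False using hT(2)[OF that(1)] that(2) \<open>\<not> norm (fst (h c)) < r\<close> by simp
      qed
      show "F Q (k (G Q a)) = a" if Q: "Q \<in> \<P>" and a: "a \<in> PL \<inter> V Q - K Q" for Q a
      proof -
        have "norm (fst (G Q a)) \<ge> r"
          using inK[OF Q, of "G Q a"] a unfolding G(2)[OF Q] by (intro leI notI) blast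
        moreover have "G Q a \<in> tropical_line"
          using PLV[OF Q, of a] a far(2)[OF Q, of "G Q a"] G(2)[OF Q] by simp
        ultimately show ?thesis using k_id G(2)[OF Q] by simp
      qed
      show "homeomorphism (PL \<inter> V Q) (L \<inter> V Q) (\<lambda>a. F Q (k (G Q a))) (\<lambda>a. F Q (h (G Q a)))" if Q: "Q \<in> \<P>" for Q
      proof (rule homeomorphismI)
        have Fc: "continuous_on UNIV (F Q)" unfolding F_def by (rule continuous_on_aff_map[OF B[OF Q]])
        have GT: "G Q a \<in> tropical_line" if "a \<in> PL \<inter> V Q" for a
          using PLV[OF Q, of a] that far(2)[OF Q, of "G Q a"] G(2)[OF Q] by simp
        have GS: "G Q a \<in> S" if "a \<in> L \<inter> V Q" for a
          using LV[OF Q, of a] that far(1)[OF Q, of "G Q a"] G(2)[OF Q] by simp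
        have ck: "continuous_on (PL \<inter> V Q) (\<lambda>a. k (G Q a))"
          by (rule continuous_on_compose2[OF homeomorphism_cont2[OF hk] continuous_on_subset[OF G(3)[OF Q]]])
            (use GT in auto)
        show "continuous_on (PL \<inter> V Q) (\<lambda>a. F Q (k (G Q a)))"
          by (rule continuous_on_compose2[OF Fc ck]) simp
        have ch: "continuous_on (L \<inter> V Q) (\<lambda>a. h (G Q a))"
          by (rule continuous_on_compose2[OF homeomorphism_cont1[OF hk] continuous_on_subset[OF G(3)[OF Q]]])
            (use GS in auto)
        show "continuous_on (L \<inter> V Q) (\<lambda>a. F Q (h (G Q a)))"
          by (rule continuous_on_compose2[OF Fc ch]) simp
        show "(\<lambda>a. F Q (k (G Q a))) ` (PL \<inter> V Q) \<subseteq> L \<inter> V Q"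
        proof (rule image_subsetI)
          fix a assume a: "a \<in> PL \<inter> V Q"
          have v: "F Q (k (G Q a)) \<in> V Q"
          proof (cases "norm (fst (G Q a)) < r")
            case True
            then show ?thesis using inK[OF Q k_small[OF GT[OF a]]] KV by blast
          next
            case False
            then show ?thesis using k_id[OF GT[OF a]] a G(2)[OF Q] by simp
          qed
          show "F Q (k (G Q a)) \<in> L \<inter> V Q"
            using LV[OF Q v] far(1)[OF Q] kS(1)[OF GT[OF a]] v by simp
        qed
        show "(\<lambda>a. F Q (h (G Q a))) ` (L \<inter> V Q) \<subseteq> PL \<inter> V Q"
        proof (rule image_subsetI)
          fix a assume a: "a \<in> L \<inter> V Q"
          have v: "F Q (h (G Q a)) \<in> V Q"
          proof (cases "norm (fst (G Q a)) < r")
            case True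
            then show ?thesis using inK[OF Q h_small[OF GS[OF a]]] KV by blast
          next
            case False
            then show ?thesis using h_id[OF GS[OF a]] a G(2)[OF Q] by simp
          qed
          show "F Q (h (G Q a)) \<in> PL \<inter> V Q"
            using PLV[OF Q v] far(2)[OF Q] hT(1)[OF GS[OF a]] v by simp
        qed
        show "F Q (h (G Q (F Q (k (G Q a))))) = a" if "a \<in> PL \<inter> V Q" for a
          using kS(2)[OF GT[OF that]] G(1,2)[OF Q] by simp
        show "F Q (k (G Q (F Q (h (G Q a))))) = a" if "a \<in> L \<inter> V Q" for a
          using hT(2)[OF GS[OF that]] G(1,2)[OF Q] by simp
      qed
    qed
    have close: "hausdorff_close \<epsilon> L PL" if \<epsilon>: "\<epsilon> > (3 * \<rho> + C) * t" for \<epsilon>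
      unfolding hausdorff_close_def
    proof (intro conjI ballI)
      have \<epsilon>': "3 * (\<rho> * t) + C * t < \<epsilon>" using \<epsilon> by (simp add: algebra_simps)
      have nn: "0 < \<rho> * t" "0 < C * t" using \<rho>(1) C(1) t by simp_all
      have \<epsilon>0: "0 < \<epsilon>" using \<epsilon>' nn by linarith
      have T0: "F Q (0, \<tau>) \<in> PL" if "Q \<in> \<P>" "(0, \<tau>) \<in> tropical_line" for Q \<tau>
      proof -
        have "F Q (0, \<tau>) \<in> V Q" using inK[OF that(1), of "(0, \<tau>)"] r KV by auto
        from PLV[OF that(1) this] show ?thesis using far(2)[OF that(1)] that(2) by simp
      qed
      fix a assume a: "a \<in> L"
      show "\<exists>b\<in>PL. dist a b < \<epsilon>"
      proof (cases "a \<in> PL")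
        case True
        then show ?thesis using \<epsilon>0 by (intro bexI[of _ a]) auto
      next
        case False
        then obtain Q where Q: "Q \<in> \<P>" "a \<in> K Q" using off[of a] a by blast
        then have aV: "a \<in> V Q" using KV by blast
        then obtain c where c: "c \<in> S" "a = F Q c" using LV[OF Q(1) aV] a by blast
        have cr: "norm (fst c) < r"
        proof (rule ccontr)
          assume "\<not> norm (fst c) < r"
          then have "c \<in> tropical_line" using ST[of c] c(1) by simp
          then show False using PLV[OF Q(1) aV] far(2)[OF Q(1), of c] c(2) False by simp
        qed
        obtain \<tau> where \<tau>: "(0, \<tau>) \<in> tropical_line" "dist (snd c) \<tau> < t" using close1[OF c(1)] by blast
        have "dist (fst a) (fst (F Q (0, \<tau>))) \<le> \<rho> * t"
          using A_small[OF Q(1), of "fst c"] cr linear_0[OF linear_adjoint_inv[OF B[OF Q(1)]]]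
          by (simp add: c(2) fstF dist_norm A_def)
        moreover have "dist (snd a) (snd (F Q (0, \<tau>))) \<le> C * dist (snd c) (snd (0 :: MR, \<tau>))"
          unfolding c(2) F_def by (rule dist_snd_aff_map[OF B[OF Q(1)] C(2)[OF Q(1)] less_imp_le[OF C(1)]])
        moreover have "C * dist (snd c) (snd (0 :: MR, \<tau>)) \<le> C * t"
          using \<tau>(2) C(1) by (intro mult_left_mono) auto
        ultimately have "dist a (F Q (0, \<tau>)) < \<epsilon>"
          using dist_prod_le[of a "F Q (0, \<tau>)"] \<epsilon>' nn by linarith
        then show ?thesis using T0[OF Q(1) \<tau>(1)] by blast
      qed
    next
      have \<epsilon>': "3 * (\<rho> * t) + C * t < \<epsilon>" using \<epsilon> by (simp add: algebra_simps)
      have nn: "0 < \<rho> * t" "0 < C * t" using \<rho>(1) C(1) t by simp_all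
      have \<epsilon>0: "0 < \<epsilon>" using \<epsilon>' nn by linarith
      fix a assume a: "a \<in> PL"
      show "\<exists>b\<in>L. dist b a < \<epsilon>"
      proof (cases "a \<in> L")
        case True
        then show ?thesis using \<epsilon>0 by (intro bexI[of _ a]) auto
      next
        case False
        then obtain Q where Q: "Q \<in> \<P>" "a \<in> K Q" using off[of a] a by blast
        then have aV: "a \<in> V Q" using KV by blast
        then obtain c where c: "c \<in> tropical_line" "a = F Q c" using PLV[OF Q(1) aV] a by blast
        have cr: "norm (fst c) < r"
        proof (rule ccontr)
          assume "\<not> norm (fst c) < r"
          then have "c \<in> S" using ST[of c] c(1) by simp
          then show False using LV[OF Q(1) aV] far(1)[OF Q(1), of c] c(2) False by simp
        qed
        have "(0, snd c) \<in> tropical_line" using tropical_line_retract[of "fst c" "snd c"] c(1) by simp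
        then obtain m where m: "(m, snd c) \<in> S" "norm m < r" using close2 by blast
        have "F Q (m, snd c) \<in> V Q" using inK[OF Q(1), of "(m, snd c)"] m(2) KV by auto
        then have "F Q (m, snd c) \<in> L" using LV[OF Q(1)] far(1)[OF Q(1)] m(1) by simp
        moreover have "dist (F Q (m, snd c)) a < \<epsilon>"
        proof -
          have "fst (F Q (m, snd c)) - fst a = s *\<^sub>R A Q m - s *\<^sub>R A Q (fst c)"
            unfolding c(2) fstF by simp
          then have "dist (fst (F Q (m, snd c))) (fst a) \<le> norm (s *\<^sub>R A Q m) + norm (s *\<^sub>R A Q (fst c))"
            unfolding dist_norm by (simp only: norm_triangle_ineq4)
          also have "\<dots> \<le> \<rho> * t + \<rho> * t"
            using A_small[OF Q(1), of m] A_small[OF Q(1), of "fst c"] m(2) cr by linarith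
          finally have "dist (fst (F Q (m, snd c))) (fst a) \<le> \<rho> * t + \<rho> * t" .
          moreover have "snd (F Q (m, snd c)) = snd a" unfolding c(2) by (simp add: F_def aff_map_def)
          ultimately show ?thesis
            using dist_prod_le[of "F Q (m, snd c)" a] \<epsilon>' nn by simp
        qed
        ultimately show ?thesis by blast
      qed
    qed
    show ?thesis
    proof (intro exI conjI allI impI)
      show "lagrangian_submanifold L" by (rule lag)
      show "L homeomorphic PL" by (rule hom)
      show "hausdorff_close \<epsilon> L PL" if "\<epsilon> > (3 * \<rho> + C) * t" for \<epsilon> by (rule close[OF that])
    qed
  qed
  show thesis by (rule that[OF step[unfolded PL_def]])
qed

end

theorem theorem4p1:
  fixes P :: "NR set" and \<nu> :: "NR \<Rightarrow> real" and \<P> :: "NR set set" and \<Xi> :: "MR set"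
  assumes "lattice_polytope P"
    and "regular_subdivision P \<nu> \<P>"
    and "unimodal \<P>"
    and "\<Xi> = tropical_curve P \<nu>"
  shows "\<exists>\<L> :: real \<Rightarrow> (MR \<times> torus) set.
           (\<forall>t\<in>{0<..1}. lagrangian_submanifold (\<L> t)) \<and>
           (\<forall>t\<in>{0<..1}. \<L> t homeomorphic PL_lift P \<nu> \<P>) \<and>
           hausdorff_converges \<L> (PL_lift P \<nu> \<P>) (at_right 0)"
proof -
  interpret unimodal_subdivision P \<nu> \<P>
    by unfold_locales (use assms in auto)
  obtain D where "\<And>t. 0 < t \<Longrightarrow> t \<le> 1 \<Longrightarrow> \<exists>L. lagrangian_submanifold L \<and>
    L homeomorphic PL_lift P \<nu> \<P> \<and> (\<forall>\<epsilon>>D * t. hausdorff_close \<epsilon> L (PL_lift P \<nu> \<P>))"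
    by (rule smoothing) (rule that)
  then obtain \<L> where \<L>: "\<And>t. 0 < t \<Longrightarrow> t \<le> 1 \<Longrightarrow> lagrangian_submanifold (\<L> t) \<and>
    \<L> t homeomorphic PL_lift P \<nu> \<P> \<and> (\<forall>\<epsilon>>D * t. hausdorff_close \<epsilon> (\<L> t) (PL_lift P \<nu> \<P>))"
    by metis
  have "hausdorff_converges \<L> (PL_lift P \<nu> \<P>) (at_right 0)"
    unfolding hausdorff_converges_def
  proof (intro allI impI)
    fix \<epsilon> :: real assume \<epsilon>: "\<epsilon> > 0"
    have "((\<lambda>t. D * t) \<longlongrightarrow> D * 0) (at_right 0)" by (intro tendsto_intros)
    then have "\<forall>\<^sub>F t in at_right 0. D * t < \<epsilon>" using \<epsilon> by (intro order_tendstoD(2)) auto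
    moreover have "\<forall>\<^sub>F t in at_right 0. t \<in> {0<..<1::real}" by (rule eventually_at_right_real) simp
    ultimately show "\<forall>\<^sub>F t in at_right 0. hausdorff_close \<epsilon> (\<L> t) (PL_lift P \<nu> \<P>)"
      by eventually_elim (use \<L> in auto)
  qed
  then show ?thesis using \<L> by (intro exI[of _ \<L>]) auto
qed

end
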